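(* Let $d\ge2$, $s>d/2$, and let $\mathbb{H}^s(\mathbb{S}^d)$ be equipped with the norm $\|\cdot\|_{\mathbb{H}^s}$ determined by a sequence $(a_\ell^{(s)})_{\ell\ge0}$ of positive reals with $a_\ell^{(s)}\asymp(1+\lambda_\ell)^{-s}$. For integers $t\ge1$ let $$\mathcal{K}_t^{(s)}(\mathbf{x}\cdot\mathbf{y})=\sum_{\ell=1}^{t}a_\ell^{(s)}Z(d,\ell)P_\ell^{(d)}(\mathbf{x}\cdot\mathbf{y}),\qquad\mathbf{x},\mathbf{y}\in\mathbb{S}^d.$$ Let $(X_N)$, $X_N=\{\mathbf{x}_{1,N},\dots,\mathbf{x}_{N,N}\}$, be a sequence of $N$-point configurations on $\mathbb{S}^d$ satisfying Property R, and let $t=t(N)$ be positive integers with $t\asymp N^{1/d}$. Then $(X_N)$ is a sequence of QMC designs for $\mathbb{H}^s(\mathbb{S}^d)$ if and only if $$\frac1{N^2}\sum_{j=1}^N\sum_{i=1}^N\mathcal{K}_t^{(s)}(\mathbf{x}_{j,N}\cdot\mathbf{x}_{i,N})=\mathcal{O}(N^{-2s/d})\qquad\text{as }N\to\infty.$$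
   Context: $\mathbb{S}^d$ is the unit sphere in $\mathbb{R}^{d+1}$, $d\ge 2$, and $\sigma_d$ is its normalized surface measure ($\sigma_d(\mathbb{S}^d)=1$). Let $\{Y_{\ell,k}:k=1,\dots,Z(d,\ell)\}$ be an $\mathbb{L}_2(\mathbb{S}^d,\sigma_d)$-orthonormal family of real spherical harmonics of exact degree $\ell$, where $Z(d,\ell)=(2\ell+d-1)\frac{\Gamma(\ell+d-1)}{\Gamma(d)\Gamma(\ell+1)}$, and let $\lambda_\ell=\ell(\ell+d-1)$, $\ell\ge 0$. $P_\ell^{(d)}$ is the Gegenbauer polynomial of degree $\ell$, orthogonal on $[-1,1]$ with respect to the weight $(1-t^2)^{d/2-1}$ and normalized by $P_\ell^{(d)}(1)=1$. For $f\in \mathbb{L}_2(\mathbb{S}^d)$ put $\widehat f_{\ell,k}=\int_{\mathbb{S}^d} f\,Y_{\ell,k}\,\mathrm{d}\sigma_d$. For $s>d/2$ the Sobolev space $\mathbb{H}^s(\mathbb{S}^d)$ is the set of $f\in \mathbb{L}_2(\mathbb{S}^d)$ with $\sum_{\ell=0}^\infty\sum_{k=1}^{Z(d,\ell)}(1+\lambda_\ell)^s|\widehat f_{\ell,k}|^2<\infty$ (embedded in $C(\mathbb{S}^d)$), with norm $\|f\|_{\mathbb{H}^s}=\big[\sum_{\ell=0}^\infty\sum_{k=1}^{Z(d,\ell)}\frac{1}{a_\ell^{(s)}}|\widehat f_{\ell,k}|^2\big]^{1/2}$. Here $a_n\asymp b_n$ means $c_1a_n\le b_n\le c_2a_n$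 for all $n$ with positive constants $c_1,c_2$ independent of $n$. A sequence $(X_N)$ of $N$-point configurations on $\mathbb{S}^d$ ($N$ in an infinite subset of the natural numbers) is a sequence of QMC designs for $\mathbb{H}^s(\mathbb{S}^d)$ if there exists $c(s,d)>0$ independent of $N$ such that $$\sup_{f\in\mathbb{H}^s(\mathbb{S}^d),\ \|f\|_{\mathbb{H}^s}\le1}\Big|\frac1N\sum_{\mathbf{x}\in X_N}f(\mathbf{x})-\int_{\mathbb{S}^d}f\,\mathrm{d}\sigma_d\Big|\le\frac{c(s,d)}{N^{s/d}}.$$ Property R: a sequence $(Z_N)$ of $N$-point configurations on $\mathbb{S}^d$ has Property R if there exist positive numbers $c_0,c_1$ independent of $N$ such that for all $Z_N$ and all $\mathbf{z}\in\mathbb{S}^d$, $|Z_N\cap\mathcal{C}(\mathbf{z};c_1N^{-1/d})|\le c_0$, where $\mathcal{C}(\mathbf{z};\theta)=\{\mathbf{y}\in\mathbb{S}^d:\mathbf{y}\cdot\mathbf{z}\ge\cos\theta\}$. *)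

theory Defs
  imports
    "HOL-Analysis.Analysis"
    "HOL-Computational_Algebra.Polynomial"
    "HOL-Library.Landau_Symbols"
begin

subsection \<open>The sphere and its normalized surface measure\<close>

text \<open>
  The unit sphere of \<^typ>\<open>'a::euclidean_space\<close> has dimension \<open>d = DIM('a) - 1\<close>. Its normalized surface
  measure is the cone measure: the image of the uniform distribution on the unit ball under
  radial projection. The origin, where the projection leaves the sphere, is a null set.
\<close>

definition sphere_measure :: "'a::euclidean_space measure" where
  "sphere_measure =
     restrict_space (distr (uniform_measure lborel (ball 0 1)) borel (\<lambda>x. x /\<^sub>R norm x)) (sphere 0 1)"

lemma space_sphere_measure: "space sphere_measure = sphere 0 1"
  by (simp add: sphere_measure_def space_restrict_space)

lemma emeasure_sphere_measure:
  "emeasure sphere_measure (sphere 0 1 :: 'a::euclidean_space set) = 1"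
proof -
  let ?B = "ball 0 1 :: 'a set" and ?U = "uniform_measure lborel (ball 0 1 :: 'a set)"
  let ?g = "\<lambda>x::'a. x /\<^sub>R norm x"
  have pos: "emeasure lborel ?B > 0"
    using content_ball_pos[of 1 "0::'a"] emeasure_lborel_ball_finite[of "0::'a" 1]
    by (simp add: measure_def enn2real_positive_iff)
  have fin: "emeasure lborel ?B < \<infinity>"
    using emeasure_lborel_ball_finite[of "0::'a" 1] by simp
  have [measurable]: "?g \<in> borel_measurable borel" by measurable
  have pre: "?g -` sphere 0 1 = UNIV - {0}"
    by auto
  have null: "emeasure lborel (?B \<inter> (UNIV - {0})) = emeasure lborel ?B"
  proof -
    have "emeasure lborel (?B - {0}) = emeasure lborel ?B - emeasure lborel {0::'a}"
      by (intro emeasure_Diff) auto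
    moreover have "?B \<inter> (UNIV - {0}) = ?B - {0}" by blast
    ultimately show ?thesis by simp
  qed
  have "emeasure sphere_measure (sphere 0 1 :: 'a set) = emeasure (distr ?U borel ?g) (sphere 0 1)"
    unfolding sphere_measure_def
    by (subst emeasure_restrict_space) (auto simp: space_restrict_space)
  also have "\<dots> = emeasure ?U (UNIV - {0})"
    by (subst emeasure_distr) (auto simp: pre)
  also have "\<dots> = 1"
    using pos fin null by (subst emeasure_uniform_measure) (auto simp: ennreal_divide_self)
  finally show "emeasure sphere_measure (sphere 0 1 :: 'a set) = 1" .
qed

definition spherical_cap :: "'a::euclidean_space \<Rightarrow> real \<Rightarrow> 'a set" where
  "spherical_cap z \<theta> = {y \<in> sphere 0 1. y \<bullet> z \<ge> cos \<theta>}"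

subsection \<open>Spherical harmonics\<close>

definition laplacian :: "('a::euclidean_space \<Rightarrow> real) \<Rightarrow> 'a \<Rightarrow> real" where
  "laplacian p x = (\<Sum>b\<in>Basis. (deriv ^^ 2) (\<lambda>t. p (x + t *\<^sub>R b)) 0)"

definition spherical_harmonic :: "nat \<Rightarrow> ('a::euclidean_space \<Rightarrow> real) \<Rightarrow> bool" where
  "spherical_harmonic l f \<longleftrightarrow>
     (\<exists>p. real_polynomial_function p \<and> (\<forall>c x. p (c *\<^sub>R x) = c ^ l * p x) \<and>
          (\<forall>x. laplacian p x = 0) \<and> (\<forall>x\<in>sphere 0 1. f x = p x))"

definition Zdim :: "nat \<Rightarrow> nat \<Rightarrow> real" where
  "Zdim d l = (2 * real l + real d - 1) * (Gamma (real l + real d - 1) / (Gamma (real d) * Gamma (real l + 1)))"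

text \<open>
  For \<open>d \<ge> 2\<close> the real number \<^term>\<open>Zdim d l\<close> is a natural number, so the index set is \<open>{1, \<dots>, Z(d,l)}\<close>.
\<close>

definition harmonic_indices :: "nat \<Rightarrow> nat \<Rightarrow> nat set" where
  "harmonic_indices d l = {k. 1 \<le> k \<and> real k \<le> Zdim d l}"

lemma Zdim_eq_choose:
  assumes "d \<ge> 2"
  shows "Zdim d l = real ((l + d - 1 choose (d - 1)) + (l + d - 2 choose (d - 1)))"
proof -
  obtain e where d: "d = e + 2" using assms by (metis le_add_diff_inverse2)
  have G: "Gamma (real l + real d - 1) = fact (l + e)" "Gamma (real d) = fact (e + 1)"
    "Gamma (real l + 1) = fact l"
    using Gamma_fact[of "l + e", where 'a=real] Gamma_fact[of "e + 1", where 'a=real]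
      Gamma_fact[of l, where 'a=real]
    by (simp_all add: d add_ac)
  have 1: "real (l + d - 1 choose (d - 1)) = (real l + real e + 1) * fact (l + e) / (fact (e + 1) * fact l)"
    using binomial_fact[of "e + 1" "l + e + 1", where 'a=real] by (simp add: d add_ac)
  have 2: "real (l + d - 2 choose (d - 1)) = real l * fact (l + e) / (fact (e + 1) * fact l)"
  proof (cases l)
    case (Suc m)
    then show ?thesis
      using binomial_fact[of "e + 1" "m + e + 1", where 'a=real]
      by (simp add: d add_ac fact_Suc[of m] del: of_nat_Suc fact_Suc binomial_Suc_Suc)
  qed (simp add: d)
  show ?thesis
    unfolding of_nat_add 1 2 Zdim_def G by (simp add: d algebra_simps del: fact_Suc flip: add_divide_distrib)
qed

lemma card_harmonic_indices:
  assumes "d \<ge> 2"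
  shows "real (card (harmonic_indices d l)) = Zdim d l"
proof -
  obtain n where n: "Zdim d l = real n" using Zdim_eq_choose[OF assms] by blast
  then have "harmonic_indices d l = {1..n}" by (auto simp: harmonic_indices_def)
  then show ?thesis by (simp add: n)
qed

definition orthonormal_spherical_harmonics ::
    "nat \<Rightarrow> (nat \<Rightarrow> nat \<Rightarrow> 'a::euclidean_space \<Rightarrow> real) \<Rightarrow> bool" where
  "orthonormal_spherical_harmonics d Y \<longleftrightarrow>
     (\<forall>l. (\<forall>k\<in>harmonic_indices d l. spherical_harmonic l (Y l k)) \<and>
          (\<forall>k\<in>harmonic_indices d l. \<forall>k'\<in>harmonic_indices d l.
             (\<integral>x. Y l k x * Y l k' x \<partial>sphere_measure) = (if k = k' then 1 else 0)))"

definition eigval :: "nat \<Rightarrow> nat \<Rightarrow> real" where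
  "eigval d l = real l * (real l + real d - 1)"

subsection \<open>Gegenbauer polynomials\<close>

definition gegenbauer_inner :: "nat \<Rightarrow> real poly \<Rightarrow> real poly \<Rightarrow> real" where
  "gegenbauer_inner d p q =
     (LBINT t:{-1..1}. poly p t * poly q t * (1 - t\<^sup>2) powr (real d / 2 - 1))"

definition is_gegenbauer :: "nat \<Rightarrow> (nat \<Rightarrow> real poly) \<Rightarrow> bool" where
  "is_gegenbauer d P \<longleftrightarrow>
     (\<forall>l. degree (P l) = l \<and> poly (P l) 1 = 1) \<and>
     (\<forall>l m. l \<noteq> m \<longrightarrow> gegenbauer_inner d (P l) (P m) = 0)"

lemma gegenbauer_integrable:
  assumes "d \<ge> 2"
  shows "set_integrable lborel {-1..1} (\<lambda>t. poly p t * (1 - t\<^sup>2) powr (real d / 2 - 1))"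
proof -
  obtain B where B: "\<And>t. t \<in> {-1..1} \<Longrightarrow> \<bar>poly p t\<bar> \<le> B"
  proof -
    have "bounded (poly p ` {-1..1})"
      by (intro compact_imp_bounded compact_continuous_image continuous_intros) auto
    then obtain B where "\<forall>t\<in>{-1..1}. \<bar>poly p t\<bar> \<le> B" by (auto simp: bounded_iff)
    then show ?thesis using that by blast
  qed
  have 1: "norm (indicator {-1..1} t *\<^sub>R (poly p t * (1 - t\<^sup>2) powr (real d / 2 - 1)))
        \<le> norm (indicator {-1..1} t *\<^sub>R B)" for t :: real
  proof (cases "t \<in> {-1..1}")
    case True
    then have "t\<^sup>2 \<le> 1" by (simp add: abs_square_le_1 abs_le_iff)
    then have "(1 - t\<^sup>2) powr (real d / 2 - 1) \<le> 1 powr (real d / 2 - 1)"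
      using assms by (intro powr_mono2) auto
    then have "\<bar>poly p t\<bar> * (1 - t\<^sup>2) powr (real d / 2 - 1) \<le> B * 1"
      using B[OF True] by (intro mult_mono) auto
    moreover have "0 \<le> B" using B[OF True] by linarith
    ultimately show ?thesis using True by (simp add: abs_mult)
  qed auto
  have [measurable]: "(\<lambda>t. poly p t) \<in> borel_measurable borel"
    by (intro borel_measurable_continuous_onI continuous_intros)
  have 2: "set_integrable lborel {-1..1::real} (\<lambda>_. B)"
    by (intro borel_integrable_atLeastAtMost') auto
  show ?thesis
    unfolding set_integrable_def
    by (rule Bochner_Integration.integrable_bound[OF 2[unfolded set_integrable_def]])
       (use 1 in \<open>auto intro!: AE_I2\<close>)
qed

lemma gegenbauer_weight_zero:
  assumes "d \<ge> 2" and nonneg: "\<And>t. t \<in> {-1..1} \<Longrightarrow> poly p t \<ge> 0"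
    and zero: "(LBINT t:{-1..1}. poly p t * (1 - t\<^sup>2) powr (real d / 2 - 1)) = 0"
  shows "p = 0"
proof (rule ccontr)
  assume "p \<noteq> 0"
  let ?h = "\<lambda>t. indicator {-1..1} t *\<^sub>R (poly p t * (1 - t\<^sup>2) powr (real d / 2 - 1))"
  have "AE t in lborel. ?h t = 0"
    using zero gegenbauer_integrable[OF assms(1), of p] nonneg
    unfolding set_lebesgue_integral_def set_integrable_def
    by (subst (asm) integral_nonneg_eq_0_iff_AE) (auto intro!: AE_I2 split: split_indicator)
  moreover have "AE t in lborel. t \<notin> {t. poly p t = 0}"
    using poly_roots_finite[OF \<open>p \<noteq> 0\<close>]
    by (intro AE_not_in) (simp add: null_sets_def emeasure_lborel_countable countable_finite
        finite_imp_closed borel_closed)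
  ultimately have "AE t in lborel. t \<notin> {-1<..<1::real}"
  proof eventually_elim
    case (elim t)
    show ?case
    proof
      assume t: "t \<in> {-1<..<1}"
      then have "t\<^sup>2 < 1" by (simp add: abs_square_less_1 abs_less_iff)
      then show False using elim t by auto
    qed
  qed
  then have "emeasure lborel {-1<..<1::real} = 0"
    by (subst (asm) AE_iff_measurable[of "{-1<..<1}"]) auto
  then show False by simp
qed

context
  fixes d :: nat assumes d2: "d \<ge> 2"
begin

lemma gegenbauer_inner_add: "gegenbauer_inner d (p + q) r = gegenbauer_inner d p r + gegenbauer_inner d q r"
proof -
  let ?w = "\<lambda>t. (1 - t\<^sup>2) powr (real d / 2 - 1)"
  have "(LBINT t:{-1..1}. poly (p * r) t * ?w t + poly (q * r) t * ?w t) =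
        (LBINT t:{-1..1}. poly (p * r) t * ?w t) + (LBINT t:{-1..1}. poly (q * r) t * ?w t)"
    by (intro set_integral_add gegenbauer_integrable d2)
  then show ?thesis by (simp add: gegenbauer_inner_def distrib_right)
qed

lemma gegenbauer_inner_smult: "gegenbauer_inner d (smult c p) r = c * gegenbauer_inner d p r"
  by (simp add: gegenbauer_inner_def mult.assoc)

lemma gegenbauer_inner_commute: "gegenbauer_inner d p q = gegenbauer_inner d q p"
  by (simp add: gegenbauer_inner_def mult.commute)

lemma gegenbauer_inner_0: "gegenbauer_inner d 0 r = 0"
  using gegenbauer_inner_smult[of 0 0 r] by simp

lemma gegenbauer_inner_diff: "gegenbauer_inner d (p - q) r = gegenbauer_inner d p r - gegenbauer_inner d q r"
  using gegenbauer_inner_add[of p "smult (-1) q" r] gegenbauer_inner_smult[of "-1" q r] by simp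

lemma gegenbauer_inner_sum: "gegenbauer_inner d (\<Sum>i\<in>A. f i) r = (\<Sum>i\<in>A. gegenbauer_inner d (f i) r)"
  by (induction A rule: infinite_finite_induct) (auto simp: gegenbauer_inner_0 gegenbauer_inner_add)

lemma gegenbauer_inner_self: "gegenbauer_inner d p p = 0 \<Longrightarrow> p = 0"
  using gegenbauer_weight_zero[OF d2, of "p * p"] by (auto simp: gegenbauer_inner_def)

lemma gegenbauer_orthogonal_lower:
  assumes "\<And>m. m < n \<Longrightarrow> degree (P m) = m" "\<And>m. m < n \<Longrightarrow> P m \<noteq> 0"
    and "\<And>m. m < n \<Longrightarrow> gegenbauer_inner d (P m) r = 0"
  shows "q = 0 \<or> degree q < n \<Longrightarrow> gegenbauer_inner d q r = 0"
proof (induction "degree q" arbitrary: q rule: less_induct)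
  case less
  show ?case
  proof (cases "q = 0")
    case False
    define m c where "m = degree q" and "c = lead_coeff q / lead_coeff (P m)"
    define q' where "q' = q - smult c (P m)"
    have m: "m < n" using less.prems False by (simp add: m_def)
    have c: "c \<noteq> 0" using False assms(2)[OF m] by (simp add: c_def)
    have le: "degree q' \<le> m"
      unfolding q'_def using assms(1)[OF m] by (intro degree_diff_le) (auto simp: m_def)
    have "coeff q' m = 0"
      using assms(1)[OF m] leading_coeff_0_iff[of "P m"] assms(2)[OF m] by (simp add: q'_def c_def m_def)
    then have "q' = 0 \<or> degree q' < m"
      using le by (metis le_neq_implies_less leading_coeff_0_iff)
    then have "gegenbauer_inner d q' r = 0"
      using less.hyps[of q'] m by (cases "q' = 0") (auto simp: gegenbauer_inner_0 m_def)
    then show ?thesis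
      using assms(3)[OF m] by (simp add: q'_def gegenbauer_inner_diff gegenbauer_inner_smult)
  qed (simp add: gegenbauer_inner_0)
qed

lemma orthogonal_poly_exists:
  "\<exists>p. degree p = n \<and> p \<noteq> 0 \<and> (\<forall>q. degree q < n \<longrightarrow> gegenbauer_inner d q p = 0)"
proof (induction n rule: less_induct)
  case (less n)
  then obtain P where P: "\<And>m. m < n \<Longrightarrow> degree (P m) = m" "\<And>m. m < n \<Longrightarrow> P m \<noteq> 0"
    "\<And>m q. m < n \<Longrightarrow> degree q < m \<Longrightarrow> gegenbauer_inner d q (P m) = 0"
    by metis
  let ?x = "monom 1 n :: real poly"
  define c where "c = (\<lambda>m. gegenbauer_inner d ?x (P m) / gegenbauer_inner d (P m) (P m))"
  define s where "s = (\<Sum>m<n. smult (c m) (P m))"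
  define p where "p = ?x - s"
  have s: "coeff s k = 0" if "k \<ge> n" for k
    unfolding s_def coeff_sum using P(1) that by (intro sum.neutral) (auto simp: coeff_eq_0)
  have cn: "coeff p n = 1" by (simp add: p_def s)
  have "degree p \<le> n" by (intro degree_le) (auto simp: p_def s)
  then have deg: "degree p = n" using le_degree[of p n] cn by simp
  have "gegenbauer_inner d (P m) p = 0" if m: "m < n" for m
  proof -
    have "gegenbauer_inner d (P i) (P m) = 0" if "i < n" "i \<noteq> m" for i
      using P(3)[of m "P i"] P(3)[of i "P m"] P(1)[of i] P(1)[of m] that m
      by (cases "i < m") (auto simp: gegenbauer_inner_commute[of "P i" "P m"])
    then have "gegenbauer_inner d s (P m) = (\<Sum>i<n. if i = m then c m * gegenbauer_inner d (P m) (P m) else 0)"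
      unfolding s_def gegenbauer_inner_sum by (intro sum.cong) (auto simp: gegenbauer_inner_smult)
    also have "\<dots> = gegenbauer_inner d ?x (P m)"
      using m gegenbauer_inner_self[of "P m"] P(2)[OF m] by (auto simp: c_def)
    finally show ?thesis
      by (subst gegenbauer_inner_commute) (simp add: p_def gegenbauer_inner_diff)
  qed
  then have "degree q < n \<longrightarrow> gegenbauer_inner d q p = 0" for q
    using gegenbauer_orthogonal_lower[of n P p q] P(1,2) by blast
  then show ?case using deg cn by (intro exI[of _ p]) auto
qed

lemma ex1_is_gegenbauer: "\<exists>!P. is_gegenbauer d P"
proof (rule ex_ex1I)
  obtain p where p: "\<And>n. degree (p n) = n" "\<And>n. p n \<noteq> 0"
    "\<And>n q. degree q < n \<Longrightarrow> gegenbauer_inner d q (p n) = 0"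
  proof -
    have "\<exists>p. \<forall>n. degree (p n) = n \<and> p n \<noteq> 0 \<and> (\<forall>q. degree q < n \<longrightarrow> gegenbauer_inner d q (p n) = 0)"
      by (rule choice) (rule allI, rule orthogonal_poly_exists)
    then show ?thesis using that by blast
  qed
  have p1: "poly (p n) 1 \<noteq> 0" for n
  proof
    assume "poly (p n) 1 = 0"
    then obtain q where q: "p n = [:-1, 1:] * q"
      by (metis dvdE poly_eq_0_iff_dvd)
    have q0: "q \<noteq> 0" using q p(2)[of n] by auto
    then have "degree (p n) = Suc (degree q)" by (simp add: q degree_mult_eq del: mult_pCons_left)
    then have "gegenbauer_inner d q (p n) = 0" using p(1,3) by simp
    then have "gegenbauer_inner d (smult (-1) (p n)) q = 0"
      by (simp only: gegenbauer_inner_smult gegenbauer_inner_commute[of q])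
    then have *: "(LBINT t:{-1..1}. poly ([:1, -1:] * (q * q)) t * (1 - t\<^sup>2) powr (real d / 2 - 1)) = 0"
      unfolding gegenbauer_inner_def q by (simp add: algebra_simps)
    have "poly ([:1, -1:] * (q * q)) t \<ge> 0" if "t \<in> {-1..1}" for t
    proof -
      have "poly ([:1, -1:] * (q * q)) t = (1 - t) * (poly q t * poly q t)"
        by (simp add: algebra_simps)
      then show ?thesis using that by simp
    qed
    then have "[:1, -1:] * (q * q) = 0" using gegenbauer_weight_zero[OF d2 _ *] by blast
    with q0 show False by (simp del: mult_pCons_left)
  qed
  have "is_gegenbauer d (\<lambda>n. smult (1 / poly (p n) 1) (p n))"
    unfolding is_gegenbauer_def
  proof (intro conjI allI impI)
    fix l m :: nat assume "l \<noteq> m"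
    then have "gegenbauer_inner d (p l) (p m) = 0"
      using p(3)[of "p l" m] p(3)[of "p m" l] p(1)
      by (cases "l < m") (auto simp: gegenbauer_inner_commute[of "p l" "p m"])
    then show "gegenbauer_inner d (smult (1 / poly (p l) 1) (p l)) (smult (1 / poly (p m) 1) (p m)) = 0"
      by (simp add: gegenbauer_inner_smult gegenbauer_inner_commute[of "p l"])
  qed (use p p1 in auto)
  then show "\<exists>P. is_gegenbauer d P" by blast
next
  fix P Q assume PQ: "is_gegenbauer d P" "is_gegenbauer d Q"
  have nz: "R n \<noteq> 0" if "is_gegenbauer d R" for R n
    using that unfolding is_gegenbauer_def by (metis poly_0 zero_neq_one)
  have orth: "gegenbauer_inner d q (R n) = 0"
    if "is_gegenbauer d R" "q = 0 \<or> degree q < n" for R n q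
    using gegenbauer_orthogonal_lower[of n R "R n" q] that nz[OF that(1)]
    unfolding is_gegenbauer_def by auto
  show "P = Q"
  proof
    fix n
    define c r where "c = lead_coeff (P n) / lead_coeff (Q n)" and "r = P n - smult c (Q n)"
    have deg: "degree (P n) = n" "degree (Q n) = n" using PQ by (auto simp: is_gegenbauer_def)
    have "degree r \<le> n" unfolding r_def using deg by (intro degree_diff_le) auto
    moreover have "coeff r n = 0" using deg leading_coeff_0_iff[of "Q n"] nz[OF PQ(2), of n] by (simp add: r_def c_def)
    ultimately have r: "r = 0 \<or> degree r < n"
      by (metis le_neq_implies_less leading_coeff_0_iff)
    have "gegenbauer_inner d r r = gegenbauer_inner d (P n) r - c * gegenbauer_inner d (Q n) r"
      by (subst (1) r_def) (simp add: gegenbauer_inner_diff gegenbauer_inner_smult)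
    also have "\<dots> = 0"
      using orth[OF PQ(1) r] orth[OF PQ(2) r] gegenbauer_inner_commute by simp
    finally have "r = 0" by (rule gegenbauer_inner_self)
    then have eq: "P n = smult c (Q n)" by (simp add: r_def)
    have "c = 1" using arg_cong[OF eq, of "\<lambda>p. poly p 1"] PQ by (simp add: is_gegenbauer_def)
    then show "P n = Q n" using eq by simp
  qed
qed

end

definition gegenbauer :: "nat \<Rightarrow> nat \<Rightarrow> real poly" where
  "gegenbauer d = (THE P. is_gegenbauer d P)"

lemma is_gegenbauer_gegenbauer: "d \<ge> 2 \<Longrightarrow> is_gegenbauer d (gegenbauer d)"
  unfolding gegenbauer_def by (rule theI'[OF ex1_is_gegenbauer])

subsection \<open>Sobolev spaces\<close>

definition comparable_on :: "'i set \<Rightarrow> ('i \<Rightarrow> real) \<Rightarrow> ('i \<Rightarrow> real) \<Rightarrow> bool" where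
  "comparable_on I a b \<longleftrightarrow> (\<exists>c1>0. \<exists>c2>0. \<forall>n\<in>I. c1 * a n \<le> b n \<and> b n \<le> c2 * a n)"

definition L2_sphere :: "('a::euclidean_space \<Rightarrow> real) set" where
  "L2_sphere = {f \<in> borel_measurable sphere_measure. integrable sphere_measure (\<lambda>x. (f x)\<^sup>2)}"

definition fourier_coeff ::
    "(nat \<Rightarrow> nat \<Rightarrow> 'a::euclidean_space \<Rightarrow> real) \<Rightarrow> ('a \<Rightarrow> real) \<Rightarrow> nat \<Rightarrow> nat \<Rightarrow> real" where
  "fourier_coeff Y f l k = (\<integral>x. f x * Y l k x \<partial>sphere_measure)"

text \<open>
  For \<open>s > d/2\<close> every class in the Sobolev space has exactly one continuous representative; the
  embedding into the continuous functions is built in by taking that representative.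
\<close>

definition sobolev_space ::
    "nat \<Rightarrow> (nat \<Rightarrow> nat \<Rightarrow> 'a::euclidean_space \<Rightarrow> real) \<Rightarrow> real \<Rightarrow> ('a \<Rightarrow> real) set" where
  "sobolev_space d Y s =
     {f \<in> L2_sphere. continuous_on (sphere 0 1) f \<and>
        summable (\<lambda>l. \<Sum>k\<in>harmonic_indices d l. (1 + eigval d l) powr s * \<bar>fourier_coeff Y f l k\<bar>\<^sup>2)}"

definition sobolev_norm ::
    "nat \<Rightarrow> (nat \<Rightarrow> nat \<Rightarrow> 'a::euclidean_space \<Rightarrow> real) \<Rightarrow> (nat \<Rightarrow> real) \<Rightarrow> ('a \<Rightarrow> real) \<Rightarrow> real" where
  "sobolev_norm d Y a f =
     sqrt (\<Sum>l. \<Sum>k\<in>harmonic_indices d l. 1 / a l * \<bar>fourier_coeff Y f l k\<bar>\<^sup>2)"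

subsection \<open>Point configurations\<close>

definition configurations :: "nat set \<Rightarrow> (nat \<Rightarrow> 'a::euclidean_space set) \<Rightarrow> bool" where
  "configurations I X \<longleftrightarrow>
     infinite I \<and> 0 \<notin> I \<and> (\<forall>N\<in>I. X N \<subseteq> sphere 0 1 \<and> finite (X N) \<and> card (X N) = N)"

text \<open>The supremum is taken in the extended reals, so that it is meaningful without a boundedness proof.\<close>

definition worst_case_error ::
    "nat \<Rightarrow> (nat \<Rightarrow> nat \<Rightarrow> 'a::euclidean_space \<Rightarrow> real) \<Rightarrow> real \<Rightarrow> (nat \<Rightarrow> real) \<Rightarrow> 'a set \<Rightarrow> ereal" where
  "worst_case_error d Y s a A =
     (SUP f \<in> {f \<in> sobolev_space d Y s. sobolev_norm d Y a f \<le> 1}.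
        ereal \<bar>1 / real (card A) * (\<Sum>x\<in>A. f x) - (\<integral>x. f x \<partial>sphere_measure)\<bar>)"

definition QMC_designs ::
    "nat \<Rightarrow> (nat \<Rightarrow> nat \<Rightarrow> 'a::euclidean_space \<Rightarrow> real) \<Rightarrow> real \<Rightarrow> (nat \<Rightarrow> real) \<Rightarrow>
     nat set \<Rightarrow> (nat \<Rightarrow> 'a set) \<Rightarrow> bool" where
  "QMC_designs d Y s a I X \<longleftrightarrow>
     (\<exists>c>0. \<forall>N\<in>I. worst_case_error d Y s a (X N) \<le> ereal (c / real N powr (s / real d)))"

definition property_R :: "nat \<Rightarrow> nat set \<Rightarrow> (nat \<Rightarrow> 'a::euclidean_space set) \<Rightarrow> bool" where
  "property_R d I X \<longleftrightarrow>
     (\<exists>c0>0. \<exists>c1>0. \<forall>N\<in>I. \<forall>z\<in>sphere 0 1.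
        real (card (X N \<inter> spherical_cap z (c1 * real N powr (- 1 / real d)))) \<le> c0)"

definition truncated_kernel :: "nat \<Rightarrow> (nat \<Rightarrow> real) \<Rightarrow> nat \<Rightarrow> real \<Rightarrow> real" where
  "truncated_kernel d a t u = (\<Sum>l=1..t. a l * Zdim d l * poly (gegenbauer d l) u)"

end

theory Submission
  imports Defs
begin

text \<open>
  The idea is to write the worst-case error as an energy. Let \<open>E l\<close> be the sum over
  \<open>k\<close> of the squares of \<open>\<Sum>x\<in>X. Y l k x\<close>. The error functional
  kills the constants, so for a function with Fourier series \<open>f = \<Sum>l. \<Sum>k. c l k
  * Y l k\<close> the error at \<open>N\<close> points is the pairing of the coefficients
  \<open>c l k\<close>, \<open>l \<ge> 1\<close>, with these sums divided by \<open>N\<close>.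
  Cauchy-Schwarz bounds the squared error by the squared norm of \<open>f\<close> times the sum
  of \<open>a l * E l / N\<^sup>2\<close> over \<open>l \<ge> 1\<close>
  (\<open>quadrature_error_le\<close>), and the polynomial that gives equality on the levels
  \<open>1, \<dots>, t\<close> shows that the squared worst-case error is at least the part of
  that sum with \<open>l \<le> t\<close> (\<open>extremal_polynomial\<close>). By the addition
  theorem this part is the normalized double sum of the truncated kernel
  (\<open>truncated_kernel_sum\<close>). So a sequence of QMC designs satisfies the criterion,
  and for the converse it remains to show that the levels \<open>l > t\<close> contribute
  \<open>O(N powr (- 2 s / d))\<close>.

  This is where Property R enters (\<open>tail_energy_bound\<close>). It bounds the number of
  points in a ball of radius of the order \<open>N powr (- 1 / d)\<close>. For harmonics of
  degree at most \<open>L\<close>, with \<open>L\<close> at least of the order \<open>N powr (1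
  / d)\<close>, the natural scale \<open>1 / L\<close> is at most of that order, and the sum of
  \<open>u(x)\<^sup>2\<close> over the points is controlled by the mean value property of the
  harmonic extension of \<open>u\<close>, used on balls of radius of the order \<open>1 /
  L\<close> that overlap boundedly often and lie in a thin shell around the sphere
  (\<open>separated_points_sum_square_le\<close>). By duality the energies up to level
  \<open>L\<close> add up to at most a constant times \<open>N L ^ d\<close>
  (\<open>large_sieve\<close>). Dyadic summation against \<open>a l \<le> C * l powr (- 2
  s)\<close> converges because \<open>2 s > d\<close> and gives \<open>N * t powr (d - 2
  s)\<close>, which is of the required order once it is divided by \<open>N\<^sup>2\<close>.

  The facts on spherical harmonics follow from one identity,
  \<open>integral_sphere_laplacian\<close>: for a homogeneous polynomial \<open>g\<close> of
  degree \<open>n\<close> on a space of dimension \<open>D\<close>, the Laplacian of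
  \<open>g\<close> has the same integral over the sphere as \<open>n (n + D - 2) g\<close>.
  Applied to products it gives, by induction over the degree, the orthogonality of harmonics of
  different degree and the Funk-Hecke formula for powers. The latter shows that the reproducing
  kernel of the harmonics of degree \<open>l\<close> is a polynomial in the inner product, and
  orthogonality identifies it as a multiple of the Gegenbauer polynomial
  (\<open>addition_theorem\<close>). That a family of \<open>Zdim d l\<close> orthonormal
  harmonics is a basis follows from counting the derivatives that determine a harmonic
  polynomial (\<open>solid_harmonic_functionals\<close>), and completeness from the
  decomposition of polynomials into harmonics and the Stone-Weierstrass theorem.
\<close>

definition dirderiv :: "'a::euclidean_space \<Rightarrow> ('a \<Rightarrow> real) \<Rightarrow> 'a \<Rightarrow> real" where
  "dirderiv v p x = deriv (\<lambda>t. p (x + t *\<^sub>R v)) 0"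

section \<open>Directional derivatives and the Laplacian of polynomials\<close>

lemmas real_polynomial_linear = real_polynomial_function.intros(1)
  and real_polynomial_const [intro] = real_polynomial_function.intros(2)
  and real_polynomial_add = real_polynomial_function.intros(3)
  and real_polynomial_mult = real_polynomial_function.intros(4)

lemma polynomial_dirderiv_exists:
  fixes p :: "'a::euclidean_space \<Rightarrow> real"
  assumes "real_polynomial_function p"
  shows "\<exists>q. real_polynomial_function q \<and>
    (\<forall>x t. ((\<lambda>t. p (x + t *\<^sub>R v)) has_field_derivative q (x + t *\<^sub>R v)) (at t))"
  using assms
proof (induction p)
  case (linear f)
  then have l: "linear f" by (rule bounded_linear.linear)
  have "((\<lambda>t. f (x + t *\<^sub>R v)) has_field_derivative f v) (at t)" for x t
    by (auto simp: linear_add[OF l] linear_scale[OF l] intro!: derivative_eq_intros)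
  then show ?case by (intro exI[of _ "\<lambda>_. f v"]) auto
next
  case (const c)
  then show ?case by (intro exI[of _ "\<lambda>_. 0"]) auto
next
  case (add f g)
  then obtain f' g' where fg: "real_polynomial_function f'" "real_polynomial_function g'"
    "\<And>x t. ((\<lambda>t. f (x + t *\<^sub>R v)) has_field_derivative f' (x + t *\<^sub>R v)) (at t)"
    "\<And>x t. ((\<lambda>t. g (x + t *\<^sub>R v)) has_field_derivative g' (x + t *\<^sub>R v)) (at t)" by blast
  then show ?case by (intro exI[of _ "\<lambda>x. f' x + g' x"]) (auto intro!: DERIV_add)
next
  case (mult f g)
  then obtain f' g' where fg: "real_polynomial_function f'" "real_polynomial_function g'"
    "\<And>x t. ((\<lambda>t. f (x + t *\<^sub>R v)) has_field_derivative f' (x + t *\<^sub>R v)) (at t)"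
    "\<And>x t. ((\<lambda>t. g (x + t *\<^sub>R v)) has_field_derivative g' (x + t *\<^sub>R v)) (at t)" by blast
  then show ?case using mult.hyps
    by (intro exI[of _ "\<lambda>x. f x * g' x + g x * f' x"]) (auto intro!: derivative_eq_intros)
qed

lemma real_polynomial_dirderiv [intro]:
    "real_polynomial_function p \<Longrightarrow> real_polynomial_function (dirderiv v p)" (is "?A \<Longrightarrow> ?B")
  and has_field_derivative_dirderiv:
    "real_polynomial_function p \<Longrightarrow>
      ((\<lambda>t. p (x + t *\<^sub>R v)) has_field_derivative dirderiv v p (x + t *\<^sub>R v)) (at t)" (is "?A \<Longrightarrow> ?C")
proof -
  assume ?A
  then obtain q where q: "real_polynomial_function q"
    "\<And>x t. ((\<lambda>t. p (x + t *\<^sub>R v)) has_field_derivative q (x + t *\<^sub>R v)) (at t)"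
    using polynomial_dirderiv_exists by blast
  have "dirderiv v p x = q x" for x
    unfolding dirderiv_def using DERIV_imp_deriv[OF q(2)[of x 0]] by simp
  then have "dirderiv v p = q" by auto
  with q show ?B and ?C by auto
qed

lemma dirderiv_eqI:
  assumes "((\<lambda>t. p (x + t *\<^sub>R v)) has_field_derivative D) (at 0)"
  shows "dirderiv v p x = D"
  unfolding dirderiv_def using assms by (rule DERIV_imp_deriv)

lemma dirderiv_at:
  "real_polynomial_function p \<Longrightarrow> ((\<lambda>t. p (x + t *\<^sub>R v)) has_field_derivative dirderiv v p x) (at 0)"
  using has_field_derivative_dirderiv[of p x v 0] by simp

lemma dirderiv_const [simp]: "dirderiv v (\<lambda>x. c) = (\<lambda>x. 0)"
  by (intro ext dirderiv_eqI) auto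

lemma dirderiv_linear: "bounded_linear f \<Longrightarrow> dirderiv v f = (\<lambda>x. f v)"
  by (intro ext dirderiv_eqI)
     (auto simp: linear_add linear_scale bounded_linear.linear intro!: derivative_eq_intros)

lemma dirderiv_inner [simp]: "dirderiv v (\<lambda>x. x \<bullet> e) = (\<lambda>x. v \<bullet> e)"
  by (rule dirderiv_linear) (rule bounded_linear_inner_left)

lemma dirderiv_add:
  "\<lbrakk>real_polynomial_function p; real_polynomial_function q\<rbrakk> \<Longrightarrow>
    dirderiv v (\<lambda>x. p x + q x) = (\<lambda>x. dirderiv v p x + dirderiv v q x)"
  by (intro ext dirderiv_eqI DERIV_add dirderiv_at)

lemma dirderiv_mult:
  "\<lbrakk>real_polynomial_function p; real_polynomial_function q\<rbrakk> \<Longrightarrow>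
    dirderiv v (\<lambda>x. p x * q x) = (\<lambda>x. dirderiv v p x * q x + p x * dirderiv v q x)"
  using DERIV_mult[OF dirderiv_at dirderiv_at]
  by (intro ext dirderiv_eqI) (fastforce simp: add.commute mult.commute)

lemma dirderiv_cmult:
  "real_polynomial_function p \<Longrightarrow> dirderiv v (\<lambda>x. c * p x) = (\<lambda>x. c * dirderiv v p x)"
  by (simp add: dirderiv_mult real_polynomial_const)

lemma real_polynomial_sum:
  "(\<And>i. i \<in> A \<Longrightarrow> real_polynomial_function (p i)) \<Longrightarrow> real_polynomial_function (\<lambda>x. \<Sum>i\<in>A. p i x)"
  by (induction A rule: infinite_finite_induct) (auto simp: real_polynomial_const)

lemma real_polynomial_inner [intro]: "real_polynomial_function (\<lambda>x. x \<bullet> e)"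
  by (rule real_polynomial_linear) (rule bounded_linear_inner_left)

lemma real_polynomial_inner_self [intro]: "real_polynomial_function (\<lambda>x::'a::euclidean_space. x \<bullet> x)"
proof -
  have "real_polynomial_function (\<lambda>x::'a. \<Sum>b\<in>Basis. (x \<bullet> b) * (x \<bullet> b))"
    by (intro real_polynomial_sum real_polynomial_mult real_polynomial_inner)
  then show ?thesis by (simp add: euclidean_inner[symmetric])
qed

lemma real_polynomial_cmult [intro]:
  "real_polynomial_function p \<Longrightarrow> real_polynomial_function (\<lambda>x. c * p x)"
  by (intro real_polynomial_mult real_polynomial_const)

lemma dirderiv_diff:
  "\<lbrakk>real_polynomial_function p; real_polynomial_function q\<rbrakk> \<Longrightarrow>
    dirderiv v (\<lambda>x. p x - q x) = (\<lambda>x. dirderiv v p x - dirderiv v q x)"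
  using dirderiv_add[of p "\<lambda>x. -1 * q x" v] dirderiv_cmult[of q v "-1"]
  by (auto simp: real_polynomial_cmult)

lemma dirderiv_sum:
  "(\<And>i. i \<in> A \<Longrightarrow> real_polynomial_function (p i)) \<Longrightarrow>
    dirderiv v (\<lambda>x. \<Sum>i\<in>A. p i x) = (\<lambda>x. \<Sum>i\<in>A. dirderiv v (p i) x)"
proof (induction A rule: infinite_finite_induct)
  case (insert i A)
  have "dirderiv v (\<lambda>x. p i x + (\<Sum>j\<in>A. p j x)) = (\<lambda>x. dirderiv v (p i) x + dirderiv v (\<lambda>x. \<Sum>j\<in>A. p j x) x)"
    using insert.prems by (intro dirderiv_add real_polynomial_sum) auto
  then show ?case using insert by simp
qed auto

lemma dirderiv_commute:
  assumes "real_polynomial_function p"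
  shows "dirderiv u (dirderiv v p) = dirderiv v (dirderiv u p)"
  using assms
proof (induction p)
  case (linear f)
  then show ?case by (simp add: dirderiv_linear)
next
  case (add f g)
  then show ?case by (simp add: dirderiv_add real_polynomial_dirderiv)
next
  case (mult f g)
  then show ?case
    by (simp add: dirderiv_mult dirderiv_add real_polynomial_dirderiv real_polynomial_mult)
      (simp add: algebra_simps)
qed simp

text \<open>
  Only the values in the directions of the standard basis are needed to know the derivative in
  an arbitrary direction. This is used with the direction \<open>x\<close> itself (Euler's
  identity) and with the pole \<open>e\<close> of a zonal function.
\<close>

lemma dirderiv_sum_Basis:
  assumes "real_polynomial_function p"
  shows "dirderiv v p x = (\<Sum>b\<in>Basis. (v \<bullet> b) * dirderiv b p x)"
  using assms
proof (induction p arbitrary: x)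
  case (linear f)
  then have l: "linear f" by (rule bounded_linear.linear)
  have "f v = f (\<Sum>b\<in>Basis. (v \<bullet> b) *\<^sub>R b)" by (simp add: euclidean_representation)
  also have "\<dots> = (\<Sum>b\<in>Basis. (v \<bullet> b) * f b)"
    by (simp add: linear_sum[OF l] linear_scale[OF l])
  finally show ?case using linear by (simp add: dirderiv_linear)
next
  case (add f g)
  then show ?case by (simp add: dirderiv_add algebra_simps sum.distrib)
next
  case (mult f g)
  have "dirderiv v (\<lambda>x. f x * g x) x
     = (\<Sum>b\<in>Basis. (v \<bullet> b) * dirderiv b f x) * g x + f x * (\<Sum>b\<in>Basis. (v \<bullet> b) * dirderiv b g x)"
    using mult by (simp add: dirderiv_mult)
  also have "\<dots> = (\<Sum>b\<in>Basis. (v \<bullet> b) * dirderiv b (\<lambda>x. f x * g x) x)"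
    unfolding sum_distrib_left sum_distrib_right sum.distrib[symmetric]
    using mult.hyps by (intro sum.cong) (auto simp: dirderiv_mult algebra_simps)
  finally show ?case .
qed simp

definition homogeneous :: "nat \<Rightarrow> ('a::real_vector \<Rightarrow> real) \<Rightarrow> bool" where
  "homogeneous n p \<longleftrightarrow> (\<forall>c x. p (c *\<^sub>R x) = c ^ n * p x)"

lemma homogeneous_mult:
  "homogeneous m p \<Longrightarrow> homogeneous n q \<Longrightarrow> homogeneous (m + n) (\<lambda>x. p x * q x)"
  by (auto simp: homogeneous_def power_add)

lemma homogeneous_cmult: "homogeneous n p \<Longrightarrow> homogeneous n (\<lambda>x. c * p x)"
  by (auto simp: homogeneous_def)

lemma homogeneous_add: "homogeneous n p \<Longrightarrow> homogeneous n q \<Longrightarrow> homogeneous n (\<lambda>x. p x + q x)"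
  by (auto simp: homogeneous_def algebra_simps)

lemma homogeneous_diff: "homogeneous n p \<Longrightarrow> homogeneous n q \<Longrightarrow> homogeneous n (\<lambda>x. p x - q x)"
  by (auto simp: homogeneous_def algebra_simps)

lemma homogeneous_sum: "(\<And>i. i \<in> A \<Longrightarrow> homogeneous n (p i)) \<Longrightarrow> homogeneous n (\<lambda>x. \<Sum>i\<in>A. p i x)"
  by (auto simp: homogeneous_def sum_distrib_left)

lemma homogeneous_inner: "homogeneous 1 (\<lambda>x. x \<bullet> e)"
  by (auto simp: homogeneous_def)

lemma homogeneous_inner_self: "homogeneous 2 (\<lambda>x. x \<bullet> x)"
  by (auto simp: homogeneous_def power2_eq_square)

lemma homogeneous_power: "homogeneous m p \<Longrightarrow> homogeneous (m * k) (\<lambda>x. p x ^ k)"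
  by (auto simp: homogeneous_def power_mult_distrib power_mult)

lemma homogeneous_0_eq: "homogeneous 0 p \<Longrightarrow> p x = p 0"
  unfolding homogeneous_def by (metis mult_1 power_0 scaleR_zero_left)

lemma homogeneous_zero: "homogeneous n (\<lambda>x. 0)"
  by (auto simp: homogeneous_def)

lemma isCont_real_polynomial: "real_polynomial_function p \<Longrightarrow> isCont p x"
  by (rule continuous_real_polymonial_function)

lemma continuous_real_polynomial: "real_polynomial_function p \<Longrightarrow> continuous_on S p"
  by (intro continuous_at_imp_continuous_on) (simp add: isCont_real_polynomial)

lemma homogeneous_0_dirderiv:
  assumes "homogeneous 0 p"
  shows "dirderiv v p = (\<lambda>x. 0)"
proof -
  have "p = (\<lambda>x. p 0)" using homogeneous_0_eq[OF assms] by auto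
  then show ?thesis using dirderiv_const by metis
qed

text \<open>
  For \<open>c \<noteq> 0\<close> this is the chain rule. The case \<open>c = 0\<close>, where
  the exponent matters through \<open>0 ^ 0 = 1\<close>, follows by continuity. The truncated
  exponent is harmless in degree \<open>0\<close>, where the derivative vanishes.
\<close>

lemma homogeneous_dirderiv:
  assumes p: "real_polynomial_function p" and h: "homogeneous n p"
  shows "homogeneous (n - 1) (dirderiv v p)"
proof (cases n)
  case 0
  then have "dirderiv v p = (\<lambda>x. 0)" using homogeneous_0_dirderiv h by blast
  then show ?thesis by (simp add: homogeneous_zero)
next
  case (Suc m)
  let ?D = "dirderiv v p"
  have 1: "?D (c *\<^sub>R x) = c ^ m * ?D x" if "c \<noteq> 0" for c x
  proof -
    have "((\<lambda>t. p (c *\<^sub>R x + (c * t) *\<^sub>R v)) has_field_derivative ?D (c *\<^sub>R x + (c * 0) *\<^sub>R v) * c) (at 0)"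
      by (rule DERIV_chain'[OF _ has_field_derivative_dirderiv[OF p]])
        (auto intro!: derivative_eq_intros)
    moreover have "(\<lambda>t. p (c *\<^sub>R x + (c * t) *\<^sub>R v)) = (\<lambda>t. c ^ n * p (x + t *\<^sub>R v))"
    proof
      fix t
      have "c *\<^sub>R x + (c * t) *\<^sub>R v = c *\<^sub>R (x + t *\<^sub>R v)" by (simp add: scaleR_add_right)
      then show "p (c *\<^sub>R x + (c * t) *\<^sub>R v) = c ^ n * p (x + t *\<^sub>R v)"
        using h by (simp add: homogeneous_def)
    qed
    moreover have "((\<lambda>t. c ^ n * p (x + t *\<^sub>R v)) has_field_derivative c ^ n * ?D x) (at 0)"
      by (intro DERIV_cmult dirderiv_at p)
    ultimately have "?D (c *\<^sub>R x) * c = c ^ n * ?D x" using DERIV_unique by fastforce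
    then show ?thesis using that Suc by simp
  qed
  have "?D (c *\<^sub>R x) = c ^ m * ?D x" for c x
  proof (cases "c = 0")
    case True
    have D: "isCont ?D y" for y
      using p by (simp add: real_polynomial_dirderiv isCont_real_polynomial)
    have "((\<lambda>c. ?D (c *\<^sub>R x)) \<longlongrightarrow> ?D (0 *\<^sub>R x)) (at 0)"
      by (rule isCont_tendsto_compose[OF D]) (auto intro!: tendsto_eq_intros)
    moreover have "((\<lambda>c. c ^ m * ?D x) \<longlongrightarrow> 0 ^ m * ?D x) (at 0)"
      by (auto intro!: tendsto_intros)
    moreover have "\<forall>\<^sub>F c in at 0. ?D (c *\<^sub>R x) = c ^ m * ?D x"
      using 1 by (auto simp: eventually_at_filter)
    ultimately have "((\<lambda>c. c ^ m * ?D x) \<longlongrightarrow> ?D (0 *\<^sub>R x)) (at 0)" "((\<lambda>c. c ^ m * ?D x) \<longlongrightarrow> 0 ^ m * ?D x) (at (0::real))"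
      using tendsto_cong[of "\<lambda>c. ?D (c *\<^sub>R x)" "\<lambda>c. c ^ m * ?D x" "at 0"] by auto
    then have "?D (0 *\<^sub>R x) = 0 ^ m * ?D x"
      using tendsto_unique[of "at (0::real)"] by auto
    then show ?thesis using True by simp
  qed (rule 1)
  then show ?thesis using Suc by (simp add: homogeneous_def)
qed

lemma euler_homogeneous:
  assumes p: "real_polynomial_function p" and h: "homogeneous n p"
  shows "(\<Sum>b\<in>Basis. (x \<bullet> b) * dirderiv b p x) = real n * p x"
proof -
  have "p (x + t *\<^sub>R x) = (1 + t) ^ n * p x" for t
  proof -
    have "x + t *\<^sub>R x = (1 + t) *\<^sub>R x" by (simp add: scaleR_add_left)
    then show ?thesis using h by (simp add: homogeneous_def)
  qed
  moreover have "((\<lambda>t. (1 + t) ^ n * p x) has_field_derivative (real n * p x)) (at 0)"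
    by (auto intro!: derivative_eq_intros)
  ultimately have "dirderiv x p x = real n * p x" by (intro dirderiv_eqI) simp
  then show ?thesis using dirderiv_sum_Basis[OF p, of x x] by linarith
qed

lemma laplacian_eq:
  fixes p :: "'a::euclidean_space \<Rightarrow> real"
  assumes "real_polynomial_function p"
  shows "laplacian p = (\<lambda>x. \<Sum>b\<in>Basis. dirderiv b (dirderiv b p) x)"
proof
  fix x
  have "deriv (\<lambda>t. p (x + t *\<^sub>R b)) = (\<lambda>t. dirderiv b p (x + t *\<^sub>R b))" for b
    by (intro ext DERIV_imp_deriv has_field_derivative_dirderiv assms)
  then show "laplacian p x = (\<Sum>b\<in>Basis. dirderiv b (dirderiv b p) x)"
    by (simp add: laplacian_def numeral_2_eq_2 dirderiv_def)
qed

lemma real_polynomial_laplacian [intro]: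
  "real_polynomial_function p \<Longrightarrow> real_polynomial_function (laplacian p)"
  by (auto simp: laplacian_eq intro!: real_polynomial_sum)

lemma homogeneous_laplacian:
  assumes "real_polynomial_function p" "homogeneous n p"
  shows "homogeneous (n - 2) (laplacian p)"
proof -
  have "homogeneous (n - 1 - 1) (dirderiv b (dirderiv b p))" for b
    using assms by (intro homogeneous_dirderiv) auto
  then show ?thesis by (simp add: laplacian_eq assms homogeneous_sum numeral_2_eq_2)
qed

lemma laplacian_low_degree:
  assumes "real_polynomial_function p" "homogeneous n p" "n \<le> 1"
  shows "laplacian p = (\<lambda>x. 0)"
proof -
  have "n - 1 = 0" using assms by simp
  then have "dirderiv b (dirderiv b p) = (\<lambda>x. 0)" for b
    using homogeneous_dirderiv[OF assms(1,2)] homogeneous_0_dirderiv by metis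
  then show ?thesis by (simp add: laplacian_eq assms)
qed

lemma laplacian_add:
  assumes "real_polynomial_function p" "real_polynomial_function q"
  shows "laplacian (\<lambda>x. p x + q x) = (\<lambda>x. laplacian p x + laplacian q x)"
  using assms by (simp add: laplacian_eq dirderiv_add real_polynomial_add
      real_polynomial_dirderiv sum.distrib)

lemma laplacian_diff:
  assumes "real_polynomial_function p" "real_polynomial_function q"
  shows "laplacian (\<lambda>x. p x - q x) = (\<lambda>x. laplacian p x - laplacian q x)"
  using assms by (simp add: laplacian_eq dirderiv_diff real_polynomial_function_diff
      real_polynomial_dirderiv sum_subtractf)

lemma laplacian_cmult:
  assumes "real_polynomial_function p"
  shows "laplacian (\<lambda>x. c * p x) = (\<lambda>x. c * laplacian p x)"
  using assms by (simp add: laplacian_eq dirderiv_cmult real_polynomial_cmult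
      real_polynomial_dirderiv sum_distrib_left)

lemma laplacian_sum:
  assumes "\<And>i. i \<in> A \<Longrightarrow> real_polynomial_function (p i)"
  shows "laplacian (\<lambda>x. \<Sum>i\<in>A. p i x) = (\<lambda>x. \<Sum>i\<in>A. laplacian (p i) x)"
  using assms
proof (induction A rule: infinite_finite_induct)
  case (insert i A)
  have "laplacian (\<lambda>x. p i x + (\<Sum>j\<in>A. p j x)) = (\<lambda>x. laplacian (p i) x + laplacian (\<lambda>x. \<Sum>j\<in>A. p j x) x)"
    using insert.prems by (intro laplacian_add real_polynomial_sum) auto
  then show ?case using insert by simp
qed (auto simp: laplacian_eq real_polynomial_const)

lemma laplacian_mult:
  assumes "real_polynomial_function p" "real_polynomial_function q"
  shows "laplacian (\<lambda>x. p x * q x) = (\<lambda>x. laplacian p x * q x + p x * laplacian q x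
    + 2 * (\<Sum>b\<in>Basis. dirderiv b p x * dirderiv b q x))"
  using assms
  by (simp add: laplacian_eq dirderiv_mult dirderiv_add real_polynomial_mult
      real_polynomial_dirderiv sum.distrib sum_distrib_left sum_distrib_right algebra_simps)

lemma dirderiv_inner_self: "dirderiv v (\<lambda>x. x \<bullet> x) = (\<lambda>x. 2 * (x \<bullet> v))"
  by (intro ext dirderiv_eqI)
     (auto simp: inner_simps inner_commute intro!: derivative_eq_intros)

lemma laplacian_inner_self: "laplacian (\<lambda>x::'a::euclidean_space. x \<bullet> x) = (\<lambda>x. 2 * real DIM('a))"
  by (simp add: laplacian_eq real_polynomial_inner_self dirderiv_inner_self dirderiv_cmult
      real_polynomial_inner) (simp only: mult.commute)

text \<open>
  The product rule leaves the mixed term \<open>4 (x \<bullet> grad q)\<close>, which Euler's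
  identity turns into \<open>4 m q\<close>.
\<close>

lemma laplacian_inner_self_mult:
  fixes q :: "'a::euclidean_space \<Rightarrow> real"
  assumes "real_polynomial_function q" "homogeneous m q"
  shows "laplacian (\<lambda>x. (x \<bullet> x) * q x)
    = (\<lambda>x. (x \<bullet> x) * laplacian q x + (2 * real DIM('a) + 4 * real m) * q x)"
proof
  fix x
  have "(\<Sum>b\<in>Basis. 2 * (x \<bullet> b) * dirderiv b q x) = 2 * (real m * q x)"
    using euler_homogeneous[OF assms, of x] by (simp add: mult.assoc flip: sum_distrib_left)
  then show "laplacian (\<lambda>x. (x \<bullet> x) * q x) x
      = (x \<bullet> x) * laplacian q x + (2 * real DIM('a) + 4 * real m) * q x"
    using assms(1) by (simp add: laplacian_mult real_polynomial_inner_self laplacian_inner_self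
        dirderiv_inner_self) (simp add: algebra_simps)
qed

section \<open>Solid harmonics and the decomposition of polynomials\<close>

text \<open>
  The operator \<open>q \<mapsto> |x|\<^sup>2 laplacian q + \<kappa> q\<close> is onto because
  the Laplacian lowers the degree: looking for \<open>q = (f - |x|\<^sup>2 g) / \<kappa>\<close>
  leads to an equation of the same form for \<open>g\<close>, of degree \<open>m - 2\<close> and
  with a larger constant. With the right \<open>\<kappa>\<close> it says that \<open>laplacian
  (|x|\<^sup>2 q) = laplacian p\<close> is solvable, and then \<open>p - |x|\<^sup>2 q\<close>
  is the harmonic part of \<open>p\<close>.
\<close>

lemma laplacian_resolvent:
  fixes f :: "'a::euclidean_space \<Rightarrow> real"
  assumes "real_polynomial_function f" "homogeneous m f" "\<kappa> > 0"
  shows "\<exists>q. real_polynomial_function q \<and> homogeneous m q \<and>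
    (\<forall>x. (x \<bullet> x) * laplacian q x + \<kappa> * q x = f x)"
  using assms
proof (induction m arbitrary: f \<kappa> rule: less_induct)
  case (less m)
  show ?case
  proof (cases "m \<le> 1")
    case True
    have "laplacian (\<lambda>x. 1 / \<kappa> * f x) = (\<lambda>x. 0)"
      using less.prems True by (intro laplacian_low_degree[of _ m] homogeneous_cmult) auto
    moreover have "homogeneous m (\<lambda>x. 1 / \<kappa> * f x)" "real_polynomial_function (\<lambda>x. 1 / \<kappa> * f x)"
      using less.prems by (intro homogeneous_cmult real_polynomial_cmult; simp)+
    ultimately show ?thesis using less.prems
      by (intro exI[of _ "\<lambda>x. 1 / \<kappa> * f x"]) simp
  next
    case False
    define \<mu> where "\<mu> = 2 * real DIM('a) + 4 * real (m - 2) + \<kappa>"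
    have "\<mu> > 0" using less.prems by (simp add: \<mu>_def add_nonneg_pos)
    obtain g where g: "real_polynomial_function g" "homogeneous (m - 2) g"
      "\<And>x. (x \<bullet> x) * laplacian g x + \<mu> * g x = laplacian f x"
      using less.IH[of "m - 2" "laplacian f" \<mu>] less.prems False \<open>\<mu> > 0\<close>
        real_polynomial_laplacian homogeneous_laplacian by (metis diff_less not_le_imp_less
          pos2 zero_less_one order_less_trans)
    define q where "q = (\<lambda>x. 1 / \<kappa> * (f x - (x \<bullet> x) * g x))"
    have p: "real_polynomial_function (\<lambda>x. (x \<bullet> x) * g x)" using g by auto
    have "2 + (m - 2) = m" using False by simp
    then have "homogeneous m (\<lambda>x. (x \<bullet> x) * g x)"
      using homogeneous_mult[OF homogeneous_inner_self g(2)] by metis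
    then have "homogeneous m q" unfolding q_def using less.prems
      by (intro homogeneous_cmult homogeneous_diff)
    moreover have "real_polynomial_function q" unfolding q_def using less.prems p by auto
    moreover have "(x \<bullet> x) * laplacian q x + \<kappa> * q x = f x" for x
    proof -
      have "laplacian q x = 1 / \<kappa> * (laplacian f x - laplacian (\<lambda>x. (x \<bullet> x) * g x) x)"
        unfolding q_def using less.prems p by (simp add: laplacian_cmult laplacian_diff real_polynomial_function_diff del: times_divide_eq_left)
      also have "laplacian f x - laplacian (\<lambda>x. (x \<bullet> x) * g x) x = \<kappa> * g x"
        using g(3)[of x] unfolding laplacian_inner_self_mult[OF g(1,2)] \<mu>_def by (simp add: algebra_simps)
      finally have "laplacian q x = g x" using less.prems by simp
      then show ?thesis using less.prems by (simp add: q_def)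
    qed
    ultimately show ?thesis by blast
  qed
qed

definition solid_harmonic :: "nat \<Rightarrow> ('a::euclidean_space \<Rightarrow> real) \<Rightarrow> bool" where
  "solid_harmonic n p \<longleftrightarrow> real_polynomial_function p \<and> homogeneous n p \<and> laplacian p = (\<lambda>x. 0)"

lemma laplacian_dirderiv:
  assumes p: "real_polynomial_function p"
  shows "laplacian (dirderiv v p) = dirderiv v (laplacian p)"
  using dirderiv_commute[OF p, of _ v] dirderiv_commute[OF real_polynomial_dirderiv[OF p], of _ v] p
  by (simp add: laplacian_eq real_polynomial_dirderiv dirderiv_sum)

lemma solid_harmonic_dirderiv:
  assumes "solid_harmonic n p"
  shows "solid_harmonic (n - 1) (dirderiv v p)"
  using assms homogeneous_dirderiv[of p n v] by (auto simp: solid_harmonic_def laplacian_dirderiv)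

lemma solid_harmonic_cmult: "solid_harmonic n p \<Longrightarrow> solid_harmonic n (\<lambda>x. c * p x)"
  by (auto simp: solid_harmonic_def laplacian_cmult homogeneous_cmult)

lemma solid_harmonic_add:
  "solid_harmonic n p \<Longrightarrow> solid_harmonic n q \<Longrightarrow> solid_harmonic n (\<lambda>x. p x + q x)"
  by (auto simp: solid_harmonic_def laplacian_add homogeneous_add)

lemma solid_harmonic_diff:
  "solid_harmonic n p \<Longrightarrow> solid_harmonic n q \<Longrightarrow> solid_harmonic n (\<lambda>x. p x - q x)"
  by (auto simp: solid_harmonic_def laplacian_diff homogeneous_diff)

lemma solid_harmonic_const: "solid_harmonic 0 (\<lambda>x. c)"
  using laplacian_low_degree[of "\<lambda>x. c" 0] by (auto simp: solid_harmonic_def homogeneous_def)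

lemma solid_harmonic_zero: "solid_harmonic n (\<lambda>x. 0)"
  using laplacian_low_degree[of "\<lambda>x. 0" 0] by (auto simp: solid_harmonic_def homogeneous_zero)

lemma solid_harmonic_sum:
  "(\<And>i. i \<in> A \<Longrightarrow> solid_harmonic n (p i)) \<Longrightarrow> solid_harmonic n (\<lambda>x. \<Sum>i\<in>A. p i x)"
  by (induction A rule: infinite_finite_induct) (auto simp: solid_harmonic_zero solid_harmonic_add)

text \<open>
  Since \<open>|x|\<^sup>2 = 1\<close> on the sphere, the splitting \<open>p = h + |x|\<^sup>2
  q\<close> with harmonic \<open>h\<close> lowers the degree of what remains to be decomposed.
\<close>

lemma homogeneous_on_sphere_harmonic_sum:
  fixes p :: "'a::euclidean_space \<Rightarrow> real"
  assumes "real_polynomial_function p" "homogeneous n p"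
  shows "\<exists>h. (\<forall>l. solid_harmonic l (h l)) \<and> (\<forall>x\<in>sphere 0 1. p x = (\<Sum>l\<le>n. h l x))"
  using assms
proof (induction n arbitrary: p rule: less_induct)
  case (less n)
  show ?case
  proof (cases "n \<le> 1")
    case True
    then have "solid_harmonic n p"
      using less.prems laplacian_low_degree by (auto simp: solid_harmonic_def)
    then have "solid_harmonic l (\<lambda>x. if l = n then p x else 0)" for l
      by (cases "l = n") (auto simp: solid_harmonic_zero)
    then show ?thesis
      by (intro exI[of _ "\<lambda>l x. if l = n then p x else 0"]) auto
  next
    case False
    define \<kappa> where "\<kappa> = 2 * real DIM('a) + 4 * real (n - 2)"
    obtain q where q: "real_polynomial_function q" "homogeneous (n - 2) q"
      "\<And>x. (x \<bullet> x) * laplacian q x + \<kappa> * q x = laplacian p x"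
      using laplacian_resolvent[of "laplacian p" "n - 2" \<kappa>] less.prems
        real_polynomial_laplacian homogeneous_laplacian[of p n]
      by (auto simp: \<kappa>_def add_pos_nonneg)
    obtain h where h: "\<And>l. solid_harmonic l (h l)"
      "\<And>x. x \<in> sphere 0 1 \<Longrightarrow> q x = (\<Sum>l\<le>n - 2. h l x)"
      using less.IH[OF _ q(1,2)] False by (metis diff_less not_le pos2 zero_less_one order_less_trans)
    let ?H = "\<lambda>x. p x - (x \<bullet> x) * q x"
    have pq: "real_polynomial_function (\<lambda>x. (x \<bullet> x) * q x)" using q by auto
    have "2 + (n - 2) = n" using False by simp
    then have "homogeneous n (\<lambda>x. (x \<bullet> x) * q x)"
      using homogeneous_mult[OF homogeneous_inner_self q(2)] by metis
    moreover have "laplacian ?H = (\<lambda>x. 0)"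
      using less.prems pq q(3)
      by (simp add: laplacian_diff laplacian_inner_self_mult[OF q(1,2)] \<kappa>_def)
    ultimately have "solid_harmonic n ?H"
      using less.prems pq by (auto simp: solid_harmonic_def homogeneous_diff)
    moreover have "p x = (\<Sum>l\<le>n. if l = n then ?H x else if l \<le> n - 2 then h l x else 0)"
      if "x \<in> sphere 0 1" for x
    proof -
      have "x \<bullet> x = 1" using that by (simp add: norm_eq_1)
      have "(\<Sum>l\<le>n. if l = n then ?H x else if l \<le> n - 2 then h l x else 0)
        = ?H x + (\<Sum>l<n. if l \<le> n - 2 then h l x else 0)"
        by (simp add: lessThan_Suc_atMost[symmetric])
      also have "(\<Sum>l<n. if l \<le> n - 2 then h l x else 0) = (\<Sum>l\<le>n - 2. h l x)"
        using False by (intro sum.mono_neutral_cong_right) auto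
      finally show ?thesis using h(2)[OF that] \<open>x \<bullet> x = 1\<close> by simp
    qed
    moreover have "solid_harmonic l (\<lambda>x. if l = n then ?H x else if l \<le> n - 2 then h l x else 0)" for l
      using calculation(1) h(1)[of l]
      by (cases "l = n"; cases "l \<le> n - 2") (auto simp: solid_harmonic_zero)
    ultimately show ?thesis
      by (intro exI[of _ "\<lambda>l x. if l = n then ?H x else if l \<le> n - 2 then h l x else 0"]) auto
  qed
qed

lemma polynomial_homogeneous_sum:
  fixes p :: "'a::euclidean_space \<Rightarrow> real"
  assumes "real_polynomial_function p"
  shows "\<exists>n h. (\<forall>i. real_polynomial_function (h i) \<and> homogeneous i (h i)) \<and> p = (\<lambda>x. \<Sum>i\<le>n. h i x)"
  using assms
proof (induction p)
  case (linear f)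
  have "real_polynomial_function (\<lambda>x. if i = 1 then f x else 0)"
    "homogeneous i (\<lambda>x. if i = 1 then f x else 0)" for i :: nat
    using linear by (cases "i = 1"; force simp: homogeneous_def linear_scale bounded_linear.linear)+
  then show ?case
    by (intro exI[of _ 1] exI[of _ "\<lambda>i x. if i = 1 then f x else 0"]) auto
next
  case (const c)
  then show ?case
    by (intro exI[of _ 0] exI[of _ "\<lambda>i x. if i = 0 then c else 0"]) (auto simp: homogeneous_def)
next
  case (add f g)
  then obtain m u n v where f: "\<And>i. real_polynomial_function (u i)" "\<And>i. homogeneous i (u i)"
    "f = (\<lambda>x. \<Sum>i\<le>m. u i x)" and g: "\<And>i. real_polynomial_function (v i)" "\<And>i. homogeneous i (v i)"
    "g = (\<lambda>x. \<Sum>i\<le>n. v i x)" by metis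
  let ?h = "\<lambda>i x. (if i \<le> m then u i x else 0) + (if i \<le> n then v i x else 0)"
  have "f x + g x = (\<Sum>i\<le>max m n. ?h i x)" for x
  proof -
    have "(\<Sum>i\<le>max m n. if i \<le> m then u i x else 0) = f x" "(\<Sum>i\<le>max m n. if i \<le> n then v i x else 0) = g x"
      unfolding f(3) g(3) by (intro sum.mono_neutral_cong_right; auto)+
    then show ?thesis by (simp add: sum.distrib)
  qed
  moreover have "real_polynomial_function (?h i)" for i
    using f(1)[of i] g(1)[of i] by (cases "i \<le> m"; cases "i \<le> n") auto
  moreover have "homogeneous i (?h i)" for i
    using f(2)[of i] g(2)[of i] by (cases "i \<le> m"; cases "i \<le> n") (auto simp: homogeneous_zero homogeneous_add)
  ultimately show ?case by (intro exI[of _ "max m n"] exI[of _ ?h]) auto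
next
  case (mult f g)
  then obtain m u n v where f: "\<And>i. real_polynomial_function (u i)" "\<And>i. homogeneous i (u i)"
    "f = (\<lambda>x. \<Sum>i\<le>m. u i x)" and g: "\<And>i. real_polynomial_function (v i)" "\<And>i. homogeneous i (v i)"
    "g = (\<lambda>x. \<Sum>i\<le>n. v i x)" by metis
  let ?I = "\<lambda>k. {(i, j). i \<le> m \<and> j \<le> n \<and> i + j = k}"
  let ?h = "\<lambda>k x. \<Sum>ij\<in>?I k. u (fst ij) x * v (snd ij) x"
  have fin: "finite (?I k)" for k
    by (rule finite_subset[of _ "{..m} \<times> {..n}"]) auto
  have "f x * g x = (\<Sum>k\<le>m + n. ?h k x)" for x
  proof -
    have "f x * g x = (\<Sum>ij\<in>{..m} \<times> {..n}. u (fst ij) x * v (snd ij) x)"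
      by (simp add: f(3) g(3) sum_product sum.cartesian_product case_prod_beta)
    also have "\<dots> = (\<Sum>k\<le>m + n. \<Sum>ij | ij \<in> {..m} \<times> {..n} \<and> fst ij + snd ij = k. u (fst ij) x * v (snd ij) x)"
      by (rule sum.group[symmetric]) auto
    also have "\<dots> = (\<Sum>k\<le>m + n. ?h k x)"
      by (intro sum.cong) auto
    finally show ?thesis .
  qed
  moreover have "real_polynomial_function (?h k)" for k
    using f g by (auto intro!: real_polynomial_sum)
  moreover have "homogeneous k (?h k)" for k
    by (rule homogeneous_sum) (use f g homogeneous_mult in fastforce)
  ultimately show ?case by (intro exI[of _ "m + n"] exI[of _ ?h]) auto
qed

lemma polynomial_on_sphere_harmonic_sum:
  fixes p :: "'a::euclidean_space \<Rightarrow> real"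
  assumes "real_polynomial_function p"
  shows "\<exists>n h. (\<forall>l. solid_harmonic l (h l)) \<and> (\<forall>x\<in>sphere 0 1. p x = (\<Sum>l\<le>n. h l x))"
proof -
  obtain n q where q: "\<And>i. real_polynomial_function (q i)" "\<And>i. homogeneous i (q i)"
    "p = (\<lambda>x. \<Sum>i\<le>n. q i x)" using polynomial_homogeneous_sum[OF assms] by metis
  have "\<forall>i. \<exists>h. (\<forall>l. solid_harmonic l (h l)) \<and> (\<forall>x\<in>sphere 0 1. q i x = (\<Sum>l\<le>i. h l x))"
    using homogeneous_on_sphere_harmonic_sum q by blast
  then obtain h where h: "\<And>i l. solid_harmonic l (h i l)"
    "\<And>i x. x \<in> sphere 0 1 \<Longrightarrow> q i x = (\<Sum>l\<le>i. h i l x)" by metis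
  have "p x = (\<Sum>l\<le>n. \<Sum>i\<in>{l..n}. h i l x)" if "x \<in> sphere 0 1" for x
  proof -
    have "p x = (\<Sum>i\<le>n. \<Sum>l\<le>i. h i l x)" using q(3) h(2)[OF that] by simp
    also have "\<dots> = (\<Sum>l\<le>n. \<Sum>i\<in>{l..n}. h i l x)"
      unfolding sum.Sigma[OF finite_atMost ballI[OF finite_atMost]] sum.Sigma[OF finite_atMost ballI[OF finite_atLeastAtMost]]
      by (rule sum.reindex_bij_witness[of _ prod.swap prod.swap]) auto
    finally show ?thesis .
  qed
  then show ?thesis
    by (intro exI[of _ n] exI[of _ "\<lambda>l x. \<Sum>i\<in>{l..n}. h i l x"]) (auto intro!: solid_harmonic_sum h)
qed

section \<open>Integration over the sphere and over the ball\<close>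

lemma sets_sphere_measure: "sets sphere_measure = sets (restrict_space borel (sphere (0::'a::euclidean_space) 1))"
  by (simp add: sphere_measure_def sets_restrict_space)

lemma measurable_sphere_continuous:
  "continuous_on (sphere (0::'a::euclidean_space) 1) f \<Longrightarrow> f \<in> borel_measurable (sphere_measure :: 'a measure)"
  using borel_measurable_continuous_on_restrict[of "sphere 0 1" f]
  by (simp add: measurable_cong_sets[OF sets_sphere_measure refl])

interpretation sphere_measure: finite_measure "sphere_measure :: 'a::euclidean_space measure"
  by (rule finite_measureI) (simp add: space_sphere_measure emeasure_sphere_measure)

lemma measure_sphere_measure: "measure sphere_measure (sphere (0::'a::euclidean_space) 1) = 1"
  by (simp add: measure_def emeasure_sphere_measure)

lemma integrable_sphere_continuous:
  fixes f :: "'a::euclidean_space \<Rightarrow> real"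
  assumes "continuous_on (sphere 0 1) f"
  shows "integrable sphere_measure f"
proof -
  have "bounded (f ` sphere 0 1)"
    using assms by (intro compact_imp_bounded compact_continuous_image) auto
  then obtain C where "\<And>x. x \<in> sphere 0 1 \<Longrightarrow> norm (f x) \<le> C"
    unfolding bounded_iff by blast
  then show ?thesis
    by (intro sphere_measure.integrable_const_bound[of _ C] AE_I2 measurable_sphere_continuous assms)
      (auto simp: space_sphere_measure)
qed

lemma integrable_sphere_polynomial:
  fixes p :: "'a::euclidean_space \<Rightarrow> real"
  shows "real_polynomial_function p \<Longrightarrow> integrable sphere_measure p"
  by (intro integrable_sphere_continuous continuous_real_polynomial)

lemma integral_sphere_cong:
  assumes "\<And>x. x \<in> sphere 0 1 \<Longrightarrow> f x = g x"
  shows "integral\<^sup>L sphere_measure f = integral\<^sup>L sphere_measure g"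
  using assms by (intro Bochner_Integration.integral_cong) (auto simp: space_sphere_measure)

lemma integral_sphere_const: "(\<integral>x. c \<partial>(sphere_measure :: 'a::euclidean_space measure)) = (c::real)"
  by (simp add: space_sphere_measure measure_sphere_measure)

lemma integral_sphere_eq_ball:
  fixes f :: "'a::euclidean_space \<Rightarrow> real"
  assumes [measurable]: "f \<in> borel_measurable borel"
  shows "integral\<^sup>L sphere_measure f
    = (LINT x:ball 0 1|lborel. f (x /\<^sub>R norm x)) / measure lborel (ball (0::'a) 1)"
proof -
  let ?B = "ball 0 1 :: 'a set" and ?g = "\<lambda>x::'a. x /\<^sub>R norm x"
  have [measurable]: "?g \<in> borel_measurable borel" by measurable
  have em: "emeasure lborel ?B = ennreal (measure lborel ?B)"
    using emeasure_lborel_ball_finite[of "0::'a" 1] by (simp add: emeasure_eq_ennreal_measure)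
  have pos: "measure lborel ?B > 0" by (simp add: content_ball_pos)
  have [measurable]: "sphere 0 1 \<in> sets (borel :: 'a measure)" "?B \<in> sets (borel :: 'a measure)" by simp_all
  have hm [measurable]: "(\<lambda>x. indicator (sphere 0 1) x *\<^sub>R f x) \<in> borel_measurable borel" by measurable
  have U: "uniform_measure lborel ?B = density lborel (\<lambda>x. ennreal (indicator ?B x / measure lborel ?B))"
    unfolding uniform_measure_def em
    by (intro arg_cong[where f="density lborel"] ext)
       (use pos divide_ennreal[of 1 "measure lborel ?B"] in \<open>auto simp: indicator_def\<close>)
  have "integral\<^sup>L sphere_measure f = (\<integral>x. indicator (sphere 0 1) x *\<^sub>R f x \<partial>distr (uniform_measure lborel ?B) borel ?g)"
    unfolding sphere_measure_def by (rule integral_restrict_space) simp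
  also have "\<dots> = (\<integral>x. indicator (sphere 0 1) (?g x) *\<^sub>R f (?g x) \<partial>uniform_measure lborel ?B)"
    by (rule integral_distr) measurable
  also have "\<dots> = (\<integral>x. (indicator ?B x / measure lborel ?B) *\<^sub>R (indicator (sphere 0 1) (?g x) *\<^sub>R f (?g x)) \<partial>lborel)"
    unfolding U
    using measurable_compose[OF \<open>?g \<in> borel_measurable borel\<close> hm]
    by (intro integral_density) (auto simp: measurable_lborel1)
  also have "\<dots> = (\<integral>x. (indicator ?B x *\<^sub>R f (?g x)) / measure lborel ?B \<partial>lborel)"
  proof (rule integral_cong_AE)
    show "AE x in lborel. (indicator ?B x / measure lborel ?B) *\<^sub>R (indicator (sphere 0 1) (?g x) *\<^sub>R f (?g x))
       = (indicator ?B x *\<^sub>R f (?g x)) / measure lborel ?B"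
      using AE_lborel_singleton[of "0::'a"]
      by eventually_elim (auto simp: indicator_def)
  qed measurable
  finally show ?thesis by (simp add: set_lebesgue_integral_def)
qed

lemma integral_ball_affine:
  fixes f :: "'a::euclidean_space \<Rightarrow> real"
  assumes [measurable]: "f \<in> borel_measurable borel" and "r > 0"
  shows "(LINT x:ball c r|lborel. f x) = r ^ DIM('a) * (LINT x:ball 0 1|lborel. f (c + r *\<^sub>R x))"
proof -
  let ?h = "\<lambda>x. indicator (ball c r) x *\<^sub>R f x"
  have [measurable]: "ball c r \<in> sets (borel :: 'a measure)" by simp
  have hm [measurable]: "?h \<in> borel_measurable borel" by measurable
  have "(LINT x:ball c r|lborel. f x)
      = integral\<^sup>L (density (distr lborel borel (\<lambda>x. c + r *\<^sub>R x)) (\<lambda>_. ennreal (\<bar>r\<bar> ^ DIM('a)))) ?h"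
    unfolding set_lebesgue_integral_def using lborel_affine[of r c] assms(2) by simp
  also have "\<dots> = (\<integral>x. \<bar>r\<bar> ^ DIM('a) *\<^sub>R ?h x \<partial>distr lborel borel (\<lambda>x. c + r *\<^sub>R x))"
    by (rule integral_density) (use hm in auto)
  also have "\<dots> = (\<integral>x. \<bar>r\<bar> ^ DIM('a) *\<^sub>R ?h (c + r *\<^sub>R x) \<partial>lborel)"
    by (rule integral_distr) measurable
  also have "\<dots> = (\<integral>x. r ^ DIM('a) * (indicator (ball 0 1) x *\<^sub>R f (c + r *\<^sub>R x)) \<partial>lborel)"
    using assms(2) by (intro Bochner_Integration.integral_cong) (auto simp: indicator_def dist_norm)
  finally show ?thesis by (simp add: set_lebesgue_integral_def)
qed

lemma set_integrable_ball_polynomial: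
  fixes p :: "'a::euclidean_space \<Rightarrow> real"
  assumes "real_polynomial_function p"
  shows "set_integrable lborel (ball c r) p"
proof (rule set_integrable_subset)
  show "set_integrable lborel (cball c r) p"
    unfolding set_integrable_def
    using borel_integrable_compact[OF compact_cball continuous_real_polynomial[OF assms], of c r]
    by simp
qed auto

lemma measurable_real_polynomial:
  fixes p :: "'a::euclidean_space \<Rightarrow> real"
  shows "real_polynomial_function p \<Longrightarrow> p \<in> borel_measurable borel"
  by (intro borel_measurable_continuous_onI continuous_real_polynomial)

lemma real_polynomial_bounded_cball:
  fixes p :: "'a::euclidean_space \<Rightarrow> real"
  assumes "real_polynomial_function p"
  obtains C where "C \<ge> 0" "\<And>x. norm x \<le> r \<Longrightarrow> \<bar>p x\<bar> \<le> C"
proof -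
  have "bounded (p ` cball 0 r)"
    by (intro compact_imp_bounded compact_continuous_image continuous_real_polynomial assms) auto
  then obtain C where "\<forall>x\<in>cball 0 r. \<bar>p x\<bar> \<le> C" unfolding bounded_iff by auto
  then have "\<And>x. norm x \<le> r \<Longrightarrow> \<bar>p x\<bar> \<le> C" by auto
  then have "\<And>x. norm x \<le> r \<Longrightarrow> \<bar>p x\<bar> \<le> max 0 C" by (simp add: le_max_iff_disj)
  then show ?thesis using that[of "max 0 C"] by simp
qed

lemma integral_ball_homogeneous_scale:
  fixes g :: "'a::euclidean_space \<Rightarrow> real"
  assumes [measurable]: "g \<in> borel_measurable borel" and "r > 0"
    and "\<And>c x. c > 0 \<Longrightarrow> g (c *\<^sub>R x) = c ^ m * g x"
  shows "(LINT x:ball 0 r|lborel. g x) = r ^ (DIM('a) + m) * (LINT x:ball 0 1|lborel. g x)"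
  using assms by (subst integral_ball_affine) (auto simp: power_add mult.assoc)

text \<open>
  Integration in polar coordinates for homogeneous integrands, where \<open>r ^ (D - 1 +
  m)\<close> integrates to \<open>1 / (D + m)\<close>. The proof compares \<open>g\<close> with
  the function \<open>k\<close> that is constant along rays and agrees with \<open>g\<close> on
  the sphere. Both integrals over a ball of radius \<open>r\<close> are known by scaling, and on
  the shell between the radii \<open>r\<close> and \<open>1\<close> the functions
  \<open>g\<close> and \<open>k\<close> differ by \<open>O(1 - r)\<close>, so that the
  difference of the shell integrals is \<open>O((1 - r)\<^sup>2)\<close>. Dividing by \<open>1 -
  r\<close> and letting \<open>r\<close> tend to \<open>1\<close> gives the identity.
\<close>

lemma integral_ball_homogeneous:
  fixes g :: "'a::euclidean_space \<Rightarrow> real"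
  assumes g: "real_polynomial_function g" and h: "homogeneous m g"
  shows "(real DIM('a) + real m) * (LINT x:ball 0 1|lborel. g x)
    = real DIM('a) * measure lborel (ball (0::'a) 1) * integral\<^sup>L sphere_measure g"
proof -
  let ?D = "DIM('a)" and ?V = "measure lborel (ball (0::'a) 1)"
  define k where "k = (\<lambda>x. g (x /\<^sub>R norm x))"
  define F where "F = (LINT x:ball 0 1|lborel. g x)"
  define G where "G = (LINT x:ball 0 1|lborel. k x)"
  have V: "?V > 0" by (simp add: content_ball_pos)
  have [measurable]: "g \<in> borel_measurable borel" using g by (rule measurable_real_polynomial)
  have [measurable]: "(\<lambda>x::'a. x /\<^sub>R norm x) \<in> borel_measurable borel" by measurable
  have [measurable]: "k \<in> borel_measurable borel" unfolding k_def by measurable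
  have gk: "g x = norm x ^ m * k x" for x
  proof (cases "x = 0")
    case True
    moreover have "g (0 *\<^sub>R 0) = 0 ^ m * g 0" using h unfolding homogeneous_def by blast
    ultimately show ?thesis by (simp add: k_def del: mult_cancel_right2 mult_cancel_right1)
  next
    case False
    then have "g (norm x *\<^sub>R (x /\<^sub>R norm x)) = norm x ^ m * k x"
      using h by (simp add: homogeneous_def k_def del: scaleR_scaleR)
    then show ?thesis using False by simp
  qed
  obtain C where C: "C \<ge> 0" "\<And>x. norm x \<le> 1 \<Longrightarrow> \<bar>g x\<bar> \<le> C"
    using real_polynomial_bounded_cball[OF g] by blast
  have kC: "\<bar>k x\<bar> \<le> C" for x unfolding k_def by (rule C(2)) (cases "x = 0"; simp)
  have kc: "k (c *\<^sub>R x) = k x" if "c > 0" for c x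
  proof -
    have "(c *\<^sub>R x) /\<^sub>R norm (c *\<^sub>R x) = x /\<^sub>R norm x" using that by (simp add: divide_simps)
    then show ?thesis unfolding k_def by (rule arg_cong)
  qed
  have kint: "set_integrable lborel (ball 0 r) k" for r
  proof -
    have "set_integrable lborel (ball 0 r :: 'a set) (\<lambda>_. C)"
      using set_integrable_ball_polynomial[OF real_polynomial_const] .
    then show ?thesis unfolding set_integrable_def
      by (rule Bochner_Integration.integrable_bound) (use kC C(1) in \<open>auto simp: indicator_def\<close>)
  qed
  have gint: "set_integrable lborel (ball 0 r) g" for r
    by (rule set_integrable_ball_polynomial[OF g])
  \<comment> \<open>the shell estimate: a product of two quantities of order 1 - r\<close>
  have shell: "\<bar>(1 - r ^ (?D + m)) * F - (1 - r ^ ?D) * G\<bar> \<le> C * ?V * (1 - r ^ m) * (1 - r ^ ?D)"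
    if r: "0 < r" "r < 1" for r :: real
  proof -
    let ?i = "\<lambda>s x. indicator (ball (0::'a) s) x :: real"
    let ?h = "\<lambda>x. (?i 1 x *\<^sub>R g x - ?i r x *\<^sub>R g x) - (?i 1 x *\<^sub>R k x - ?i r x *\<^sub>R k x)"
    let ?b = "\<lambda>x. ?i 1 x *\<^sub>R (C * (1 - r ^ m)) - ?i r x *\<^sub>R (C * (1 - r ^ m))"
    have Gr: "(LINT x:ball 0 r|lborel. k x) = r ^ ?D * G"
      unfolding G_def using integral_ball_homogeneous_scale[of k r 0] r kc
      by simp
    have Fr: "(LINT x:ball 0 r|lborel. g x) = r ^ (?D + m) * F"
      unfolding F_def using r h by (intro integral_ball_homogeneous_scale) (auto simp: homogeneous_def)
    have ints: "integrable lborel (\<lambda>x. ?i s x *\<^sub>R g x)" "integrable lborel (\<lambda>x. ?i s x *\<^sub>R k x)" for s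
      using kint[of s] gint[of s] by (auto simp: set_integrable_def)
    have intc: "integrable lborel (\<lambda>x::'a. ?i s x *\<^sub>R (C * (1 - r ^ m)))" for s
      using set_integrable_ball_polynomial[OF real_polynomial_const, of "0::'a" s "C * (1 - r ^ m)"]
      by (simp add: set_integrable_def)
    have rm: "r ^ m \<le> 1" using r by (simp add: power_le_one)
    have cst: "(\<integral>x. ?i s (x::'a) *\<^sub>R (C * (1 - r ^ m)) \<partial>lborel) = s ^ ?D * ?V * (C * (1 - r ^ m))" if "s > 0" for s
      using that content_ball_conv_unit_ball[of s "0::'a"] by simp
    have e1: "(1 - r ^ (?D + m)) * F - (1 - r ^ ?D) * G = integral\<^sup>L lborel ?h"
      using ints Fr Gr
      by (simp add: set_lebesgue_integral_def F_def G_def algebra_simps)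
    have e2: "\<bar>integral\<^sup>L lborel ?h\<bar> \<le> integral\<^sup>L lborel ?b"
    proof -
      have "norm (integral\<^sup>L lborel ?h) \<le> integral\<^sup>L lborel ?b"
      proof (rule Bochner_Integration.integral_norm_bound_integral)
        show "integrable lborel ?h" "integrable lborel ?b" using ints intc by auto
        show "norm (?h x) \<le> ?b x" for x
        proof (cases "norm x < 1 \<and> r \<le> norm x")
          case True
          then have "?h x = (norm x ^ m - 1) * k x" using gk[of x] by (simp add: algebra_simps)
          moreover have "\<bar>norm x ^ m - 1\<bar> \<le> 1 - r ^ m"
          proof -
            have "norm x ^ m \<le> 1" "r ^ m \<le> norm x ^ m"
              using True r by (auto simp: power_le_one intro: power_mono)
            then show ?thesis by auto
          qed
          ultimately have "\<bar>?h x\<bar> \<le> (1 - r ^ m) * C"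
            using kC[of x] by (simp only: abs_mult) (intro mult_mono, auto)
          then show ?thesis using True by (simp add: mult.commute)
        next
          case False
          then show ?thesis using r C(1) rm by (auto simp: indicator_def)
        qed
      qed
      then show ?thesis by simp
    qed
    have e3: "integral\<^sup>L lborel ?b = C * ?V * (1 - r ^ m) * (1 - r ^ ?D)"
    proof -
      have "integral\<^sup>L lborel ?b = 1 ^ ?D * ?V * (C * (1 - r ^ m)) - r ^ ?D * ?V * (C * (1 - r ^ m))"
        using Bochner_Integration.integral_diff[OF intc[of 1] intc[of r]] cst[of 1] cst[of r] r by simp
      then show ?thesis by (simp add: algebra_simps)
    qed
    show ?thesis using e2 unfolding e1 e3 .
  qed
  \<comment> \<open>the factor 1 - r is divided out by means of geometric sums\<close>
  let ?p = "\<lambda>n r. \<Sum>i<n. (r::real) ^ i"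
  have geo: "1 - r ^ n = (1 - r) * ?p n r" for r :: real and n
    using one_diff_power_eq[of r n] by simp
  have le: "\<bar>?p (?D + m) r * F - ?p ?D r * G\<bar> \<le> C * ?V * (1 - r ^ m) * ?p ?D r"
    if r: "0 < r" "r < 1" for r
  proof -
    have "(1 - r) * \<bar>?p (?D + m) r * F - ?p ?D r * G\<bar> = \<bar>(1 - r) * (?p (?D + m) r * F - ?p ?D r * G)\<bar>"
      using r by (simp add: abs_mult)
    also have "\<dots> = \<bar>(1 - r ^ (?D + m)) * F - (1 - r ^ ?D) * G\<bar>"
      unfolding geo[of r "?D + m"] geo[of r ?D] by (simp add: algebra_simps)
    also have "\<dots> \<le> C * ?V * (1 - r ^ m) * (1 - r ^ ?D)" by (rule shell[OF r])
    also have "\<dots> = (1 - r) * (C * ?V * (1 - r ^ m) * ?p ?D r)"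
      unfolding geo[of r ?D] by simp
    finally show ?thesis using r by simp
  qed
  have "((\<lambda>r. C * ?V * (1 - r ^ m) * ?p ?D r - \<bar>?p (?D + m) r * F - ?p ?D r * G\<bar>) \<longlongrightarrow>
      C * ?V * (1 - 1 ^ m) * ?p ?D 1 - \<bar>?p (?D + m) 1 * F - ?p ?D 1 * G\<bar>) (at_left (1::real))"
    by (intro tendsto_intros)
  moreover have "\<forall>\<^sub>F r in at_left (1::real). 0 \<le> C * ?V * (1 - r ^ m) * ?p ?D r - \<bar>?p (?D + m) r * F - ?p ?D r * G\<bar>"
    using eventually_at_left_real[of 0 "1::real"] by (auto elim!: eventually_mono simp: le)
  ultimately have "0 \<le> C * ?V * (1 - 1 ^ m) * ?p ?D 1 - \<bar>?p (?D + m) 1 * F - ?p ?D 1 * G\<bar>"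
    by (rule tendsto_lowerbound) simp
  then have "real (?D + m) * F = real ?D * G" by simp
  moreover have "G = ?V * integral\<^sup>L sphere_measure g"
    unfolding G_def k_def using integral_sphere_eq_ball[of g] V by simp
  ultimately show ?thesis by (simp add: F_def)
qed

section \<open>Green's identity on the ball and on the sphere\<close>

lemma real_polynomial_lipschitz:
  fixes p :: "'a::euclidean_space \<Rightarrow> real"
  assumes p: "real_polynomial_function p"
  obtains C where "C \<ge> 0" "\<And>x t. norm x \<le> r \<Longrightarrow> 0 \<le> t \<Longrightarrow> t \<le> 1 \<Longrightarrow> \<bar>p (x + t *\<^sub>R v) - p x\<bar> \<le> C * t"
proof -
  obtain C where C: "C \<ge> 0" "\<And>x. norm x \<le> r + norm v \<Longrightarrow> \<bar>dirderiv v p x\<bar> \<le> C"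
    using real_polynomial_bounded_cball[OF real_polynomial_dirderiv[OF p]] by blast
  have "\<bar>p (x + t *\<^sub>R v) - p x\<bar> \<le> C * t" if x: "norm x \<le> r" and t: "0 \<le> t" "t \<le> 1" for x t
  proof (cases "t = 0")
    case False
    then obtain z where z: "0 < z" "z < t" "p (x + t *\<^sub>R v) - p (x + 0 *\<^sub>R v) = (t - 0) * dirderiv v p (x + z *\<^sub>R v)"
      using MVT2[of 0 t "\<lambda>t. p (x + t *\<^sub>R v)" "\<lambda>t. dirderiv v p (x + t *\<^sub>R v)"]
        has_field_derivative_dirderiv[OF p] t by auto
    have "norm (x + z *\<^sub>R v) \<le> r + norm v"
    proof -
      have "norm (z *\<^sub>R v) \<le> 1 * norm v" using z t by (simp add: mult_left_le_one_le)
      then show ?thesis using norm_triangle_ineq[of x "z *\<^sub>R v"] x by linarith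
    qed
    then have "t * \<bar>dirderiv v p (x + z *\<^sub>R v)\<bar> \<le> t * C" using C(2) t by (intro mult_left_mono) auto
    then show ?thesis using z t by (simp add: abs_mult mult.commute)
  qed simp
  then show ?thesis using that C(1) by blast
qed

text \<open>
  The integrand is the derivative in the direction \<open>b\<close> of \<open>(1 - |x|\<^sup>2)
  q\<close>, which vanishes on the unit sphere. Extended by \<open>0\<close> this function is
  Lipschitz with compact support, so its difference quotients have integral \<open>0\<close> by
  translation invariance and converge boundedly to the integrand off the sphere.
\<close>

lemma integral_ball_weighted_dirderiv:
  fixes q :: "'a::euclidean_space \<Rightarrow> real"
  assumes q: "real_polynomial_function q" and b: "norm b = 1"
  shows "(LINT x:ball 0 1|lborel. (1 - x \<bullet> x) * dirderiv b q x - 2 * (x \<bullet> b) * q x) = 0"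
proof -
  define w where "w = (\<lambda>x::'a. max 0 (1 - x \<bullet> x))"
  define \<Phi> where "\<Phi> = (\<lambda>x. w x * q x)"
  define \<phi> where "\<phi> = (\<lambda>x. indicator (ball 0 1) x *\<^sub>R ((1 - x \<bullet> x) * dirderiv b q x - 2 * (x \<bullet> b) * q x))"
  define h where "h = (\<lambda>n::nat. 1 / real (Suc n))"
  define s where "s = (\<lambda>n x. (\<Phi> (x + h n *\<^sub>R b) - \<Phi> x) / h n)"
  have h: "h n > 0" "h n \<le> 1" for n by (auto simp: h_def divide_simps)
  have h0: "h \<longlonglongrightarrow> 0" unfolding h_def using LIMSEQ_inverse_real_of_nat by (simp add: inverse_eq_divide)
  have [measurable]: "q \<in> borel_measurable borel" "dirderiv b q \<in> borel_measurable borel"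
    using q by (auto intro: measurable_real_polynomial)
  have [measurable]: "w \<in> borel_measurable borel" unfolding w_def by measurable
  have [measurable]: "\<Phi> \<in> borel_measurable borel" unfolding \<Phi>_def by measurable
  have [measurable]: "ball 0 1 \<in> sets (borel :: 'a measure)" by simp
  have [measurable]: "\<phi> \<in> borel_measurable borel" unfolding \<phi>_def by measurable
  have xx: "x \<bullet> x = (norm x)\<^sup>2" for x :: 'a by (simp add: power2_norm_eq_inner)
  have w0: "w x = 0" if "norm x \<ge> 1" for x
    using that by (simp add: w_def xx)
  have w1: "w x \<le> 1" "w x \<ge> 0" for x by (auto simp: w_def)
  obtain C where C: "C \<ge> 0" "\<And>x. norm x \<le> 2 \<Longrightarrow> \<bar>q x\<bar> \<le> C"
    using real_polynomial_bounded_cball[OF q] by blast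
  obtain L where L: "L \<ge> 0" "\<And>x t. norm x \<le> 2 \<Longrightarrow> 0 \<le> t \<Longrightarrow> t \<le> 1 \<Longrightarrow> \<bar>q (x + t *\<^sub>R b) - q x\<bar> \<le> L * t"
    using real_polynomial_lipschitz[OF q] by blast
  have wl: "\<bar>w (x + t *\<^sub>R b) - w x\<bar> \<le> 5 * t" if "norm x \<le> 2" "0 \<le> t" "t \<le> 1" for x t
  proof -
    have "\<bar>w (x + t *\<^sub>R b) - w x\<bar> \<le> \<bar>(x + t *\<^sub>R b) \<bullet> (x + t *\<^sub>R b) - x \<bullet> x\<bar>"
      unfolding w_def by (auto simp: max_def)
    also have "\<dots> = \<bar>t * (2 * (x \<bullet> b) + t)\<bar>"
      using b by (simp add: inner_simps inner_commute norm_eq_1 algebra_simps)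
    also have "\<dots> \<le> t * 5"
    proof -
      have "\<bar>x \<bullet> b\<bar> \<le> 2" using Cauchy_Schwarz_ineq2[of x b] b that by simp
      then have "\<bar>2 * (x \<bullet> b) + t\<bar> \<le> 5" using that by (auto simp: abs_le_iff)
      then show ?thesis using that by (auto simp: abs_mult intro: mult_left_mono)
    qed
    finally show ?thesis by simp
  qed
  \<comment> \<open>5 bounds the Lipschitz constant of w on the ball of radius 2; the step is at most 1\<close>
  have bound: "\<bar>s n x\<bar> \<le> (5 * C + L) * indicator (ball 0 (5/2)) x" for n x
  proof (cases "norm x < 2")
    case True
    have n1: "norm (h n *\<^sub>R b) \<le> 1" using h[of n] b by simp
    have e: "\<Phi> (x + h n *\<^sub>R b) - \<Phi> x
       = w (x + h n *\<^sub>R b) * (q (x + h n *\<^sub>R b) - q x) + (w (x + h n *\<^sub>R b) - w x) * q x"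
      by (simp add: \<Phi>_def algebra_simps)
    have "\<bar>w (x + h n *\<^sub>R b) * (q (x + h n *\<^sub>R b) - q x)\<bar> \<le> 1 * (L * h n)"
      unfolding abs_mult using w1 L(2)[of x "h n"] True h[of n] by (intro mult_mono) auto
    moreover have "\<bar>(w (x + h n *\<^sub>R b) - w x) * q x\<bar> \<le> (5 * h n) * C"
      unfolding abs_mult using wl[of x "h n"] C True h[of n] by (intro mult_mono) auto
    ultimately have "\<bar>\<Phi> (x + h n *\<^sub>R b) - \<Phi> x\<bar> \<le> (5 * C + L) * h n"
      unfolding e by (simp add: algebra_simps abs_le_iff)
    then have "\<bar>s n x\<bar> \<le> 5 * C + L"
      unfolding s_def using h(1)[of n] by (simp add: abs_divide divide_le_eq)
    then show ?thesis using True by simp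
  next
    case False
    have "norm x \<le> norm (x + h n *\<^sub>R b) + norm (h n *\<^sub>R b)"
      by (metis add_diff_cancel_right' norm_triangle_ineq4)
    then have "norm (x + h n *\<^sub>R b) \<ge> 1" using False b h[of n] by simp
    then have "s n x = 0" using False w0 by (simp add: s_def \<Phi>_def)
    then show ?thesis using C L by simp
  qed
  have \<Phi>int: "integrable lborel \<Phi>"
  proof (rule Bochner_Integration.integrable_bound)
    show "integrable lborel (\<lambda>x::'a. indicator (ball 0 1) x *\<^sub>R C)"
      using set_integrable_ball_polynomial[OF real_polynomial_const] by (simp add: set_integrable_def)
    have "\<bar>\<Phi> x\<bar> \<le> indicator (ball 0 1) x *\<^sub>R C" for x
    proof (cases "norm x < 1")
      case True
      have "\<bar>w x\<bar> * \<bar>q x\<bar> \<le> 1 * C" using w1 C True by (intro mult_mono) auto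
      then show ?thesis using True by (simp add: \<Phi>_def abs_mult)
    qed (simp add: \<Phi>_def w0)
    then show "AE x in lborel. norm (\<Phi> x) \<le> norm (indicator (ball 0 1) x *\<^sub>R C)"
      using C(1) by (intro AE_I2) (simp add: order_trans[OF _ abs_ge_self])
  qed simp
  have shift: "integral\<^sup>L lborel (\<lambda>x. \<Phi> (x + v)) = integral\<^sup>L lborel \<Phi>"
    "integrable lborel (\<lambda>x. \<Phi> (x + v))" for v
  proof -
    have "integral\<^sup>L lborel \<Phi> = integral\<^sup>L (distr lborel borel ((+) v)) \<Phi>"
      by (simp add: lborel_distr_plus)
    also have "\<dots> = integral\<^sup>L lborel (\<lambda>x. \<Phi> (v + x))" by (rule integral_distr) auto
    finally show "integral\<^sup>L lborel (\<lambda>x. \<Phi> (x + v)) = integral\<^sup>L lborel \<Phi>" by (simp add: add.commute)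
    have "integrable (distr lborel borel ((+) v)) \<Phi>"
      using \<Phi>int by (simp add: lborel_distr_plus)
    then have "integrable lborel (\<lambda>x. \<Phi> (v + x))" by (rule integrable_distr[rotated]) auto
    then show "integrable lborel (\<lambda>x. \<Phi> (x + v))" by (simp add: add.commute)
  qed
  have s0: "integral\<^sup>L lborel (s n) = 0" for n
    unfolding s_def using shift[of "h n *\<^sub>R b"] \<Phi>int by simp
  have "(\<lambda>n. integral\<^sup>L lborel (s n)) \<longlonglongrightarrow> integral\<^sup>L lborel \<phi>"
  proof (rule integral_dominated_convergence)
    show "integrable lborel (\<lambda>x::'a. (5 * C + L) * indicator (ball 0 (5/2)) x)"
      using set_integrable_ball_polynomial[OF real_polynomial_const, of "0::'a" "5/2" "5 * C + L"]
      by (simp add: set_integrable_def mult.commute)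
    show "AE x in lborel. norm (s n x) \<le> (5 * C + L) * indicator (ball 0 (5/2)) x" for n
      using bound by (intro AE_I2) simp
    have "sphere (0::'a) 1 \<in> null_sets lborel"
      using negligible_sphere[of "0::'a" 1] null_sets_completion_iff[of "sphere (0::'a) 1" lborel]
      by (simp add: negligible_iff_null_sets)
    then have "AE x in lborel. x \<notin> sphere (0::'a) 1" by (rule AE_not_in)
    then show "AE x in lborel. (\<lambda>n. s n x) \<longlonglongrightarrow> \<phi> x"
    proof eventually_elim
      case (elim x)
      have hx: "(\<lambda>n. x + h n *\<^sub>R b) \<longlonglongrightarrow> x"
        using tendsto_add[OF tendsto_const tendsto_scaleR[OF h0 tendsto_const]] by simp
      consider "norm x < 1" | "norm x > 1" using elim by fastforce
      then show ?case
      proof cases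
        case 1
        have in1: "\<forall>\<^sub>F n in sequentially. norm (x + h n *\<^sub>R b) < 1"
          using tendsto_norm[OF hx] 1 by (rule order_tendstoD(2))
        have "((\<lambda>t. (1 - (x + t *\<^sub>R b) \<bullet> (x + t *\<^sub>R b)) * q (x + t *\<^sub>R b)) has_field_derivative
           (1 - x \<bullet> x) * dirderiv b q x - 2 * (x \<bullet> b) * q x) (at 0)"
          using has_field_derivative_dirderiv[OF q, of x b 0]
          by (auto simp: inner_simps inner_commute intro!: derivative_eq_intros)
        then have "(\<lambda>t. ((1 - (x + t *\<^sub>R b) \<bullet> (x + t *\<^sub>R b)) * q (x + t *\<^sub>R b) - (1 - x \<bullet> x) * q x) / t)
            \<midarrow>0\<rightarrow> (1 - x \<bullet> x) * dirderiv b q x - 2 * (x \<bullet> b) * q x"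
          unfolding DERIV_def by simp
        then have "(\<lambda>n. ((1 - (x + h n *\<^sub>R b) \<bullet> (x + h n *\<^sub>R b)) * q (x + h n *\<^sub>R b) - (1 - x \<bullet> x) * q x) / h n)
            \<longlonglongrightarrow> (1 - x \<bullet> x) * dirderiv b q x - 2 * (x \<bullet> b) * q x"
          by (rule filterlim_compose) (use h0 h(1) in \<open>auto simp: filterlim_at intro!: always_eventually less_imp_neq[symmetric]\<close>)
        moreover have "\<forall>\<^sub>F n in sequentially.
          ((1 - (x + h n *\<^sub>R b) \<bullet> (x + h n *\<^sub>R b)) * q (x + h n *\<^sub>R b) - (1 - x \<bullet> x) * q x) / h n = s n x"
          using in1
        proof eventually_elim
          case (elim n)
          have "w y = 1 - y \<bullet> y" if "norm y < 1" for y
            using that by (simp add: w_def xx abs_square_less_1 less_imp_le)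
          then show ?case using 1 elim by (simp add: s_def \<Phi>_def)
        qed
        ultimately have "(\<lambda>n. s n x) \<longlonglongrightarrow> (1 - x \<bullet> x) * dirderiv b q x - 2 * (x \<bullet> b) * q x"
          by (rule Lim_transform_eventually)
        then show ?thesis using 1 by (simp add: \<phi>_def)
      next
        case 2
        have "\<forall>\<^sub>F n in sequentially. norm (x + h n *\<^sub>R b) > 1"
          using tendsto_norm[OF hx] 2 by (rule order_tendstoD(1))
        then have "\<forall>\<^sub>F n in sequentially. 0 = s n x"
          by eventually_elim (use 2 w0 in \<open>simp add: s_def \<Phi>_def\<close>)
        then have "(\<lambda>n. s n x) \<longlonglongrightarrow> 0"
          by (rule Lim_transform_eventually[OF tendsto_const])
        then show ?thesis using 2 by (simp add: \<phi>_def)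
      qed
    qed
  qed (auto simp: s_def)
  then have "integral\<^sup>L lborel \<phi> = 0" using s0 LIMSEQ_unique[OF _ tendsto_const] by fastforce
  then show ?thesis by (simp add: \<phi>_def set_lebesgue_integral_def)
qed

lemma integral_ball_laplacian:
  fixes g :: "'a::euclidean_space \<Rightarrow> real"
  assumes g: "real_polynomial_function g"
  shows "(LINT x:ball 0 1|lborel. (1 - x \<bullet> x) * laplacian g x)
    = 2 * (LINT x:ball 0 1|lborel. (\<Sum>b\<in>Basis. (x \<bullet> b) * dirderiv b g x))"
proof -
  let ?f = "\<lambda>b x. (1 - x \<bullet> x) * dirderiv b (dirderiv b g) x" and ?k = "\<lambda>b x. (x \<bullet> b) * dirderiv b g x"
  have i1: "set_integrable lborel (ball 0 1) (?f b)" for b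
    using g by (intro set_integrable_ball_polynomial real_polynomial_mult real_polynomial_function_diff) auto
  have i2: "set_integrable lborel (ball 0 1) (?k b)" for b
    using g by (intro set_integrable_ball_polynomial real_polynomial_mult real_polynomial_function_diff) auto
  have i3: "set_integrable lborel (ball 0 1) (\<lambda>x. 2 * ?k b x)" for b
    using i2 by simp
  have z: "(LINT x:ball 0 1|lborel. ?f b x) = 2 * (LINT x:ball 0 1|lborel. ?k b x)" if "b \<in> Basis" for b
  proof -
    have "(LINT x:ball 0 1|lborel. ?f b x - 2 * ?k b x) = 0"
      using integral_ball_weighted_dirderiv[of "dirderiv b g" b] g that by (simp add: real_polynomial_dirderiv mult.assoc)
    then show ?thesis using set_integral_diff(2)[OF i1[of b] i3[of b]] by simp
  qed
  have "(LINT x:ball 0 1|lborel. (1 - x \<bullet> x) * laplacian g x) = (LINT x:ball 0 1|lborel. (\<Sum>b\<in>Basis. ?f b x))"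
    by (simp add: laplacian_eq[OF g] sum_distrib_left)
  also have "\<dots> = (\<Sum>b\<in>Basis. LINT x:ball 0 1|lborel. ?f b x)"
    using i1 unfolding set_lebesgue_integral_def set_integrable_def scaleR_sum_right
    by (intro Bochner_Integration.integral_sum) auto
  also have "\<dots> = (\<Sum>b\<in>Basis. 2 * (LINT x:ball 0 1|lborel. ?k b x))" using z by simp
  also have "\<dots> = 2 * (LINT x:ball 0 1|lborel. (\<Sum>b\<in>Basis. ?k b x))"
    using i2 unfolding set_lebesgue_integral_def set_integrable_def scaleR_sum_right sum_distrib_left[symmetric]
    by (subst Bochner_Integration.integral_sum) auto
  finally show ?thesis .
qed

text \<open>
  The analytic fact on which the whole theory of spherical harmonics rests here: integrating
  against the weight \<open>1 - |x|\<^sup>2\<close> removes the boundary terms in Green's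
  identity, and \<open>integral_ball_homogeneous\<close> transports the result to the sphere. It
  expresses that the spherical part of the Laplacian integrates to \<open>0\<close>.
\<close>

lemma integral_sphere_laplacian:
  fixes g :: "'a::euclidean_space \<Rightarrow> real"
  assumes g: "real_polynomial_function g" and h: "homogeneous n g" and D: "DIM('a) \<ge> 2"
  shows "integral\<^sup>L sphere_measure (laplacian g)
    = real n * (real n + real DIM('a) - 2) * integral\<^sup>L sphere_measure g"
proof -
  let ?D = "real DIM('a)" and ?V = "measure lborel (ball (0::'a) 1)"
  let ?J = "\<lambda>f. LINT x:ball 0 1|lborel. (f x :: real)"
  have V: "?V > 0" by (simp add: content_ball_pos)
  have l: "real_polynomial_function (laplacian g)" "homogeneous (n - 2) (laplacian g)"
    using g h by (auto simp: homogeneous_laplacian)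
  have J: "?J (\<lambda>x. (1 - x \<bullet> x) * laplacian g x) = 2 * (real n * ?J g)"
    using integral_ball_laplacian[OF g] by (simp add: euler_homogeneous[OF g h])
  show ?thesis
  proof (cases "n \<le> 1")
    case True
    then have "laplacian g = (\<lambda>x. 0)" using laplacian_low_degree[OF g h] by simp
    then have "real n * ?J g = 0" using J by simp
    then have "n = 0 \<or> integral\<^sup>L sphere_measure g = 0"
      using integral_ball_homogeneous[OF g h] V by auto
    then show ?thesis using \<open>laplacian g = (\<lambda>x. 0)\<close> by auto
  next
    case False
    let ?m = "n - 2"
    have rm: "real ?m = real n - 2" using False by simp
    have p: "real_polynomial_function (\<lambda>x. (x \<bullet> x) * laplacian g x)" using l by auto
    have hp: "homogeneous n (\<lambda>x. (x \<bullet> x) * laplacian g x)"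
      using homogeneous_mult[OF homogeneous_inner_self l(2)] le_add_diff_inverse[of 2 n] False by simp
    have same: "integral\<^sup>L sphere_measure (\<lambda>x. (x \<bullet> x) * laplacian g x) = integral\<^sup>L sphere_measure (laplacian g)"
      by (rule integral_sphere_cong) (simp add: norm_eq_1)
    have 1: "(?D + real n - 2) * ?J (laplacian g) = ?D * ?V * integral\<^sup>L sphere_measure (laplacian g)"
      using integral_ball_homogeneous[OF l] rm by (simp add: algebra_simps)
    have 2: "(?D + real n) * ?J (\<lambda>x. (x \<bullet> x) * laplacian g x) = ?D * ?V * integral\<^sup>L sphere_measure (laplacian g)"
      using integral_ball_homogeneous[OF p hp] same by simp
    have 3: "(?D + real n) * ?J g = ?D * ?V * integral\<^sup>L sphere_measure g"
      by (rule integral_ball_homogeneous[OF g h])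
    have 4: "?J (laplacian g) - ?J (\<lambda>x. (x \<bullet> x) * laplacian g x) = 2 * (real n * ?J g)"
      using set_integral_diff(2)[OF set_integrable_ball_polynomial[OF l(1)] set_integrable_ball_polynomial[OF p], of 0 1]
        J by (simp add: algebra_simps)
    let ?A = "?J (laplacian g)"
    define k where "k = ?D + real n"
    have k: "k > 2" using D False by (simp add: k_def)
    have "k * (?A - ?J (\<lambda>x. (x \<bullet> x) * laplacian g x)) = 2 * ?A"
      using 1 2 by (simp add: k_def algebra_simps)
    then have "2 * ?A = k * (2 * (real n * ?J g))" unfolding 4 by simp
    then have "?A = real n * (k * ?J g)" by simp
    then have "?A = real n * (?D * ?V * integral\<^sup>L sphere_measure g)" using 3 by (simp add: k_def)
    then have "?D * ?V * integral\<^sup>L sphere_measure (laplacian g)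
        = ?D * ?V * (real n * (k - 2) * integral\<^sup>L sphere_measure g)"
      using 1 by (simp add: k_def algebra_simps)
    moreover have "?D * ?V \<noteq> 0" using V by simp
    ultimately have "integral\<^sup>L sphere_measure (laplacian g) = real n * (k - 2) * integral\<^sup>L sphere_measure g"
      using mult_left_cancel by blast
    then show ?thesis by (simp add: k_def add.commute)
  qed
qed

section \<open>Orthogonality and the Funk-Hecke formula\<close>

lemma laplacian_mult_harmonic:
  assumes "solid_harmonic l g" "solid_harmonic m h"
  shows "laplacian (\<lambda>x. g x * h x) = (\<lambda>x. 2 * (\<Sum>b\<in>Basis. dirderiv b g x * dirderiv b h x))"
  using assms by (simp add: solid_harmonic_def laplacian_mult)

lemma solid_harmonic_polynomial: "solid_harmonic l h \<Longrightarrow> real_polynomial_function h"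
  and solid_harmonic_homogeneous: "solid_harmonic l h \<Longrightarrow> homogeneous l h"
  by (auto simp: solid_harmonic_def)

text \<open>
  The Laplacian of \<open>g h\<close> is a sum of products of derivatives of \<open>g\<close>
  and \<open>h\<close>, which are harmonics whose degrees are again different. By
  \<open>integral_sphere_laplacian\<close> the claim therefore reduces to smaller degrees, down
  to the case in which one factor is constant and all these products vanish.
\<close>

lemma solid_harmonic_orthogonal:
  fixes g h :: "'a::euclidean_space \<Rightarrow> real"
  assumes "DIM('a) \<ge> 2" "solid_harmonic l g" "solid_harmonic m h" "l \<noteq> m"
  shows "(\<integral>x. g x * h x \<partial>sphere_measure) = 0"
  using assms(2-4)
proof (induction l arbitrary: m g h)
  case 0
  have p: "real_polynomial_function (\<lambda>x. g x * h x)" "homogeneous (0 + m) (\<lambda>x. g x * h x)"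
    using 0 solid_harmonic_polynomial solid_harmonic_homogeneous
    by (blast intro: homogeneous_mult real_polynomial_mult)+
  have "dirderiv b g = (\<lambda>x. 0)" for b
    using homogeneous_0_dirderiv solid_harmonic_homogeneous 0 by blast
  then have "real m * (real m + real DIM('a) - 2) * (\<integral>x. g x * h x \<partial>sphere_measure) = 0"
    using integral_sphere_laplacian[OF p assms(1)] laplacian_mult_harmonic[OF 0(1,2)] by simp
  then show ?case using 0 assms(1) by auto
next
  case (Suc l)
  have p: "real_polynomial_function (\<lambda>x. g x * h x)" "homogeneous (Suc l + m) (\<lambda>x. g x * h x)"
    using Suc.prems solid_harmonic_polynomial solid_harmonic_homogeneous
    by (blast intro: homogeneous_mult real_polynomial_mult)+
  have "(\<integral>x. dirderiv b g x * dirderiv b h x \<partial>sphere_measure) = 0" for b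
  proof (cases m)
    case 0
    then have "dirderiv b h = (\<lambda>x. 0)"
      using homogeneous_0_dirderiv solid_harmonic_homogeneous Suc.prems by blast
    then show ?thesis by simp
  next
    case (Suc m')
    then show ?thesis
      using Suc.IH[of "dirderiv b g" m' "dirderiv b h"] Suc.prems
        solid_harmonic_dirderiv[of "Suc l" g b] solid_harmonic_dirderiv[of m h b] by simp
  qed
  moreover have "integrable sphere_measure (\<lambda>x. dirderiv b g x * dirderiv b h x)" for b
    using Suc.prems
    by (intro integrable_sphere_polynomial real_polynomial_mult real_polynomial_dirderiv solid_harmonic_polynomial)
  ultimately have "integral\<^sup>L sphere_measure (laplacian (\<lambda>x. g x * h x)) = 0"
    using laplacian_mult_harmonic[OF Suc.prems(1,2)] by (simp add: Bochner_Integration.integral_sum)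
  then have "real (Suc l + m) * (real (Suc l + m) + real DIM('a) - 2) * (\<integral>x. g x * h x \<partial>sphere_measure) = 0"
    using integral_sphere_laplacian[OF p assms(1)] by simp
  moreover have "real (Suc l + m) * (real (Suc l + m) + real DIM('a) - 2) > 0"
    using assms(1) by (intro mult_pos_pos) auto
  ultimately show ?case by (metis less_irrefl mult_eq_0_iff)
qed

lemma integral_sphere_harmonic:
  fixes h :: "'a::euclidean_space \<Rightarrow> real"
  assumes "DIM('a) \<ge> 2" "solid_harmonic l h" "l > 0"
  shows "integral\<^sup>L sphere_measure h = 0"
  using solid_harmonic_orthogonal[OF assms(1) solid_harmonic_const[of 1] assms(2)] assms(3) by simp

text \<open>
  The eigenvalue of the convolution with \<open>t ^ m\<close> on the harmonics of degree
  \<open>l\<close> in dimension \<open>D\<close>. The recursion is what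
  \<open>integral_sphere_laplacian\<close> gives for the integral of \<open>(x \<bullet> e) ^ m
  h(x)\<close>.
\<close>

fun funk_hecke_coeff :: "nat \<Rightarrow> nat \<Rightarrow> nat \<Rightarrow> real" where
  "funk_hecke_coeff D 0 l = (if l = 0 then 1 else 0)"
| "funk_hecke_coeff D (Suc m) l =
    (real (Suc m) * real m * funk_hecke_coeff D (m - 1) l + 2 * real (Suc m) * real l * funk_hecke_coeff D m (l - 1))
     / (real (Suc m + l) * (real (Suc m + l) + real D - 2))"

lemma dirderiv_inner_power:
  "dirderiv v (\<lambda>x. (x \<bullet> e) ^ n) = (\<lambda>x. real n * (v \<bullet> e) * (x \<bullet> e) ^ (n - 1))"
  by (intro ext dirderiv_eqI) (auto simp: inner_simps intro!: derivative_eq_intros)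

lemma laplacian_inner_power:
  fixes e :: "'a::euclidean_space"
  assumes "norm e = 1"
  shows "laplacian (\<lambda>x. (x \<bullet> e) ^ n) = (\<lambda>x. real n * real (n - 1) * (x \<bullet> e) ^ (n - 2))"
proof -
  have "dirderiv b (\<lambda>x. real n * (b \<bullet> e) * (x \<bullet> e) ^ (n - 1))
      = (\<lambda>x. real n * (b \<bullet> e) * (real (n - 1) * (b \<bullet> e) * (x \<bullet> e) ^ (n - 1 - 1)))" for b
    by (subst dirderiv_cmult) (auto simp: dirderiv_inner_power)
  then have "laplacian (\<lambda>x. (x \<bullet> e) ^ n)
      = (\<lambda>x. \<Sum>b\<in>Basis. real n * real (n - 1) * (x \<bullet> e) ^ (n - 2) * ((e \<bullet> b) * (e \<bullet> b)))"
    by (simp add: laplacian_eq real_polynomial_function_power real_polynomial_inner dirderiv_inner_power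
        inner_commute mult_ac numeral_2_eq_2)
  also have "\<dots> = (\<lambda>x. real n * real (n - 1) * (x \<bullet> e) ^ (n - 2) * (\<Sum>b\<in>Basis. (e \<bullet> b) * (e \<bullet> b)))"
    by (simp add: sum_distrib_left)
  also have "(\<Sum>b\<in>Basis. (e \<bullet> b) * (e \<bullet> b)) = 1"
    using assms by (simp add: norm_eq_1 flip: euclidean_inner)
  finally show ?thesis by simp
qed

text \<open>
  The product rule writes the Laplacian of \<open>(x \<bullet> e) ^ m h(x)\<close> as a
  combination of two integrands of the same type, one with \<open>h\<close> and a smaller power,
  the other with the harmonic \<open>dirderiv e h\<close>, whose value at \<open>e\<close> is
  \<open>l h(e)\<close> by Euler's identity. So the total degree drops, and induction applies.
\<close>

theorem funk_hecke_power:
  fixes h :: "'a::euclidean_space \<Rightarrow> real"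
  assumes D: "DIM('a) \<ge> 2" and e: "norm e = 1" and "solid_harmonic l h"
  shows "(\<integral>x. (x \<bullet> e) ^ m * h x \<partial>sphere_measure) = funk_hecke_coeff DIM('a) m l * h e"
  using assms(3)
proof (induction "DIM('a)" m l arbitrary: h rule: funk_hecke_coeff.induct)
  case (1 l)
  show ?case
  proof (cases "l = 0")
    case True
    then have "h = (\<lambda>x. h e)"
      using homogeneous_0_eq solid_harmonic_homogeneous 1 by metis
    then have "integral\<^sup>L sphere_measure h = (\<integral>x. h e \<partial>(sphere_measure :: 'a measure))" by metis
    then show ?thesis using True integral_sphere_const[of "h e", where 'a='a] by simp
  next
    case False
    then show ?thesis using integral_sphere_harmonic[OF D 1] by simp
  qed
next
  case (2 m l)
  let ?I = "\<lambda>f. integral\<^sup>L sphere_measure (f :: 'a \<Rightarrow> real)"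
  let ?n = "Suc m" and ?D = "DIM('a)"
  have h: "real_polynomial_function h" "homogeneous l h" "laplacian h = (\<lambda>x. 0)"
    using 2(3) by (auto simp: solid_harmonic_def)
  let ?f = "\<lambda>x. (x \<bullet> e) ^ ?n * h x"
  have f: "real_polynomial_function ?f"
    using h(1) by (intro real_polynomial_mult real_polynomial_function_power real_polynomial_inner)
  have "homogeneous (1 * ?n) (\<lambda>x. (x \<bullet> e) ^ ?n)" by (rule homogeneous_power[OF homogeneous_inner])
  then have fh: "homogeneous (?n + l) ?f" using homogeneous_mult[OF _ h(2)] unfolding mult_1 by blast
  let ?A = "\<lambda>x. (x \<bullet> e) ^ (m - 1) * h x" and ?B = "\<lambda>x. (x \<bullet> e) ^ m * dirderiv e h x"
  have lap: "laplacian ?f = (\<lambda>x. real ?n * real m * ?A x + 2 * real ?n * ?B x)"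
  proof
    fix x
    have "(\<Sum>b\<in>Basis. real ?n * (b \<bullet> e) * (x \<bullet> e) ^ m * dirderiv b h x)
        = real ?n * (x \<bullet> e) ^ m * (\<Sum>b\<in>Basis. (e \<bullet> b) * dirderiv b h x)"
      by (simp add: sum_distrib_left inner_commute mult_ac del: of_nat_Suc)
    also have "\<dots> = real ?n * ?B x" using dirderiv_sum_Basis[OF h(1), of e x] by simp
    finally have "(\<Sum>b\<in>Basis. real ?n * (b \<bullet> e) * (x \<bullet> e) ^ m * dirderiv b h x) = real ?n * ?B x" .
    then show "laplacian ?f x = real ?n * real m * ?A x + 2 * real ?n * ?B x"
      using laplacian_mult[OF real_polynomial_function_power[OF real_polynomial_inner] h(1), of e ?n]
      by (simp add: laplacian_inner_power[OF e] dirderiv_inner_power h(3) numeral_2_eq_2 del: of_nat_Suc power_Suc)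
  qed
  have int: "integrable sphere_measure ?A" "integrable sphere_measure ?B"
    using h(1) by (intro integrable_sphere_polynomial real_polynomial_mult
        real_polynomial_function_power real_polynomial_inner real_polynomial_dirderiv; simp)+
  have "?I (laplacian ?f) = real ?n * real m * ?I ?A + 2 * real ?n * ?I ?B"
    unfolding lap using int by simp
  moreover have "?I ?A = funk_hecke_coeff ?D (m - 1) l * h e"
    using 2(1)[OF 2(3)] .
  moreover have "?I ?B = funk_hecke_coeff ?D m (l - 1) * dirderiv e h e"
    using 2(2)[OF solid_harmonic_dirderiv[OF 2(3)]] .
  moreover have "dirderiv e h e = real l * h e"
    using euler_homogeneous[OF h(1,2), of e] dirderiv_sum_Basis[OF h(1), of e e] by simp
  moreover have "?I (laplacian ?f) = real (?n + l) * (real (?n + l) + real ?D - 2) * ?I ?f"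
    by (rule integral_sphere_laplacian[OF f fh D])
  moreover have "real (?n + l) * (real (?n + l) + real ?D - 2) \<noteq> 0"
  proof -
    have "real (?n + l) * (real (?n + l) + real ?D - 2) > 0" using D by (intro mult_pos_pos) auto
    then show ?thesis by linarith
  qed
  ultimately have "?I ?f = (real ?n * real m * (funk_hecke_coeff ?D (m - 1) l * h e)
     + 2 * real ?n * (funk_hecke_coeff ?D m (l - 1) * (real l * h e))) / (real (?n + l) * (real (?n + l) + real ?D - 2))"
    by (simp only: eq_divide_eq if_True not_False_eq_True) (simp only: mult.commute)
  also have "\<dots> = funk_hecke_coeff ?D ?n l * h e"
    unfolding funk_hecke_coeff.simps(2) times_divide_eq_left by (rule arg_cong[where f="\<lambda>x. x / _"]) (simp add: algebra_simps)
  finally show ?case .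
qed

lemma funk_hecke_coeff_zero: "m < l \<Longrightarrow> funk_hecke_coeff D m l = 0"
  by (induction D m l rule: funk_hecke_coeff.induct) auto

text \<open>
  The coefficients form a triangular matrix with nonzero diagonal. This lets one solve the
  expansions of the powers \<open>t ^ m\<close> for the reproducing kernels.
\<close>

lemma funk_hecke_coeff_diag_pos:
  assumes "D \<ge> 2" shows "funk_hecke_coeff D m m > 0"
proof (induction m)
  case (Suc m)
  then show ?case using assms by (simp add: funk_hecke_coeff_zero add_pos_nonneg)
qed simp

section \<open>The mean value property and the energy in shells\<close>

text \<open>
  The homogeneous parts of a harmonic polynomial are harmonic, because the Laplacian of
  \<open>p(c x)\<close> is a polynomial in \<open>c\<close> that vanishes identically.
\<close>

lemma harmonic_polynomial_homogeneous_sum: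
  fixes p :: "'a::euclidean_space \<Rightarrow> real"
  assumes p: "real_polynomial_function p" and lap: "laplacian p = (\<lambda>x. 0)"
  shows "\<exists>n h. (\<forall>i. solid_harmonic i (h i)) \<and> p = (\<lambda>x. \<Sum>i\<le>n. h i x)"
proof -
  obtain n h where h: "\<And>i. real_polynomial_function (h i)" "\<And>i. homogeneous i (h i)"
    "p = (\<lambda>x. \<Sum>i\<le>n. h i x)" using polynomial_homogeneous_sum[OF p] by metis
  have "laplacian (h i) x = 0" if "i \<le> n" for i x
  proof -
    \<comment> \<open>the factor c^2 repairs the truncated exponent i - 2: for i = 0 and i = 1 the Laplacian
      vanishes\<close>
    have "(\<Sum>i\<le>n. laplacian (h i) x * c ^ i) = 0" for c
    proof -
      have "laplacian (h i) x * c ^ i = c\<^sup>2 * laplacian (h i) (c *\<^sub>R x)" for i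
      proof (cases "i \<le> 1")
        case True
        then show ?thesis using laplacian_low_degree[OF h(1,2)[of i]] by simp
      next
        case False
        then have "2 + (i - 2) = i" by simp
        then have "c ^ i = c\<^sup>2 * c ^ (i - 2)" by (metis power_add)
        then show ?thesis using homogeneous_laplacian[OF h(1,2)[of i]] by (simp add: homogeneous_def)
      qed
      then have "(\<Sum>i\<le>n. laplacian (h i) x * c ^ i) = c\<^sup>2 * laplacian p (c *\<^sub>R x)"
        unfolding h(3) by (simp add: laplacian_sum h(1) sum_distrib_left)
      then show ?thesis by (simp add: lap)
    qed
    then show ?thesis using polyfun_eq_0[of "\<lambda>i. laplacian (h i) x" n] that by blast
  qed
  then have "solid_harmonic i (\<lambda>x. if i \<le> n then h i x else 0)" for i
    using h(1,2)[of i] by (cases "i \<le> n") (auto simp: solid_harmonic_zero solid_harmonic_def)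
  moreover have "p = (\<lambda>x. \<Sum>i\<le>n. if i \<le> n then h i x else 0)"
    unfolding h(3) by (intro ext sum.cong) auto
  ultimately show ?thesis by (intro exI[of _ n] exI[of _ "\<lambda>i x. if i \<le> n then h i x else 0"]) auto
qed

text \<open>
  The mean value property: all homogeneous parts of positive degree have integral
  \<open>0\<close>.
\<close>

lemma integral_ball_harmonic:
  fixes p :: "'a::euclidean_space \<Rightarrow> real"
  assumes D: "DIM('a) \<ge> 2" and p: "real_polynomial_function p" and lap: "laplacian p = (\<lambda>x. 0)"
  shows "(LINT x:ball 0 1|lborel. p x) = measure lborel (ball (0::'a) 1) * p 0"
proof -
  let ?V = "measure lborel (ball (0::'a) 1)"
  obtain n h where h: "\<And>i. solid_harmonic i (h i)" "p = (\<lambda>x. \<Sum>i\<le>n. h i x)"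
    using harmonic_polynomial_homogeneous_sum[OF p lap] by metis
  have *: "(LINT x:ball 0 1|lborel. h i x) = ?V * h i 0" for i
  proof (cases "i = 0")
    case True
    define c where "c = h i 0"
    have "h i = (\<lambda>x. c)"
      unfolding c_def using True homogeneous_0_eq solid_harmonic_homogeneous h(1) by blast
    then show ?thesis by (simp add: set_lebesgue_integral_def)
  next
    case False
    have "h i (0 *\<^sub>R 0) = 0 ^ i * h i 0" using solid_harmonic_homogeneous[OF h(1)] by (simp only: homogeneous_def)
    then have "h i 0 = 0" using False by (cases i) auto
    moreover have "(LINT x:ball 0 1|lborel. h i x) = 0"
      using integral_ball_homogeneous[OF solid_harmonic_polynomial[OF h(1)] solid_harmonic_homogeneous[OF h(1)], of i]
        integral_sphere_harmonic[OF D h(1)] False by simp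
    ultimately show ?thesis by simp
  qed
  have "(LINT x:ball 0 1|lborel. p x) = (\<Sum>i\<le>n. LINT x:ball 0 1|lborel. h i x)"
    using set_integrable_ball_polynomial[OF solid_harmonic_polynomial[OF h(1)], of 0 1]
    unfolding h(2) set_lebesgue_integral_def set_integrable_def scaleR_sum_right
    by (intro Bochner_Integration.integral_sum) auto
  then show ?thesis by (simp add: * h(2) sum_distrib_left)
qed

text \<open>
  The mean value property on the ball with centre \<open>z\<close>, applied to the rescaled
  polynomial \<open>v(x) = u(z + r x)\<close>, together with the nonnegativity of the integral
  of \<open>(v - v(0))\<^sup>2\<close>.
\<close>

lemma harmonic_sub_mean_value:
  fixes u :: "'a::euclidean_space \<Rightarrow> real"
  assumes D: "DIM('a) \<ge> 2" and u: "real_polynomial_function u" and lap: "laplacian u = (\<lambda>x. 0)"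
    and r: "r > 0"
  shows "measure lborel (ball (0::'a) 1) * r ^ DIM('a) * (u z)\<^sup>2 \<le> (LINT x:ball z r|lborel. (u x)\<^sup>2)"
proof -
  let ?V = "measure lborel (ball (0::'a) 1)" and ?J = "\<lambda>f. LINT x:ball (0::'a) 1|lborel. (f x :: real)"
  define v where "v = (\<lambda>x. u (z + r *\<^sub>R x))"
  have pv: "real_polynomial_function v"
  proof -
    have "polynomial_function (\<lambda>x::'a. z + r *\<^sub>R x)"
      by (intro polynomial_function_add polynomial_function_const polynomial_function_cmul polynomial_function_id[unfolded id_def])
    then have "real_polynomial_function (u \<circ> (\<lambda>x. z + r *\<^sub>R x))"
      using u by (rule real_polynomial_function_compose)
    then show ?thesis by (simp add: v_def o_def)
  qed
  have dv: "dirderiv b (\<lambda>x. q (z + r *\<^sub>R x)) = (\<lambda>x. r * dirderiv b q (z + r *\<^sub>R x))"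
    if "real_polynomial_function q" for q and b :: 'a
  proof (intro ext dirderiv_eqI)
    fix x
    have "((\<lambda>t. q ((z + r *\<^sub>R x) + (r * t) *\<^sub>R b)) has_field_derivative
        dirderiv b q ((z + r *\<^sub>R x) + (r * 0) *\<^sub>R b) * r) (at 0)"
      by (rule DERIV_chain'[OF _ has_field_derivative_dirderiv[OF that]])
        (auto intro!: derivative_eq_intros)
    then show "((\<lambda>t. q (z + r *\<^sub>R (x + t *\<^sub>R b))) has_field_derivative r * dirderiv b q (z + r *\<^sub>R x)) (at 0)"
      by (simp add: algebra_simps)
  qed
  have pd: "real_polynomial_function (\<lambda>x. dirderiv b u (z + r *\<^sub>R x))" for b
  proof -
    have "dirderiv b v = (\<lambda>x. r * dirderiv b u (z + r *\<^sub>R x))" unfolding v_def using dv[OF u] .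
    then have "real_polynomial_function (\<lambda>x. 1 / r * (r * dirderiv b u (z + r *\<^sub>R x)))"
      using real_polynomial_cmult[OF real_polynomial_dirderiv[OF pv], of "1 / r" b] by simp
    then show ?thesis using r by simp
  qed
  have "laplacian v x = r\<^sup>2 * laplacian u (z + r *\<^sub>R x)" for x
  proof -
    have "dirderiv b (dirderiv b v) x = r\<^sup>2 * dirderiv b (dirderiv b u) (z + r *\<^sub>R x)" for b
      unfolding v_def dv[OF u]
      using dirderiv_cmult[OF pd, of b r b] dv[OF real_polynomial_dirderiv[OF u, of b], of b]
      by (simp add: power2_eq_square)
    then show ?thesis by (simp add: laplacian_eq[OF pv] laplacian_eq[OF u] sum_distrib_left)
  qed
  then have "laplacian v = (\<lambda>x. 0)" by (auto simp: lap)
  then have mean: "?J v = ?V * v 0" by (rule integral_ball_harmonic[OF D pv])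
  have sq: "set_integrable lborel (ball 0 1) (\<lambda>x. (v x)\<^sup>2)"
    using pv by (intro set_integrable_ball_polynomial real_polynomial_function_power)
  have lin: "set_integrable lborel (ball 0 1) (\<lambda>x. 2 * v 0 * v x - (v 0)\<^sup>2)"
    using pv by (intro set_integrable_ball_polynomial real_polynomial_function_diff real_polynomial_cmult real_polynomial_const)
  have "0 \<le> ?J (\<lambda>x. (v x)\<^sup>2 - (2 * v 0 * v x - (v 0)\<^sup>2))"
    unfolding set_lebesgue_integral_def
  proof (rule Bochner_Integration.integral_nonneg)
    fix x
    have "(v x)\<^sup>2 - (2 * v 0 * v x - (v 0)\<^sup>2) = (v x - v 0)\<^sup>2" by (simp add: power2_eq_square algebra_simps)
    then show "0 \<le> indicator (ball 0 1) x *\<^sub>R ((v x)\<^sup>2 - (2 * v 0 * v x - (v 0)\<^sup>2))"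
      by (simp add: indicator_def)
  qed
  also have "\<dots> = ?J (\<lambda>x. (v x)\<^sup>2) - ?J (\<lambda>x. 2 * v 0 * v x - (v 0)\<^sup>2)"
    by (rule set_integral_diff(2)[OF sq lin])
  also have "?J (\<lambda>x. 2 * v 0 * v x - (v 0)\<^sup>2) = 2 * v 0 * ?J v - ?J (\<lambda>x. (v 0)\<^sup>2)"
    using set_integral_diff(2)[OF set_integrable_ball_polynomial[OF real_polynomial_cmult[OF pv]]
        set_integrable_ball_polynomial[OF real_polynomial_const], of 0 1 "2 * v 0" "(v 0)\<^sup>2"] by simp
  also have "?J (\<lambda>x. (v 0)\<^sup>2) = ?V * (v 0)\<^sup>2" by (simp add: set_lebesgue_integral_def)
  finally have "?V * (v 0)\<^sup>2 \<le> ?J (\<lambda>x. (v x)\<^sup>2)"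
    unfolding mean by (simp add: power2_eq_square algebra_simps)
  then have "r ^ DIM('a) * (?V * (v 0)\<^sup>2) \<le> r ^ DIM('a) * ?J (\<lambda>x. (v x)\<^sup>2)"
    using r by (intro mult_left_mono) auto
  also have "\<dots> = (LINT x:ball z r|lborel. (u x)\<^sup>2)"
    using integral_ball_affine[of "\<lambda>x. (u x)\<^sup>2" r z] measurable_real_polynomial[OF real_polynomial_function_power[OF u]] r
    by (simp add: v_def)
  finally show ?thesis by (simp add: v_def mult_ac)
qed

lemma power_diff_le:
  fixes a b :: real
  assumes "1 \<le> a" "0 \<le> b" "b \<le> a"
  shows "a ^ n - b ^ n \<le> real n * (a - b) * a ^ n"
proof (induction n)
  case (Suc n)
  have "a ^ Suc n - b ^ Suc n = a * (a ^ n - b ^ n) + (a - b) * b ^ n" by (simp add: algebra_simps)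
  also have "\<dots> \<le> a * (real n * (a - b) * a ^ n) + (a - b) * a ^ Suc n"
  proof (intro add_mono mult_left_mono Suc)
    have "b ^ n \<le> a ^ n" using assms by (intro power_mono)
    also have "\<dots> \<le> a ^ Suc n" using assms by (intro power_increasing) auto
    finally show "b ^ n \<le> a ^ Suc n" .
  qed (use assms in auto)
  also have "\<dots> = real (Suc n) * (a - b) * a ^ Suc n" by (simp add: algebra_simps)
  finally show ?case .
qed simp

text \<open>
  By orthogonality only the diagonal products contribute, and each of them is homogeneous.
\<close>

lemma integral_ball_harmonic_sum_square:
  fixes p :: "nat \<Rightarrow> 'a::euclidean_space \<Rightarrow> real"
  assumes D: "DIM('a) \<ge> 2" and p: "\<And>l. solid_harmonic l (p l)" and r: "r > 0"
  shows "(LINT x:ball 0 r|lborel. (\<Sum>l\<le>n. p l x)\<^sup>2)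
    = real DIM('a) * measure lborel (ball (0::'a) 1) *
      (\<Sum>l\<le>n. r ^ (DIM('a) + 2 * l) / real (DIM('a) + 2 * l) * (\<integral>x. (p l x)\<^sup>2 \<partial>sphere_measure))"
proof -
  let ?D = "DIM('a)" and ?V = "measure lborel (ball (0::'a) 1)"
  have pq: "real_polynomial_function (\<lambda>x. p l x * p m x)" for l m
    using p by (intro real_polynomial_mult solid_harmonic_polynomial)
  have hq: "homogeneous (l + m) (\<lambda>x. p l x * p m x)" for l m
    using p by (intro homogeneous_mult solid_harmonic_homogeneous)
  have 1: "(LINT x:ball 0 r|lborel. p l x * p m x)
     = r ^ (?D + (l + m)) / real (?D + (l + m)) * (real ?D * ?V * (\<integral>x. p l x * p m x \<partial>sphere_measure))" for l m
  proof -
    have "(LINT x:ball 0 r|lborel. p l x * p m x) = r ^ (?D + (l + m)) * (LINT x:ball 0 1|lborel. p l x * p m x)"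
      using hq[of l m] r by (intro integral_ball_homogeneous_scale measurable_real_polynomial pq) (auto simp: homogeneous_def)
    moreover have "(LINT x:ball 0 1|lborel. p l x * p m x) = real ?D * ?V * (\<integral>x. p l x * p m x \<partial>sphere_measure) / real (?D + (l + m))"
    proof -
      have "real (?D + (l + m)) \<noteq> 0" using D by simp
      then show ?thesis using integral_ball_homogeneous[OF pq hq, of l m]
        by (simp only: eq_divide_eq if_False) (simp add: algebra_simps)
    qed
    ultimately show ?thesis by simp
  qed
  have "(LINT x:ball 0 r|lborel. (\<Sum>l\<le>n. p l x)\<^sup>2) = (LINT x:ball 0 r|lborel. (\<Sum>l\<le>n. \<Sum>m\<le>n. p l x * p m x))"
    by (simp add: power2_eq_square sum_product)
  also have "\<dots> = (\<Sum>l\<le>n. \<Sum>m\<le>n. LINT x:ball 0 r|lborel. p l x * p m x)"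
    using set_integrable_ball_polynomial[OF pq, of 0 r]
    unfolding set_lebesgue_integral_def set_integrable_def scaleR_sum_right
    by (simp only: Bochner_Integration.integral_sum Bochner_Integration.integrable_sum)
  also have "\<dots> = (\<Sum>l\<le>n. \<Sum>m\<le>n. if m = l then r ^ (?D + (l + l)) / real (?D + (l + l)) * (real ?D * ?V * (\<integral>x. p l x * p l x \<partial>sphere_measure)) else 0)"
    using solid_harmonic_orthogonal[OF D p p] by (intro sum.cong refl) (auto simp: 1)
  also have "\<dots> = (\<Sum>l\<le>n. r ^ (?D + (l + l)) / real (?D + (l + l)) * (real ?D * ?V * (\<integral>x. p l x * p l x \<partial>sphere_measure)))"
    by simp
  also have "\<dots> = real ?D * ?V * (\<Sum>l\<le>n. r ^ (?D + 2 * l) / real (?D + 2 * l) * (\<integral>x. (p l x)\<^sup>2 \<partial>sphere_measure))"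
    by (simp add: sum_distrib_left power2_eq_square mult_ac flip: mult_2_right)
  finally show ?thesis .
qed

text \<open>
  A shell of width \<open>r\<close> carries about \<open>r\<close> times the energy on the
  sphere, as long as \<open>n r\<close> stays bounded: the factor \<open>(1 + r) ^ (D + 2
  n)\<close> measures how fast harmonics of degree \<open>n\<close> grow along rays.
\<close>

lemma integral_shell_harmonic_sum_square:
  fixes p :: "nat \<Rightarrow> 'a::euclidean_space \<Rightarrow> real"
  assumes D: "DIM('a) \<ge> 2" and p: "\<And>l. solid_harmonic l (p l)" and r: "0 < r" "r < 1"
  shows "(LINT x:ball 0 (1 + r)|lborel. (\<Sum>l\<le>n. p l x)\<^sup>2) - (LINT x:ball 0 (1 - r)|lborel. (\<Sum>l\<le>n. p l x)\<^sup>2)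
    \<le> 2 * r * real DIM('a) * measure lborel (ball (0::'a) 1) * (1 + r) ^ (DIM('a) + 2 * n)
      * (\<Sum>l\<le>n. \<integral>x. (p l x)\<^sup>2 \<partial>sphere_measure)"
proof -
  let ?D = "DIM('a)" and ?V = "measure lborel (ball (0::'a) 1)"
  let ?E = "\<lambda>l. \<integral>x. (p l x)\<^sup>2 \<partial>sphere_measure"
  have "(LINT x:ball 0 (1 + r)|lborel. (\<Sum>l\<le>n. p l x)\<^sup>2) - (LINT x:ball 0 (1 - r)|lborel. (\<Sum>l\<le>n. p l x)\<^sup>2)
    = real ?D * ?V * (\<Sum>l\<le>n. ((1 + r) ^ (?D + 2 * l) - (1 - r) ^ (?D + 2 * l)) / real (?D + 2 * l) * ?E l)"
    using r by (simp add: integral_ball_harmonic_sum_square[OF D p] diff_divide_distrib left_diff_distrib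
        sum_subtractf right_diff_distrib)
  also have "\<dots> \<le> real ?D * ?V * (\<Sum>l\<le>n. 2 * r * (1 + r) ^ (?D + 2 * n) * ?E l)"
  proof (intro mult_left_mono sum_mono mult_right_mono)
    fix l assume l: "l \<in> {..n}"
    have "(1 + r) ^ (?D + 2 * l) - (1 - r) ^ (?D + 2 * l) \<le> real (?D + 2 * l) * (2 * r) * (1 + r) ^ (?D + 2 * l)"
      using power_diff_le[of "1 + r" "1 - r" "?D + 2 * l"] r by simp
    also have "\<dots> \<le> real (?D + 2 * l) * (2 * r) * (1 + r) ^ (?D + 2 * n)"
      using r l by (intro mult_left_mono power_increasing) auto
    finally show "((1 + r) ^ (?D + 2 * l) - (1 - r) ^ (?D + 2 * l)) / real (?D + 2 * l) \<le> 2 * r * (1 + r) ^ (?D + 2 * n)"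
      using D by (subst pos_divide_le_eq) (auto simp: algebra_simps)
  qed auto
  also have "\<dots> = 2 * r * real ?D * ?V * (1 + r) ^ (?D + 2 * n) * (\<Sum>l\<le>n. ?E l)"
    by (simp add: sum_distrib_left mult_ac)
  finally show ?thesis .
qed

section \<open>The dimension of the space of solid harmonics\<close>

abbreviation iterderiv :: "'a::euclidean_space list \<Rightarrow> ('a \<Rightarrow> real) \<Rightarrow> 'a \<Rightarrow> real" where
  "iterderiv \<equiv> foldr dirderiv"

lemma real_polynomial_iterderiv: "real_polynomial_function p \<Longrightarrow> real_polynomial_function (iterderiv vs p)"
  by (induction vs) auto

lemma dirderiv_iterderiv:
  "real_polynomial_function p \<Longrightarrow> dirderiv b (iterderiv vs p) = iterderiv vs (dirderiv b p)"
  by (induction vs) (simp_all add: dirderiv_commute[of _ b] real_polynomial_iterderiv)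

lemma iterderiv_append_Cons:
  assumes "real_polynomial_function p"
  shows "iterderiv (us @ b # zs) p = iterderiv (us @ zs) (dirderiv b p)"
  using dirderiv_iterderiv[OF assms, of b zs] by simp

lemma iterderiv_linear_sum:
  assumes "\<And>i. i \<in> A \<Longrightarrow> real_polynomial_function (p i)"
  shows "iterderiv vs (\<lambda>x. \<Sum>i\<in>A. c i * p i x) = (\<lambda>x. \<Sum>i\<in>A. c i * iterderiv vs (p i) x)"
proof (induction vs)
  case (Cons v vs)
  have "dirderiv v (\<lambda>x. \<Sum>i\<in>A. c i * iterderiv vs (p i) x) = (\<lambda>x. \<Sum>i\<in>A. dirderiv v (\<lambda>x. c i * iterderiv vs (p i) x) x)"
    by (rule dirderiv_sum) (use assms real_polynomial_iterderiv in auto)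
  also have "\<dots> = (\<lambda>x. \<Sum>i\<in>A. c i * dirderiv v (iterderiv vs (p i)) x)"
    by (intro ext sum.cong refl) (simp add: dirderiv_cmult real_polynomial_iterderiv assms)
  finally show ?case using Cons by simp
qed simp

lemma homogeneous_iterderiv:
  "real_polynomial_function p \<Longrightarrow> homogeneous n p \<Longrightarrow> homogeneous (n - length vs) (iterderiv vs p)"
proof (induction vs)
  case (Cons v vs)
  then show ?case
    using homogeneous_dirderiv[of "iterderiv vs p" "n - length vs" v] by (simp add: real_polynomial_iterderiv)
qed simp

text \<open>
  For homogeneous polynomials of degree \<open>n\<close>, iterated derivatives of order
  \<open>n\<close> are constants, that is, linear functionals. This predicate says that the
  functionals with index in \<open>F\<close> determine all those that differentiate only in
  directions from \<open>B\<close>.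
\<close>

definition derivs_determine :: "'a::euclidean_space set \<Rightarrow> nat \<Rightarrow> 'a list set \<Rightarrow> bool" where
  "derivs_determine B n F \<longleftrightarrow> (\<forall>p. real_polynomial_function p \<longrightarrow>
     (\<forall>vs\<in>F. iterderiv vs p = (\<lambda>x. 0)) \<longrightarrow>
     (\<forall>ws. length ws = n \<and> set ws \<subseteq> B \<longrightarrow> iterderiv ws p = (\<lambda>x. 0)))"

text \<open>
  Since derivatives commute, one list for each multiset of size \<open>n\<close> over
  \<open>B\<close> suffices. The count follows Pascal's rule: a multiset over \<open>insert b
  B\<close> either avoids \<open>b\<close> or contains \<open>b\<close> once more than a
  multiset of size \<open>n - 1\<close>.
\<close>

lemma derivs_determine_exists:
  fixes B :: "'a::euclidean_space set"
  assumes "finite B" "B \<noteq> {}"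
  shows "\<exists>F. finite F \<and> card F \<le> (n + (card B - 1)) choose (card B - 1) \<and> (\<forall>vs\<in>F. length vs = n)
    \<and> derivs_determine B n F"
  using assms
proof (induction B arbitrary: n rule: finite_ne_induct)
  case (singleton b)
  have "ws = replicate n b" if "length ws = n" "set ws \<subseteq> {b}" for ws
    using that by (intro replicate_eqI) auto
  then have "derivs_determine {b} n {replicate n b}" unfolding derivs_determine_def by blast
  then show ?case by (intro exI[of _ "{replicate n b}"]) simp
next
  case (insert b B)
  define k where "k = card B - 1"
  have cB: "card B > 0" using insert by (simp add: card_gt_0_iff)
  then have k: "card (insert b B) - 1 = Suc k" using insert by (simp add: k_def)
  show ?case unfolding k
  proof (induction n)
    case 0
    show ?case by (intro exI[of _ "{[]}"]) (auto simp: derivs_determine_def)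
  next
    case (Suc n)
    obtain F2 where F2: "finite F2" "card F2 \<le> (n + Suc k) choose Suc k" "\<forall>vs\<in>F2. length vs = n"
      "derivs_determine (insert b B) n F2" using Suc by blast
    obtain F1 where F1: "finite F1" "card F1 \<le> (Suc n + k) choose k" "\<forall>vs\<in>F1. length vs = Suc n"
      "derivs_determine B (Suc n) F1" using insert.IH[of "Suc n"] unfolding k_def by blast
    let ?F = "F1 \<union> (\<lambda>vs. vs @ [b]) ` F2"
    have "card ?F \<le> card F1 + card F2"
      using card_Un_le[of F1 "(\<lambda>vs. vs @ [b]) ` F2"] card_image_le[OF F2(1), of "\<lambda>vs. vs @ [b]"] by linarith
    then have "card ?F \<le> (Suc n + Suc k) choose Suc k"
      using F1(2) F2(2) binomial_Suc_Suc[of "Suc n + k" k] by simp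
    moreover have "derivs_determine (insert b B) (Suc n) ?F"
      unfolding derivs_determine_def
    proof (intro allI impI)
      fix p :: "'a \<Rightarrow> real" and ws
      assume p: "real_polynomial_function p" and z: "\<forall>vs\<in>?F. iterderiv vs p = (\<lambda>x. 0)"
        and ws: "length ws = Suc n \<and> set ws \<subseteq> insert b B"
      show "iterderiv ws p = (\<lambda>x. 0)"
      proof (cases "b \<in> set ws")
        case False
        then have "set ws \<subseteq> B" using ws by auto
        then show ?thesis using F1(4) p z ws by (auto simp: derivs_determine_def)
      next
        case True
        then obtain us zs where e: "ws = us @ b # zs" by (meson split_list)
        have "\<forall>vs\<in>F2. iterderiv vs (dirderiv b p) = (\<lambda>x. 0)"
        proof
          fix vs assume "vs \<in> F2"
          then have "iterderiv (vs @ [b]) p = (\<lambda>x. 0)" using z by blast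
          then show "iterderiv vs (dirderiv b p) = (\<lambda>x. 0)" by simp
        qed
        moreover have "length (us @ zs) = n \<and> set (us @ zs) \<subseteq> insert b B" using ws e by auto
        ultimately have "iterderiv (us @ zs) (dirderiv b p) = (\<lambda>x. 0)"
          using F2(4) real_polynomial_dirderiv[OF p, of b] unfolding derivs_determine_def by blast
        then show ?thesis unfolding e iterderiv_append_Cons[OF p] .
      qed
    qed
    ultimately show ?case using F1 F2 by (intro exI[of _ ?F]) auto
  qed
qed

text \<open>
  The Cauchy-Kovalevskaya principle for the Laplace equation: a second derivative in the
  direction \<open>e\<close> is a combination of second derivatives in the other basis
  directions, so derivatives that involve \<open>e\<close> at most once determine all others.
\<close>

lemma harmonic_iterderiv_zero:
  fixes p :: "'a::euclidean_space \<Rightarrow> real"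
  assumes "real_polynomial_function p" "laplacian p = (\<lambda>x. 0)" and e: "e \<in> Basis"
    and "\<And>ws. length ws = n \<Longrightarrow> set ws \<subseteq> Basis - {e} \<Longrightarrow> iterderiv ws p = (\<lambda>x. 0)"
    and "\<And>ws. Suc (length ws) = n \<Longrightarrow> set ws \<subseteq> Basis - {e} \<Longrightarrow> iterderiv ws (dirderiv e p) = (\<lambda>x. 0)"
    and "length ws = n" "set ws \<subseteq> Basis"
  shows "iterderiv ws p = (\<lambda>x. 0)"
  using assms(1,2,4-)
proof (induction n arbitrary: p ws)
  case (Suc n)
  obtain us b where ws: "ws = us @ [b]" using Suc.prems(5) by (cases ws rule: rev_cases) auto
  have us: "length us = n" "set us \<subseteq> Basis" and b: "b \<in> Basis" using Suc.prems ws by auto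
  have p: "real_polynomial_function p" "laplacian p = (\<lambda>x. 0)" by fact+
  have p': "real_polynomial_function (dirderiv v p)" "laplacian (dirderiv v p) = (\<lambda>x. 0)" for v
    using p by (auto simp: laplacian_dirderiv)
  have "iterderiv us (dirderiv b p) = (\<lambda>x. 0)"
  proof (cases "b = e")
    case False
    show ?thesis
    proof (rule Suc.IH[OF p'])
      fix vs assume vs: "length vs = n" "set vs \<subseteq> Basis - {e}"
      show "iterderiv vs (dirderiv b p) = (\<lambda>x. 0)"
        using Suc.prems(3)[of "vs @ [b]"] vs b False by simp
    next
      fix vs assume vs: "Suc (length vs) = n" "set vs \<subseteq> Basis - {e}"
      have "iterderiv vs (dirderiv b (dirderiv e p)) = (\<lambda>x. 0)"
        using Suc.prems(4)[of "vs @ [b]"] vs b False by simp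
      then show "iterderiv vs (dirderiv e (dirderiv b p)) = (\<lambda>x. 0)"
        using dirderiv_commute[OF p(1), of e b] by simp
    qed (use us in auto)
  next
    case True
    show ?thesis
    proof (rule Suc.IH[OF p'])
      fix vs assume vs: "length vs = n" "set vs \<subseteq> Basis - {e}"
      show "iterderiv vs (dirderiv b p) = (\<lambda>x. 0)"
        using Suc.prems(4)[of vs] vs True by simp
    next
      fix vs assume vs: "Suc (length vs) = n" "set vs \<subseteq> Basis - {e}"
      have "dirderiv e (dirderiv e p) = (\<lambda>x. \<Sum>c\<in>Basis - {e}. -1 * dirderiv c (dirderiv c p) x)"
      proof
        fix x
        have "laplacian p x = 0" using p(2) by simp
        then have "(\<Sum>c\<in>Basis. dirderiv c (dirderiv c p) x) = 0" by (simp add: laplacian_eq[OF p(1)])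
        then show "dirderiv e (dirderiv e p) x = (\<Sum>c\<in>Basis - {e}. -1 * dirderiv c (dirderiv c p) x)"
          using e by (simp add: sum.remove[OF finite_Basis e] sum_negf)
      qed
      then have "iterderiv vs (dirderiv e (dirderiv b p))
          = (\<lambda>x. \<Sum>c\<in>Basis - {e}. -1 * iterderiv vs (dirderiv c (dirderiv c p)) x)"
        using iterderiv_linear_sum[of "Basis - {e}" "\<lambda>c. dirderiv c (dirderiv c p)" vs "\<lambda>_. -1"] True p(1)
        by (simp add: real_polynomial_dirderiv)
      also have "\<dots> = (\<lambda>x. 0)"
      proof -
        have "iterderiv vs (dirderiv c (dirderiv c p)) = (\<lambda>x. 0)" if "c \<in> Basis - {e}" for c
          using Suc.prems(3)[of "vs @ [c, c]"] vs that by simp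
        then show ?thesis by simp
      qed
      finally show "iterderiv vs (dirderiv e (dirderiv b p)) = (\<lambda>x. 0)" .
    qed (use us in auto)
  qed
  then show ?case using ws by simp
qed simp

lemma homogeneous_iterderiv_zero:
  fixes p :: "'a::euclidean_space \<Rightarrow> real"
  assumes "real_polynomial_function p" "homogeneous n p"
    and "\<And>ws. length ws = n \<Longrightarrow> set ws \<subseteq> Basis \<Longrightarrow> iterderiv ws p = (\<lambda>x. 0)"
  shows "p = (\<lambda>x. 0)"
  using assms
proof (induction n arbitrary: p)
  case 0
  show ?case using 0(3)[of "[]"] by simp
next
  case (Suc n)
  have "dirderiv b p = (\<lambda>x. 0)" if "b \<in> Basis" for b
  proof (rule Suc.IH)
    show "homogeneous n (dirderiv b p)" using homogeneous_dirderiv[OF Suc.prems(1,2)] by simp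
    show "iterderiv ws (dirderiv b p) = (\<lambda>x. 0)" if "length ws = n" "set ws \<subseteq> Basis" for ws
      using Suc.prems(3)[of "ws @ [b]"] that \<open>b \<in> Basis\<close> by simp
  qed (use Suc.prems in auto)
  then have "real (Suc n) * p x = 0" for x
    using euler_homogeneous[OF Suc.prems(1,2), of x] by simp
  then show ?case by auto
qed

text \<open>
  The functionals are the derivatives of order \<open>n\<close> in the \<open>d\<close>
  directions other than \<open>e\<close>, and those of order \<open>n - 1\<close> in these
  directions followed by one in the direction \<open>e\<close>. Their numbers are the two
  binomial coefficients in \<open>Zdim_eq_choose\<close>, so the space of harmonics has at most
  the dimension \<open>Zdim d n\<close>.
\<close>

lemma solid_harmonic_functionals:
  assumes D: "DIM('a::euclidean_space) = d + 1" and d: "d \<ge> 2"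
  shows "\<exists>A :: 'a list set. finite A \<and> real (card A) \<le> Zdim d n \<and>
    (\<forall>p. solid_harmonic n p \<longrightarrow> (\<forall>vs\<in>A. iterderiv vs p 0 = 0) \<longrightarrow> p = (\<lambda>x. 0))"
proof -
  obtain e :: 'a where e: "e \<in> Basis" using nonempty_Basis by blast
  let ?B = "Basis - {e}"
  have cB: "card ?B = d" using e D by simp
  have fB: "finite ?B" by simp
  have nB: "?B \<noteq> {}" using cB d by (metis card.empty not_numeral_le_zero)
  obtain F1 where F1: "finite F1" "card F1 \<le> (n + (d - 1)) choose (d - 1)" "\<forall>vs\<in>F1. length vs = n"
    "derivs_determine ?B n F1" using derivs_determine_exists[OF fB nB, of n] cB by auto
  obtain F2 where F2: "finite F2" "card F2 \<le> (n + d - 2) choose (d - 1)" "\<forall>vs\<in>F2. Suc (length vs) = n"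
    "\<And>m. Suc m = n \<Longrightarrow> derivs_determine ?B m F2"
  proof (cases n)
    case 0
    then show ?thesis using that[of "{}"] by auto
  next
    case (Suc m)
    moreover have "m + (d - 1) = n + d - 2" using Suc d by simp
    ultimately show ?thesis using derivs_determine_exists[OF fB nB, of m] cB that by auto
  qed
  let ?A = "F1 \<union> (\<lambda>vs. vs @ [e]) ` F2"
  have "card ?A \<le> card F1 + card F2"
    using card_Un_le[of F1 "(\<lambda>vs. vs @ [e]) ` F2"] card_image_le[OF F2(1), of "\<lambda>vs. vs @ [e]"] by linarith
  moreover have "n + (d - 1) = n + d - 1" using d by simp
  ultimately have "card ?A \<le> (n + d - 1 choose (d - 1)) + (n + d - 2 choose (d - 1))"
    using F1(2) F2(2) by simp
  then have "real (card ?A) \<le> Zdim d n"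
    unfolding Zdim_eq_choose[OF d] by (simp only: of_nat_le_iff)
  moreover have "p = (\<lambda>x. 0)" if p: "solid_harmonic n p" and z: "\<forall>vs\<in>?A. iterderiv vs p 0 = 0" for p
  proof -
    have rp: "real_polynomial_function p" "homogeneous n p" "laplacian p = (\<lambda>x. 0)"
      using p by (auto simp: solid_harmonic_def)
    have z': "iterderiv vs p = (\<lambda>x. 0)" if "vs \<in> ?A" for vs
    proof
      fix x
      have "length vs = n" using that F1 F2 by auto
      then have "iterderiv vs p x = iterderiv vs p 0"
        using homogeneous_iterderiv[OF rp(1,2), of vs] by (intro homogeneous_0_eq) simp
      then show "iterderiv vs p x = 0" using z that by auto
    qed
    have "iterderiv ws p = (\<lambda>x. 0)" if "length ws = n" "set ws \<subseteq> Basis" for ws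
    proof (rule harmonic_iterderiv_zero[OF rp(1,3) e _ _ that])
      show "iterderiv ws p = (\<lambda>x. 0)" if "length ws = n" "set ws \<subseteq> ?B" for ws
        using F1(4) rp(1) z' that unfolding derivs_determine_def by blast
      show "iterderiv ws (dirderiv e p) = (\<lambda>x. 0)" if "Suc (length ws) = n" "set ws \<subseteq> ?B" for ws
      proof -
        have "\<forall>vs\<in>F2. iterderiv vs (dirderiv e p) = (\<lambda>x. 0)"
        proof
          fix vs assume "vs \<in> F2"
          then show "iterderiv vs (dirderiv e p) = (\<lambda>x. 0)" using z'[of "vs @ [e]"] by simp
        qed
        then show ?thesis
          using F2(4)[OF that(1)] real_polynomial_dirderiv[OF rp(1), of e] that(2)
          unfolding derivs_determine_def by blast
      qed
    qed
    then show ?thesis using homogeneous_iterderiv_zero[OF rp(1,2)] by blast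
  qed
  ultimately show ?thesis using F1(1) F2(1) by (intro exI[of _ ?A]) auto
qed

text \<open>
  Gaussian elimination: a nontrivial equation eliminates one unknown together with itself, which
  keeps the unknowns in the majority.
\<close>

lemma underdetermined_system_solution:
  fixes M :: "'i \<Rightarrow> 'j \<Rightarrow> real"
  assumes "finite A" "finite B" "card A < card B"
  shows "\<exists>c. (\<exists>b\<in>B. c b \<noteq> 0) \<and> (\<forall>a\<in>A. (\<Sum>b\<in>B. c b * M a b) = 0)"
  using assms
proof (induction A arbitrary: B M rule: finite_induct)
  case empty
  then have "B \<noteq> {}" by auto
  then show ?case by (intro exI[of _ "\<lambda>_. 1"]) auto
next
  case (insert a A)
  show ?case
  proof (cases "\<forall>b\<in>B. M a b = 0")
    case True
    have "card A < card B" using insert by simp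
    then obtain c where c: "\<exists>b\<in>B. c b \<noteq> 0" "\<forall>a\<in>A. (\<Sum>b\<in>B. c b * M a b) = 0"
      using insert.IH insert.prems(1) by blast
    then show ?thesis using True by (intro exI[of _ c]) auto
  next
    case False
    then obtain b0 where b0: "b0 \<in> B" "M a b0 \<noteq> 0" by blast
    let ?B = "B - {b0}"
    let ?M = "\<lambda>a' b. M a' b - M a' b0 * M a b / M a b0"
    have "finite ?B" "card A < card ?B" using insert b0 by auto
    from insert.IH[where B="?B" and M="?M", OF this]
    obtain c where c: "\<exists>b\<in>?B. c b \<noteq> 0" "\<forall>a'\<in>A. (\<Sum>b\<in>?B. c b * ?M a' b) = 0"
      by (elim exE conjE)
    define r where "r = - (\<Sum>b\<in>?B. c b * M a b) / M a b0"
    let ?c = "c(b0 := r)"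
    have s: "(\<Sum>b\<in>B. ?c b * M a' b) = r * M a' b0 + (\<Sum>b\<in>?B. c b * M a' b)" for a'
    proof -
      have "(\<Sum>b\<in>?B. ?c b * M a' b) = (\<Sum>b\<in>?B. c b * M a' b)" by (intro sum.cong) auto
      then show ?thesis using sum.remove[OF insert.prems(1) b0(1), of "\<lambda>b. ?c b * M a' b"] by simp
    qed
    have "(\<Sum>b\<in>B. ?c b * M a b) = 0" unfolding s using b0(2) by (simp add: r_def)
    moreover have "(\<Sum>b\<in>B. ?c b * M a' b) = 0" if "a' \<in> A" for a'
    proof -
      have "(\<Sum>b\<in>?B. c b * ?M a' b) = (\<Sum>b\<in>?B. c b * M a' b - (c b * M a b) * (M a' b0 / M a b0))"
        by (intro sum.cong) (auto simp: algebra_simps)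
      also have "\<dots> = (\<Sum>b\<in>?B. c b * M a' b) - (\<Sum>b\<in>?B. c b * M a b) * (M a' b0 / M a b0)"
        unfolding sum_subtractf sum_distrib_right ..
      finally have "(\<Sum>b\<in>?B. c b * M a' b) = (\<Sum>b\<in>?B. c b * M a b) * (M a' b0 / M a b0)"
        using c(2) that by simp
      then show ?thesis unfolding s by (simp add: r_def)
    qed
    moreover have "\<exists>b\<in>B. ?c b \<noteq> 0" using c(1) by auto
    ultimately show ?thesis by (intro exI[of _ ?c]) auto
  qed
qed

section \<open>Orthonormal families of harmonics\<close>

text \<open>
  The functions \<open>q l k\<close> are harmonic polynomials on the whole space. Only their
  restrictions to the sphere matter for the spherical harmonics, but derivatives and integrals
  over balls need the extensions.
\<close>

locale orthonormal_harmonics =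
  fixes d :: nat and q :: "nat \<Rightarrow> nat \<Rightarrow> 'a::euclidean_space \<Rightarrow> real"
  assumes dim: "DIM('a) = d + 1" and d2: "d \<ge> 2"
    and harmonic: "\<And>l k. k \<in> harmonic_indices d l \<Longrightarrow> solid_harmonic l (q l k)"
    and orthonormal: "\<And>l k k'. k \<in> harmonic_indices d l \<Longrightarrow> k' \<in> harmonic_indices d l \<Longrightarrow>
      (\<integral>x. q l k x * q l k' x \<partial>sphere_measure) = (if k = k' then 1 else 0)"
begin

abbreviation J :: "nat \<Rightarrow> nat set" where "J l \<equiv> harmonic_indices d l"

lemma dim_ge_2: "DIM('a) \<ge> 2" using dim d2 by simp

lemma Zdim_pos: "Zdim d l > 0"
proof -
  have "(l + d - 1 choose (d - 1)) > 0" using d2 by (simp add: zero_less_binomial_iff)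
  then show ?thesis unfolding Zdim_eq_choose[OF d2] by (simp only: of_nat_0_less_iff add_pos_nonneg)
qed

lemma finite_J: "finite (J l)"
proof (rule card_ge_0_finite)
  show "card (J l) > 0" using card_harmonic_indices[OF d2, of l] Zdim_pos[of l] by simp
qed

lemma polynomial_q: "k \<in> J l \<Longrightarrow> real_polynomial_function (q l k)"
  by (rule solid_harmonic_polynomial[OF harmonic])

lemma orthogonal_levels:
  "k \<in> J l \<Longrightarrow> k' \<in> J m \<Longrightarrow> l \<noteq> m \<Longrightarrow> (\<integral>x. q l k x * q m k' x \<partial>sphere_measure) = 0"
  by (rule solid_harmonic_orthogonal[OF dim_ge_2 harmonic harmonic])

lemma integral_sum_q:
  assumes "k \<in> J l" "A \<subseteq> J l"
  shows "(\<integral>x. (\<Sum>i\<in>A. c i * q l i x) * q l k x \<partial>sphere_measure) = (if k \<in> A then c k else 0)"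
proof -
  have fin: "finite A" using assms finite_J finite_subset by blast
  have i: "integrable sphere_measure (\<lambda>x. c i * (q l i x * q l k x))" if "i \<in> A" for i
    using assms that by (intro integrable_sphere_polynomial real_polynomial_cmult
        real_polynomial_mult polynomial_q) auto
  have "(\<integral>x. (\<Sum>i\<in>A. c i * q l i x) * q l k x \<partial>sphere_measure)
      = (\<integral>x. (\<Sum>i\<in>A. c i * (q l i x * q l k x)) \<partial>sphere_measure)"
    by (simp add: sum_distrib_right mult.assoc)
  also have "\<dots> = (\<Sum>i\<in>A. \<integral>x. c i * (q l i x * q l k x) \<partial>sphere_measure)"
    using i by (rule Bochner_Integration.integral_sum)
  also have "\<dots> = (\<Sum>i\<in>A. if i = k then c k else 0)"
    using assms orthonormal by (intro sum.cong) auto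
  also have "\<dots> = (if k \<in> A then c k else 0)" using fin by simp
  finally show ?thesis .
qed

text \<open>
  A nonzero \<open>r\<close> that is orthogonal to the family would make it a linearly
  independent family of \<open>Zdim d l + 1\<close> harmonics, more than there are functionals
  in \<open>solid_harmonic_functionals\<close>.
\<close>

lemma solid_harmonic_orthogonal_zero:
  assumes r: "solid_harmonic l r" and orth: "\<And>k. k \<in> J l \<Longrightarrow> (\<integral>x. r x * q l k x \<partial>sphere_measure) = 0"
  shows "r = (\<lambda>x. 0)"
proof -
  obtain A :: "'a list set" where A: "finite A" "real (card A) \<le> Zdim d l"
    "\<And>p. solid_harmonic l p \<Longrightarrow> (\<forall>vs\<in>A. iterderiv vs p 0 = 0) \<Longrightarrow> p = (\<lambda>x. 0)"
    using solid_harmonic_functionals[OF dim d2, of l] by blast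
  \<comment> \<open>the index 0 is free for r because the index sets start at 1\<close>
  let ?g = "\<lambda>k. if k = 0 then r else q l k"
  have J0: "0 \<notin> J l" by (simp add: harmonic_indices_def)
  have "card A \<le> card (J l)" using A(2) card_harmonic_indices[OF d2, of l] by linarith
  then have "card A < card (insert 0 (J l))" using J0 finite_J by simp
  then obtain c where c: "\<exists>b\<in>insert 0 (J l). c b \<noteq> 0"
    "\<And>vs. vs \<in> A \<Longrightarrow> (\<Sum>b\<in>insert 0 (J l). c b * iterderiv vs (?g b) 0) = 0"
    using underdetermined_system_solution[OF A(1), of "insert 0 (J l)" "\<lambda>vs b. iterderiv vs (?g b) 0"] finite_J
    by auto
  have g: "solid_harmonic l (?g b)" if "b \<in> insert 0 (J l)" for b
    using that r harmonic by auto
  let ?s = "\<lambda>x. \<Sum>b\<in>insert 0 (J l). c b * ?g b x"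
  have "?s = (\<lambda>x. 0)"
  proof (rule A(3))
    show "solid_harmonic l ?s" using g by (intro solid_harmonic_sum solid_harmonic_cmult)
    show "\<forall>vs\<in>A. iterderiv vs ?s 0 = 0"
    proof
      fix vs assume "vs \<in> A"
      then show "iterderiv vs ?s 0 = 0"
        using c(2)[of vs] g solid_harmonic_polynomial
        by (subst iterderiv_linear_sum) blast+
    qed
  qed
  moreover have "?s = (\<lambda>x. c 0 * r x + (\<Sum>b\<in>J l. c b * q l b x))"
  proof
    fix x
    have "(\<Sum>b\<in>J l. c b * ?g b x) = (\<Sum>b\<in>J l. c b * q l b x)" using J0 by (intro sum.cong) auto
    then show "?s x = c 0 * r x + (\<Sum>b\<in>J l. c b * q l b x)" using J0 finite_J by simp
  qed
  ultimately have s0: "c 0 * r x + (\<Sum>b\<in>J l. c b * q l b x) = 0" for x by metis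
  have ck: "c k = 0" if k: "k \<in> J l" for k
  proof -
    have i1: "integrable sphere_measure (\<lambda>x. r x * q l k x)"
      using r k by (intro integrable_sphere_polynomial real_polynomial_mult polynomial_q solid_harmonic_polynomial)
    have i2: "integrable sphere_measure (\<lambda>x. (\<Sum>b\<in>J l. c b * q l b x) * q l k x)"
      using k by (intro integrable_sphere_polynomial real_polynomial_mult real_polynomial_sum
          real_polynomial_cmult polynomial_q)
    have "0 = (\<integral>x. (c 0 * r x + (\<Sum>b\<in>J l. c b * q l b x)) * q l k x \<partial>sphere_measure)" by (simp add: s0)
    also have "\<dots> = c 0 * (\<integral>x. r x * q l k x \<partial>sphere_measure) + (\<integral>x. (\<Sum>b\<in>J l. c b * q l b x) * q l k x \<partial>sphere_measure)"
      using i1 i2 by (simp add: distrib_right mult.assoc)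
    also have "\<dots> = c k" using orth[OF k] integral_sum_q[OF k order_refl, of c] k by simp
    finally show ?thesis by simp
  qed
  then have "c 0 \<noteq> 0" using c(1) by auto
  moreover have "c 0 * r x = 0" for x using s0[of x] ck by simp
  ultimately show ?thesis by auto
qed

theorem solid_harmonic_expansion:
  assumes h: "solid_harmonic l h"
  shows "h x = (\<Sum>k\<in>J l. (\<integral>y. h y * q l k y \<partial>sphere_measure) * q l k x)"
proof -
  let ?c = "\<lambda>k. \<integral>y. h y * q l k y \<partial>sphere_measure"
  let ?s = "\<lambda>x. \<Sum>k\<in>J l. ?c k * q l k x"
  have s: "solid_harmonic l ?s" by (intro solid_harmonic_sum solid_harmonic_cmult harmonic)
  have "(\<lambda>x. h x - ?s x) = (\<lambda>x. 0)"
  proof (rule solid_harmonic_orthogonal_zero)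
    show "solid_harmonic l (\<lambda>x. h x - ?s x)" by (intro solid_harmonic_diff h s)
    fix k assume k: "k \<in> J l"
    have i: "integrable sphere_measure (\<lambda>x. h x * q l k x)" "integrable sphere_measure (\<lambda>x. ?s x * q l k x)"
      by (rule integrable_sphere_polynomial[OF real_polynomial_mult
            [OF solid_harmonic_polynomial[OF h] polynomial_q[OF k]]],
          rule integrable_sphere_polynomial[OF real_polynomial_mult
            [OF solid_harmonic_polynomial[OF s] polynomial_q[OF k]]])
    have "(\<integral>x. (h x - ?s x) * q l k x \<partial>sphere_measure) = ?c k - (\<integral>x. ?s x * q l k x \<partial>sphere_measure)"
      using Bochner_Integration.integral_diff[OF i] by (simp add: left_diff_distrib)
    also have "\<dots> = 0" using integral_sum_q[OF k order_refl, of ?c] k by simp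
    finally show "(\<integral>x. (h x - ?s x) * q l k x \<partial>sphere_measure) = 0" .
  qed
  then have "h x - ?s x = 0" by (rule fun_cong)
  then show ?thesis by simp
qed

end

section \<open>The addition theorem\<close>

definition gegenbauer_moment :: "nat \<Rightarrow> nat \<Rightarrow> real" where
  "gegenbauer_moment d m = (LBINT t:{-1..1}. t ^ m * (1 - t\<^sup>2) powr (real d / 2 - 1))"

lemma set_integrable_gegenbauer_monom:
  assumes "d \<ge> 2"
  shows "set_integrable lborel {-1..1} (\<lambda>t. t ^ m * (1 - t\<^sup>2) powr (real d / 2 - 1))"
  using gegenbauer_integrable[OF assms, of "monom 1 m"] by (simp add: poly_monom)

text \<open>
  The integrand is the derivative of \<open>t ^ m (1 - t\<^sup>2) powr (d / 2)\<close>, which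
  vanishes at both end points.
\<close>

lemma gegenbauer_boundary_integral:
  assumes d: "d \<ge> 2"
  shows "(LBINT t:{-1..1}. (real m * t ^ (m - 1) * (1 - t\<^sup>2) - real d * t ^ (m + 1)) * (1 - t\<^sup>2) powr (real d / 2 - 1)) = 0"
proof -
  let ?f = "\<lambda>t::real. t ^ m * (1 - t\<^sup>2) powr (real d / 2)"
  let ?g = "\<lambda>t::real. (real m * t ^ (m - 1) * (1 - t\<^sup>2) - real d * t ^ (m + 1)) * (1 - t\<^sup>2) powr (real d / 2 - 1)"
  have "(?g has_integral (?f 1 - ?f (-1))) {-1..1}"
  proof (rule fundamental_theorem_of_calculus_interior)
    show "continuous_on {-1..1} ?f"
      using d by (intro continuous_intros continuous_on_powr') (auto simp: abs_square_le_1 abs_le_iff)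
    fix t :: real assume t: "t \<in> {-1<..<1}"
    then have pos: "1 - t\<^sup>2 > 0" by (simp add: abs_square_less_1 abs_less_iff)
    have pw: "(1 - t\<^sup>2) powr (real d / 2) = (1 - t\<^sup>2) * (1 - t\<^sup>2) powr (real d / 2 - 1)"
      using pos powr_add[of "1 - t\<^sup>2" 1 "real d / 2 - 1"] by simp
    have "(?f has_field_derivative (real m * t ^ (m - 1) * (1 - t\<^sup>2) powr (real d / 2)
       + t ^ m * ((1 - t\<^sup>2) powr (real d / 2 - 1) * (real d / 2) * (- 2 * t)))) (at t)"
      using pos by (auto intro!: derivative_eq_intros)
    also have "real m * t ^ (m - 1) * (1 - t\<^sup>2) powr (real d / 2)
       + t ^ m * ((1 - t\<^sup>2) powr (real d / 2 - 1) * (real d / 2) * (- 2 * t)) = ?g t"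
      unfolding pw by (simp add: algebra_simps)
    finally show "(?f has_vector_derivative ?g t) (at t)"
      by (simp add: has_real_derivative_iff_has_vector_derivative)
  qed simp
  then have "integral {-1..1} ?g = 0" by (simp add: integral_unique)
  moreover have "set_integrable lborel {-1..1} ?g"
    using gegenbauer_integrable[OF d, of "monom (real m) (m - 1) * [:1, 0, -1:] - monom (real d) (m + 1)"]
    by (simp add: poly_monom power2_eq_square algebra_simps)
  ultimately show ?thesis by (simp add: set_borel_integral_eq_integral)
qed

lemma gegenbauer_moment_1:
  assumes d: "d \<ge> 2" shows "gegenbauer_moment d 1 = 0"
proof -
  have "(LBINT t:{-1..1}. (- real d) * (t ^ 1 * (1 - t\<^sup>2) powr (real d / 2 - 1))) = 0"
    using gegenbauer_boundary_integral[OF d, of 0] by (simp add: mult.assoc)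
  then show ?thesis unfolding gegenbauer_moment_def set_integral_mult_right using d by simp
qed

lemma gegenbauer_moment_rec:
  assumes d: "d \<ge> 2"
  shows "(real m + 1 + real d) * gegenbauer_moment d (m + 2) = (real m + 1) * gegenbauer_moment d m"
proof -
  let ?w = "\<lambda>t::real. (1 - t\<^sup>2) powr (real d / 2 - 1)"
  have i: "set_integrable lborel {-1..1} (\<lambda>t. c * (t ^ k * ?w t))" for c k
    using set_integrable_gegenbauer_monom[OF d, of k] by simp
  have "0 = (LBINT t:{-1..1}. (real m + 1) * (t ^ m * ?w t) - (real m + 1 + real d) * (t ^ (m + 2) * ?w t))"
    using gegenbauer_boundary_integral[OF d, of "m + 1"]
    by (simp add: algebra_simps power2_eq_square)
  also have "\<dots> = (real m + 1) * gegenbauer_moment d m - (real m + 1 + real d) * gegenbauer_moment d (m + 2)"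
    using set_integral_diff(2)[OF i[of "real m + 1" m] i[of "real m + 1 + real d" "m + 2"]]
    by (simp add: gegenbauer_moment_def)
  finally show ?thesis by simp
qed

text \<open>
  The moments of the Gegenbauer weight satisfy the recursion of the integrals of \<open>(x
  \<bullet> e) ^ m\<close> over the sphere. Hence the weight is, up to a constant, the
  distribution of \<open>x \<bullet> e\<close> as far as polynomials are concerned.
\<close>

lemma gegenbauer_moment_eq:
  assumes d: "d \<ge> 2"
  shows "gegenbauer_moment d m = gegenbauer_moment d 0 * funk_hecke_coeff (d + 1) m 0"
proof (induction m rule: induct_nat_012)
  case 1
  then show ?case using gegenbauer_moment_1[OF d] by simp
next
  case (ge2 m)
  define K where "K = real m + 1 + real d"
  have K: "K > 0" by (simp add: K_def)
  have "funk_hecke_coeff (d + 1) (Suc (Suc m)) 0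
      = (real (m + 2) * (real m + 1) * funk_hecke_coeff (d + 1) m 0) / (real (m + 2) * K)"
    by (simp add: K_def del: funk_hecke_coeff.simps) (simp add: add_ac)
  also have "\<dots> = (real m + 1) * funk_hecke_coeff (d + 1) m 0 / K"
    by (simp del: of_nat_add funk_hecke_coeff.simps)
  finally have f: "K * funk_hecke_coeff (d + 1) (Suc (Suc m)) 0 = (real m + 1) * funk_hecke_coeff (d + 1) m 0"
    using K by (simp del: funk_hecke_coeff.simps)
  have "K * gegenbauer_moment d (Suc (Suc m)) = (real m + 1) * gegenbauer_moment d m"
    using gegenbauer_moment_rec[OF d, of m] by (simp add: K_def)
  also have "\<dots> = gegenbauer_moment d 0 * ((real m + 1) * funk_hecke_coeff (d + 1) m 0)"
    using ge2 by (simp del: funk_hecke_coeff.simps)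
  also have "\<dots> = K * (gegenbauer_moment d 0 * funk_hecke_coeff (d + 1) (Suc (Suc m)) 0)"
    unfolding f[symmetric] by (simp del: funk_hecke_coeff.simps)
  finally show ?case using K by (simp del: funk_hecke_coeff.simps)
qed simp

lemma gegenbauer_weight_integral:
  fixes e :: "'a::euclidean_space"
  assumes d: "d \<ge> 2" and D: "DIM('a) = d + 1" and e: "norm e = 1"
  shows "(LBINT t:{-1..1}. poly p t * (1 - t\<^sup>2) powr (real d / 2 - 1))
    = gegenbauer_moment d 0 * (\<integral>x. poly p (x \<bullet> e) \<partial>sphere_measure)"
proof -
  let ?w = "\<lambda>t::real. (1 - t\<^sup>2) powr (real d / 2 - 1)"
  have m: "(\<integral>x. (x \<bullet> e) ^ i \<partial>sphere_measure) = funk_hecke_coeff (d + 1) i 0" for i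
    using funk_hecke_power[OF _ e solid_harmonic_const[of 1], of i] d D by simp
  have "(LBINT t:{-1..1}. poly p t * ?w t) = (LBINT t:{-1..1}. (\<Sum>i\<le>degree p. coeff p i * (t ^ i * ?w t)))"
    by (simp add: poly_altdef sum_distrib_right mult.assoc)
  also have "\<dots> = (\<Sum>i\<le>degree p. coeff p i * gegenbauer_moment d i)"
  proof -
    have i: "set_integrable lborel {-1..1} (\<lambda>t. coeff p i * (t ^ i * ?w t))" for i
      using set_integrable_gegenbauer_monom[OF d, of i] by simp
    have "(LBINT t:{-1..1}. (\<Sum>i\<le>degree p. coeff p i * (t ^ i * ?w t)))
       = (\<Sum>i\<le>degree p. LBINT t:{-1..1}. coeff p i * (t ^ i * ?w t))"
      using i unfolding set_lebesgue_integral_def set_integrable_def scaleR_sum_right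
      by (intro Bochner_Integration.integral_sum) auto
    then show ?thesis by (simp add: gegenbauer_moment_def)
  qed
  also have "\<dots> = gegenbauer_moment d 0 * (\<Sum>i\<le>degree p. coeff p i * (\<integral>x. (x \<bullet> e) ^ i \<partial>sphere_measure))"
    by (subst gegenbauer_moment_eq[OF d]) (simp add: m sum_distrib_left mult_ac)
  also have "(\<Sum>i\<le>degree p. coeff p i * (\<integral>x. (x \<bullet> e) ^ i \<partial>sphere_measure)) = (\<integral>x. poly p (x \<bullet> e) \<partial>sphere_measure)"
  proof -
    have i: "integrable sphere_measure (\<lambda>x. coeff p i * (x \<bullet> e) ^ i)" for i
      by (intro integrable_sphere_polynomial real_polynomial_cmult real_polynomial_function_power real_polynomial_inner)
    show ?thesis unfolding poly_altdef using i by (simp add: Bochner_Integration.integral_sum)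
  qed
  finally show ?thesis .
qed

context orthonormal_harmonics
begin

definition reproducing_kernel :: "nat \<Rightarrow> 'a \<Rightarrow> 'a \<Rightarrow> real" where
  "reproducing_kernel l x y = (\<Sum>k\<in>J l. q l k x * q l k y)"

text \<open>
  The power is a sum of harmonics on the sphere, and the Funk-Hecke formula computes its Fourier
  coefficients.
\<close>

lemma inner_power_expansion:
  assumes e: "norm e = 1" and x: "x \<in> sphere 0 1"
  shows "(x \<bullet> e) ^ m = (\<Sum>l\<le>m. funk_hecke_coeff DIM('a) m l * reproducing_kernel l e x)"
proof -
  have f: "real_polynomial_function (\<lambda>x. (x \<bullet> e) ^ m)" by auto
  have "homogeneous (1 * m) (\<lambda>x. (x \<bullet> e) ^ m)" by (rule homogeneous_power[OF homogeneous_inner])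
  then have fh: "homogeneous m (\<lambda>x. (x \<bullet> e) ^ m)" by simp
  obtain h where h: "\<And>l. solid_harmonic l (h l)" "\<And>x. x \<in> sphere 0 1 \<Longrightarrow> (x \<bullet> e) ^ m = (\<Sum>l\<le>m. h l x)"
    using homogeneous_on_sphere_harmonic_sum[OF f fh] by blast
  have "h l x = funk_hecke_coeff DIM('a) m l * reproducing_kernel l e x" if l: "l \<le> m" for l
  proof -
    have "(\<integral>y. h l y * q l k y \<partial>sphere_measure) = funk_hecke_coeff DIM('a) m l * q l k e" if k: "k \<in> J l" for k
    proof -
      have i: "integrable sphere_measure (\<lambda>y. h j y * q l k y)" for j
        using k h by (intro integrable_sphere_polynomial real_polynomial_mult polynomial_q solid_harmonic_polynomial)
      have "funk_hecke_coeff DIM('a) m l * q l k e = (\<integral>y. (y \<bullet> e) ^ m * q l k y \<partial>sphere_measure)"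
        using funk_hecke_power[OF dim_ge_2 e harmonic[OF k]] by simp
      also have "\<dots> = (\<integral>y. (\<Sum>j\<le>m. h j y * q l k y) \<partial>sphere_measure)"
        by (intro integral_sphere_cong) (simp add: h(2) sum_distrib_right)
      also have "\<dots> = (\<Sum>j\<le>m. \<integral>y. h j y * q l k y \<partial>sphere_measure)"
        using i by (intro Bochner_Integration.integral_sum) auto
      also have "\<dots> = (\<Sum>j\<le>m. if j = l then \<integral>y. h l y * q l k y \<partial>sphere_measure else 0)"
        using solid_harmonic_orthogonal[OF dim_ge_2 h(1) harmonic[OF k]] by (intro sum.cong) auto
      also have "\<dots> = (\<integral>y. h l y * q l k y \<partial>sphere_measure)" using l by simp
      finally show ?thesis by simp
    qed
    then have "h l x = (\<Sum>k\<in>J l. funk_hecke_coeff DIM('a) m l * q l k e * q l k x)"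
      using solid_harmonic_expansion[OF h(1), of l x] by (simp cong: sum.cong)
    then show ?thesis by (simp add: reproducing_kernel_def sum_distrib_left mult.assoc)
  qed
  then show ?thesis using h(2)[OF x] by simp
qed

text \<open>
  The expansions of \<open>t ^ 0, \<dots>, t ^ l\<close> form a triangular system for the
  kernels, which can therefore be written as polynomials in \<open>x \<bullet> e\<close>.
\<close>

lemma reproducing_kernel_zonal_polynomial:
  "\<exists>g :: real poly. degree g = l \<and> (\<forall>e\<in>sphere 0 1. \<forall>x\<in>sphere 0 1. reproducing_kernel l e x = poly g (x \<bullet> e))"
proof (induction l rule: less_induct)
  case (less l)
  let ?c = "funk_hecke_coeff DIM('a) l"
  have cl: "?c l > 0" by (rule funk_hecke_coeff_diag_pos[OF dim_ge_2])
  have "\<forall>i. \<exists>g :: real poly. i < l \<longrightarrow> degree g = i \<and> (\<forall>e\<in>sphere 0 1. \<forall>x\<in>sphere 0 1. reproducing_kernel i e x = poly g (x \<bullet> e))"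
    using less by auto
  then obtain g :: "nat \<Rightarrow> real poly" where g: "\<And>i. i < l \<Longrightarrow> degree (g i) = i"
    "\<And>i e x. i < l \<Longrightarrow> e \<in> sphere 0 1 \<Longrightarrow> x \<in> sphere 0 1 \<Longrightarrow> reproducing_kernel i e x = poly (g i) (x \<bullet> e)"
    by metis
  \<comment> \<open>solving the triangular system for the kernel of level l\<close>
  define p where "p = smult (1 / ?c l) (monom 1 l - (\<Sum>i<l. smult (?c i) (g i)))"
  have "coeff (\<Sum>i<l. smult (?c i) (g i)) k = 0" if "k \<ge> l" for k
    unfolding coeff_sum using g(1) that by (intro sum.neutral) (auto simp: coeff_eq_0)
  then have co: "coeff p k = (if k = l then 1 / ?c l else 0)" if "k \<ge> l" for k
    using that by (simp add: p_def)
  then have "degree p \<le> l" by (intro degree_le) auto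
  moreover have "degree p \<ge> l" using co[of l] cl by (intro le_degree) auto
  ultimately have "degree p = l" by simp
  moreover have "reproducing_kernel l e x = poly p (x \<bullet> e)" if e: "e \<in> sphere 0 1" and x: "x \<in> sphere 0 1" for e x
  proof -
    have "(x \<bullet> e) ^ l = (\<Sum>i<l. ?c i * reproducing_kernel i e x) + ?c l * reproducing_kernel l e x"
      using inner_power_expansion[of e x l] e x by (simp flip: lessThan_Suc_atMost)
    then have "reproducing_kernel l e x = 1 / ?c l * ((x \<bullet> e) ^ l - (\<Sum>i<l. ?c i * reproducing_kernel i e x))"
      using cl by (simp add: field_simps)
    also have "\<dots> = poly p (x \<bullet> e)"
      using g(2) e x by (simp add: p_def poly_sum poly_monom)
    finally show ?thesis .
  qed
  ultimately show ?case by blast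
qed

text \<open>
  The reproducing kernels are polynomials \<open>g l\<close> of degree \<open>l\<close> in
  \<open>x \<bullet> y\<close>. Kernels of different degree are orthogonal on the sphere, so the
  \<open>g l\<close> are orthogonal for the Gegenbauer weight and must be multiples of the
  Gegenbauer polynomials. The factor is the value at \<open>1\<close>, that is, the integral of
  the diagonal of the kernel, which is the number of functions of degree \<open>l\<close> in the
  family.
\<close>

theorem addition_theorem:
  assumes x: "x \<in> sphere 0 1" and y: "y \<in> sphere 0 1"
  shows "(\<Sum>k\<in>J l. q l k x * q l k y) = Zdim d l * poly (gegenbauer d l) (x \<bullet> y)"
proof -
  obtain g :: "nat \<Rightarrow> real poly" where deg: "\<And>l. degree (g l) = l"
    and g: "\<And>l e x. e \<in> sphere 0 1 \<Longrightarrow> x \<in> sphere 0 1 \<Longrightarrow> reproducing_kernel l e x = poly (g l) (x \<bullet> e)"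
    using reproducing_kernel_zonal_polynomial by metis
  have g1: "poly (g l) 1 = Zdim d l" for l
  proof -
    have i: "integrable sphere_measure (\<lambda>x. q l k x * q l k x)" if "k \<in> J l" for k
      using that by (intro integrable_sphere_polynomial real_polynomial_mult polynomial_q)
    have "poly (g l) 1 = (\<integral>x. poly (g l) 1 \<partial>(sphere_measure :: 'a measure))"
      by (rule integral_sphere_const[symmetric])
    also have "\<dots> = (\<integral>x. (\<Sum>k\<in>J l. q l k x * q l k x) \<partial>sphere_measure)"
    proof (rule integral_sphere_cong)
      fix x :: 'a assume "x \<in> sphere 0 1"
      moreover then have "x \<bullet> x = 1" by (simp add: norm_eq_1)
      ultimately show "poly (g l) 1 = (\<Sum>k\<in>J l. q l k x * q l k x)"
        using g[of x x l] by (simp add: reproducing_kernel_def)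
    qed
    also have "\<dots> = (\<Sum>k\<in>J l. \<integral>x. q l k x * q l k x \<partial>sphere_measure)"
      using i by (rule Bochner_Integration.integral_sum)
    also have "\<dots> = real (card (J l))" using orthonormal by simp
    finally show ?thesis using card_harmonic_indices[OF d2] by simp
  qed
  define P where "P = (\<lambda>l. smult (1 / Zdim d l) (g l))"
  have "is_gegenbauer d P"
    unfolding is_gegenbauer_def
  proof (intro conjI allI impI)
    fix l show "degree (P l) = l" "poly (P l) 1 = 1"
      using Zdim_pos[of l] deg g1 by (auto simp: P_def)
  next
    fix l m :: nat assume lm: "l \<noteq> m"
    obtain e :: 'a where e: "norm e = 1" using nonempty_Basis norm_Basis by blast
    have i: "integrable sphere_measure (\<lambda>x. q l k e * q m k' e * (q l k x * q m k' x))"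
      if "k \<in> J l" "k' \<in> J m" for k k'
      using that by (intro integrable_sphere_polynomial real_polynomial_cmult real_polynomial_mult polynomial_q)
    have "(\<integral>x. poly (g l * g m) (x \<bullet> e) \<partial>sphere_measure)
        = (\<integral>x. (\<Sum>k\<in>J l. \<Sum>k'\<in>J m. q l k e * q m k' e * (q l k x * q m k' x)) \<partial>sphere_measure)"
      using e g[of e] by (intro integral_sphere_cong) (simp add: reproducing_kernel_def sum_product mult_ac flip: g)
    also have "\<dots> = (\<Sum>k\<in>J l. \<Sum>k'\<in>J m. q l k e * q m k' e * (\<integral>x. q l k x * q m k' x \<partial>sphere_measure))"
      using i by (simp add: Bochner_Integration.integral_sum)
    also have "\<dots> = 0" using orthogonal_levels lm by simp
    finally have "gegenbauer_inner d (g l) (g m) = 0"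
      using gegenbauer_weight_integral[OF d2 dim e, of "g l * g m"] by (simp add: gegenbauer_inner_def)
    then show "gegenbauer_inner d (P l) (P m) = 0"
      by (simp add: P_def gegenbauer_inner_smult[OF d2] gegenbauer_inner_commute[OF d2, of "g l"])
  qed
  then have "gegenbauer d = P"
    using ex1_is_gegenbauer[OF d2] is_gegenbauer_gegenbauer[OF d2] by blast
  then show ?thesis using g[OF x y, of l] Zdim_pos[of l] by (simp add: P_def reproducing_kernel_def inner_commute)
qed

end

section \<open>A large sieve inequality for harmonics\<close>

lemma dist_radial_projection:
  fixes y :: "'a::euclidean_space"
  assumes "y \<noteq> 0"
  shows "dist y (y /\<^sub>R norm y) = \<bar>norm y - 1\<bar>"
proof -
  have "y - y /\<^sub>R norm y = (norm y - 1) *\<^sub>R (y /\<^sub>R norm y)"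
    using assms by (simp add: scaleR_diff_left left_diff_distrib)
  then have "norm (y - y /\<^sub>R norm y) = \<bar>norm y - 1\<bar> * norm (y /\<^sub>R norm y)" by (metis norm_scaleR)
  then show ?thesis using assms by (simp add: dist_norm)
qed

text \<open>
  Each value \<open>u(x)\<^sup>2\<close> is at most the mean of \<open>u\<^sup>2\<close> over
  the ball of radius \<open>r\<close> around \<open>x\<close>. These balls lie in the shell
  between the radii \<open>1 - r\<close> and \<open>1 + r\<close>, and no point is covered more
  than \<open>c\<close> times, since its radial projection is within \<open>2 r\<close> of the
  centres. This is the upper half of a Marcinkiewicz-Zygmund inequality.
\<close>

lemma separated_points_sum_square_le:
  fixes p :: "nat \<Rightarrow> 'a::euclidean_space \<Rightarrow> real"
  assumes D: "DIM('a) \<ge> 2" and p: "\<And>l. solid_harmonic l (p l)"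
    and A: "finite A" "A \<subseteq> sphere 0 1" and r: "0 < r" "r < 1"
    and sep: "\<And>z. z \<in> sphere 0 1 \<Longrightarrow> real (card {x \<in> A. dist x z \<le> 2 * r}) \<le> c"
  shows "r ^ (DIM('a) - 1) * (\<Sum>x\<in>A. (\<Sum>l\<le>n. p l x)\<^sup>2)
    \<le> 2 * real DIM('a) * c * (1 + r) ^ (DIM('a) + 2 * n) * (\<Sum>l\<le>n. \<integral>x. (p l x)\<^sup>2 \<partial>sphere_measure)"
proof -
  let ?D = "DIM('a)" and ?V = "measure lborel (ball (0::'a) 1)"
  define u where "u = (\<lambda>x. \<Sum>l\<le>n. p l x)"
  let ?E = "\<Sum>l\<le>n. \<integral>x. (p l x)\<^sup>2 \<partial>sphere_measure"
  have V: "?V > 0" by (simp add: content_ball_pos)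
  have u: "real_polynomial_function u"
    unfolding u_def using p by (intro real_polynomial_sum solid_harmonic_polynomial)
  have lu: "laplacian u = (\<lambda>x. 0)"
    unfolding u_def using p by (subst laplacian_sum) (auto simp: solid_harmonic_def)
  have int: "integrable lborel (\<lambda>y. indicator (ball z s) y *\<^sub>R (u y)\<^sup>2)" for z s
    using set_integrable_ball_polynomial[OF real_polynomial_function_power[OF u, of 2], of z s]
    by (simp add: set_integrable_def)
  obtain z0 :: 'a where z0: "z0 \<in> sphere 0 1"
    using nonempty_Basis norm_Basis by (metis all_not_in_conv mem_sphere_0)
  have c0: "c \<ge> 0" using sep[OF z0] by linarith
  have ptw: "(\<Sum>x\<in>A. indicator (ball x r) y *\<^sub>R (u y)\<^sup>2)
      \<le> c * (indicator (ball 0 (1 + r)) y *\<^sub>R (u y)\<^sup>2 - indicator (ball 0 (1 - r)) y *\<^sub>R (u y)\<^sup>2)" for y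
  proof -
    let ?Ay = "{x \<in> A. dist x y < r}"
    have eq: "(\<Sum>x\<in>A. indicator (ball x r) y *\<^sub>R (u y)\<^sup>2) = real (card ?Ay) * (u y)\<^sup>2"
    proof -
      have "(\<Sum>x\<in>A. indicator (ball x r) y *\<^sub>R (u y)\<^sup>2) = (\<Sum>x\<in>A. if dist x y < r then (u y)\<^sup>2 else 0)"
        by (intro sum.cong) (auto simp: indicator_def)
      also have "\<dots> = (\<Sum>x\<in>?Ay. (u y)\<^sup>2)" by (rule sum.inter_filter[symmetric, OF A(1)])
      finally show ?thesis by simp
    qed
    show ?thesis
    proof (cases "?Ay = {}")
      case True
      have "indicator (ball 0 (1 - r)) y \<le> (indicator (ball 0 (1 + r)) y :: real)"
        using r by (auto simp: indicator_def)
      then have "0 \<le> c * ((indicator (ball 0 (1 + r)) y - indicator (ball 0 (1 - r)) y) * (u y)\<^sup>2)"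
        using c0 by (intro mult_nonneg_nonneg) auto
      then show ?thesis unfolding eq True by (simp add: left_diff_distrib)
    next
      case False
      then obtain x where x: "x \<in> A" "dist x y < r" by auto
      have nx: "norm x' = 1" if "x' \<in> A" for x' using A that by auto
      have yb: "\<bar>norm y - 1\<bar> < r"
        using x norm_triangle_ineq3[of y x] nx[OF x(1)] by (simp add: dist_norm norm_minus_commute)
      then have y0: "y \<noteq> 0" using r by auto
      let ?z = "y /\<^sub>R norm y"
      have z: "?z \<in> sphere 0 1" using y0 by simp
      have "?Ay \<subseteq> {x \<in> A. dist x ?z \<le> 2 * r}"
      proof (rule subsetI)
        fix x' assume "x' \<in> ?Ay"
        then have "x' \<in> A" "dist x' y < r" by auto
        moreover have "dist x' ?z \<le> dist x' y + dist y ?z" by (rule dist_triangle)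
        ultimately show "x' \<in> {x \<in> A. dist x ?z \<le> 2 * r}"
          using yb dist_radial_projection[OF y0] by simp
      qed
      then have "real (card ?Ay) \<le> c"
        using sep[OF z] card_mono[of "{x \<in> A. dist x ?z \<le> 2 * r}" ?Ay] A(1) by fastforce
      then have "real (card ?Ay) * (u y)\<^sup>2 \<le> c * (u y)\<^sup>2" by (intro mult_right_mono) auto
      moreover have "y \<in> ball 0 (1 + r)" "y \<notin> ball 0 (1 - r)" using yb by auto
      ultimately show ?thesis unfolding eq by simp
    qed
  qed
  have "?V * r ^ ?D * (\<Sum>x\<in>A. (u x)\<^sup>2) = (\<Sum>x\<in>A. ?V * r ^ ?D * (u x)\<^sup>2)"
    by (simp add: sum_distrib_left)
  also have "\<dots> \<le> (\<Sum>x\<in>A. \<integral>y. indicator (ball x r) y *\<^sub>R (u y)\<^sup>2 \<partial>lborel)"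
    using harmonic_sub_mean_value[OF D u lu r(1)] by (intro sum_mono) (simp add: set_lebesgue_integral_def)
  also have "\<dots> = (\<integral>y. (\<Sum>x\<in>A. indicator (ball x r) y *\<^sub>R (u y)\<^sup>2) \<partial>lborel)"
    using int by (intro Bochner_Integration.integral_sum[symmetric]) auto
  also have "\<dots> \<le> (\<integral>y. c * (indicator (ball 0 (1 + r)) y *\<^sub>R (u y)\<^sup>2 - indicator (ball 0 (1 - r)) y *\<^sub>R (u y)\<^sup>2) \<partial>lborel)"
    using int by (intro integral_mono ptw Bochner_Integration.integrable_sum integrable_mult_right
        Bochner_Integration.integrable_diff) auto
  also have "\<dots> = c * ((LINT x:ball 0 (1 + r)|lborel. (u x)\<^sup>2) - (LINT x:ball 0 (1 - r)|lborel. (u x)\<^sup>2))"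
    using Bochner_Integration.integral_diff[OF int[of 0 "1 + r"] int[of 0 "1 - r"]]
    by (simp add: set_lebesgue_integral_def)
  also have "\<dots> \<le> c * (2 * r * real ?D * ?V * (1 + r) ^ (?D + 2 * n) * ?E)"
    unfolding u_def using integral_shell_harmonic_sum_square[OF D p r] c0 by (intro mult_left_mono)
  finally have "?V * r ^ ?D * (\<Sum>x\<in>A. (u x)\<^sup>2) \<le> c * (2 * r * real ?D * ?V * (1 + r) ^ (?D + 2 * n) * ?E)" .
  moreover have "r ^ ?D = r * r ^ (?D - 1)" using D by (simp flip: power_Suc)
  ultimately have "(?V * r) * (r ^ (?D - 1) * (\<Sum>x\<in>A. (u x)\<^sup>2))
      \<le> (?V * r) * (2 * real ?D * c * (1 + r) ^ (?D + 2 * n) * ?E)"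
    by (simp add: mult_ac)
  then show ?thesis using V r by (simp add: u_def)
qed

lemma one_plus_power_le_exp:
  fixes r :: real assumes "0 \<le> r"
  shows "(1 + r) ^ k \<le> exp (real k * r)"
proof -
  have "(1 + r) ^ k \<le> exp r ^ k" using assms by (intro power_mono exp_ge_add_one_self) auto
  then show ?thesis by (simp add: exp_of_nat_mult)
qed

context orthonormal_harmonics
begin

corollary level_sum_square:
  assumes x: "x \<in> sphere 0 1" shows "(\<Sum>k\<in>J l. (q l k x)\<^sup>2) = Zdim d l"
proof -
  have "x \<bullet> x = 1" using x by (simp add: norm_eq_1)
  then show ?thesis using addition_theorem[OF x x, of l] is_gegenbauer_gegenbauer[OF d2]
    by (simp add: power2_eq_square is_gegenbauer_def)
qed

text \<open>
  The energy of a point set at level \<open>l\<close>: the squared length of the vector of the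
  sums of the \<open>q l k\<close> over the points. It does not depend on the orthonormal
  family, being the double sum of \<open>Zdim d l\<close> times the Gegenbauer polynomial.
\<close>

definition level_energy :: "'a set \<Rightarrow> nat \<Rightarrow> real" where
  "level_energy A l = (\<Sum>k\<in>J l. (\<Sum>x\<in>A. q l k x)\<^sup>2)"

text \<open>
  The factor \<open>2 D\<close> comes from the width of the shell and from polar coordinates;
  the exponential bounds \<open>(1 + r) ^ (D + 2 n)\<close> when \<open>r \<le> 1\<close> and
  \<open>n r \<le> 1\<close>.
\<close>

definition sieve_const :: real where
  "sieve_const = 2 * real DIM('a) * exp (real DIM('a) + 2)"

lemma level_energy_nonneg: "level_energy A l \<ge> 0"
  by (simp add: level_energy_def sum_nonneg)

lemma integral_square_sum_q:
  "(\<integral>x. (\<Sum>k\<in>J l. c k * q l k x)\<^sup>2 \<partial>sphere_measure) = (\<Sum>k\<in>J l. (c k)\<^sup>2)"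
proof -
  have i: "integrable sphere_measure (\<lambda>x. c k * ((\<Sum>k\<in>J l. c k * q l k x) * q l k x))" if "k \<in> J l" for k
    using that by (intro integrable_sphere_polynomial real_polynomial_cmult real_polynomial_mult
        real_polynomial_sum polynomial_q)
  have "(\<integral>x. (\<Sum>k\<in>J l. c k * q l k x)\<^sup>2 \<partial>sphere_measure)
      = (\<integral>x. (\<Sum>k\<in>J l. c k * ((\<Sum>k\<in>J l. c k * q l k x) * q l k x)) \<partial>sphere_measure)"
    by (simp add: power2_eq_square sum_distrib_left mult_ac)
  also have "\<dots> = (\<Sum>k\<in>J l. \<integral>x. c k * ((\<Sum>k\<in>J l. c k * q l k x) * q l k x) \<partial>sphere_measure)"
    using i by (rule Bochner_Integration.integral_sum)
  also have "\<dots> = (\<Sum>k\<in>J l. c k * c k)"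
    using integral_sum_q[OF _ order_refl, of _ l c] by (intro sum.cong) auto
  finally show ?thesis by (simp add: power2_eq_square)
qed

text \<open>
  The dual form of \<open>separated_points_sum_square_le\<close>. It is obtained by testing that
  inequality with the polynomial whose Fourier coefficients are the sums of the \<open>q l
  k\<close> over the points: its sum over the points and its squared norm are both equal to the
  total energy.
\<close>

theorem large_sieve:
  assumes A: "finite A" "A \<subseteq> sphere 0 1" and r: "0 < r" "r < 1" "real n * r \<le> 1"
    and sep: "\<And>z. z \<in> sphere 0 1 \<Longrightarrow> real (card {x \<in> A. dist x z \<le> 2 * r}) \<le> c"
  shows "r ^ d * (\<Sum>l\<le>n. level_energy A l) \<le> sieve_const * c * real (card A)"
proof -
  define T where "T = (\<lambda>l k. \<Sum>x\<in>A. q l k x)"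
  define p where "p = (\<lambda>l x. \<Sum>k\<in>J l. T l k * q l k x)"
  define B where "B = (\<Sum>l\<le>n. level_energy A l)"
  have B0: "B \<ge> 0" unfolding B_def by (intro sum_nonneg level_energy_nonneg)
  have p: "solid_harmonic l (p l)" for l
    unfolding p_def by (intro solid_harmonic_sum solid_harmonic_cmult harmonic)
  obtain z0 :: 'a where z0: "z0 \<in> sphere 0 1"
    using nonempty_Basis norm_Basis by (metis all_not_in_conv mem_sphere_0)
  have c0: "c \<ge> 0" using sep[OF z0] by linarith
  have E: "(\<Sum>l\<le>n. \<integral>x. (p l x)\<^sup>2 \<partial>sphere_measure) = B"
    by (simp add: p_def integral_square_sum_q B_def level_energy_def T_def)
  have S: "(\<Sum>x\<in>A. \<Sum>l\<le>n. p l x) = B"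
  proof -
    have "(\<Sum>x\<in>A. \<Sum>l\<le>n. p l x) = (\<Sum>l\<le>n. \<Sum>x\<in>A. p l x)" by (rule sum.swap)
    also have "\<dots> = (\<Sum>l\<le>n. \<Sum>k\<in>J l. \<Sum>x\<in>A. T l k * q l k x)"
      unfolding p_def by (intro sum.cong refl sum.swap)
    also have "\<dots> = (\<Sum>l\<le>n. \<Sum>k\<in>J l. T l k * T l k)"
      by (simp add: T_def sum_distrib_left)
    finally show ?thesis by (simp add: B_def level_energy_def T_def power2_eq_square)
  qed
  have "B\<^sup>2 \<le> real (card A) * (\<Sum>x\<in>A. (\<Sum>l\<le>n. p l x)\<^sup>2)"
    using Cauchy_Schwarz_ineq_sum[of "\<lambda>_. 1" "\<lambda>x. \<Sum>l\<le>n. p l x" A] by (simp add: S)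
  then have "r ^ d * B\<^sup>2 \<le> r ^ d * (real (card A) * (\<Sum>x\<in>A. (\<Sum>l\<le>n. p l x)\<^sup>2))"
    using r by (intro mult_left_mono) auto
  also have "\<dots> = real (card A) * (r ^ (DIM('a) - 1) * (\<Sum>x\<in>A. (\<Sum>l\<le>n. p l x)\<^sup>2))"
    by (simp add: dim)
  also have "\<dots> \<le> real (card A) * (2 * real DIM('a) * c * (1 + r) ^ (DIM('a) + 2 * n) * B)"
    using separated_points_sum_square_le[OF dim_ge_2 p A r(1,2) sep, of n] unfolding E by (intro mult_left_mono) auto
  also have "\<dots> \<le> real (card A) * (2 * real DIM('a) * c * exp (real DIM('a) + 2) * B)"
  proof -
    have "(1 + r) ^ (DIM('a) + 2 * n) \<le> exp (real (DIM('a) + 2 * n) * r)"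
      using r by (intro one_plus_power_le_exp) auto
    also have "\<dots> \<le> exp (real DIM('a) + 2)"
    proof -
      have "real DIM('a) * r \<le> real DIM('a)" using r by (simp add: mult_left_le)
      moreover have "real (DIM('a) + 2 * n) * r = real DIM('a) * r + 2 * (real n * r)" by (simp add: algebra_simps)
      ultimately have "real (DIM('a) + 2 * n) * r \<le> real DIM('a) + 2" using r(3) by linarith
      then show ?thesis by simp
    qed
    finally show ?thesis using c0 B0 by (intro mult_left_mono mult_right_mono) auto
  qed
  also have "\<dots> = sieve_const * c * real (card A) * B" by (simp add: sieve_const_def mult_ac)
  finally have "(r ^ d * B) * B \<le> (sieve_const * c * real (card A)) * B"
    by (simp add: power2_eq_square mult_ac)
  moreover have "0 \<le> sieve_const * c * real (card A)" using c0 by (simp add: sieve_const_def)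
  ultimately have "r ^ d * B \<le> sieve_const * c * real (card A)"
    using B0 by (cases "B = 0") auto
  then show ?thesis by (simp add: B_def)
qed

text \<open>
  A single point is separated at every scale, and its energy at level \<open>l\<close> is
  \<open>Zdim d l\<close>. The sieve thus also yields the growth of the dimensions.
\<close>

lemma sum_Zdim_le: "n \<ge> 1 \<Longrightarrow> (\<Sum>l\<le>n. Zdim d l) \<le> sieve_const * 2 ^ d * real n ^ d"
proof -
  assume n: "n \<ge> 1"
  obtain z0 :: 'a where z0: "z0 \<in> sphere 0 1"
    using nonempty_Basis norm_Basis by (metis all_not_in_conv mem_sphere_0)
  \<comment> \<open>the factor 2 makes r < 1 also for n = 1\<close>
  define r where "r = 1 / (2 * real n)"
  have r: "0 < r" "r < 1" "real n * r \<le> 1" using n by (auto simp: r_def)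
  have "level_energy {z0} l = Zdim d l" for l
    using level_sum_square[OF z0] by (simp add: level_energy_def)
  moreover have "real (card {x \<in> {z0}. dist x z \<le> 2 * r}) \<le> 1" for z
  proof -
    have "card {x \<in> {z0}. dist x z \<le> 2 * r} \<le> card {z0}" by (intro card_mono) auto
    then show ?thesis by simp
  qed
  ultimately have "r ^ d * (\<Sum>l\<le>n. Zdim d l) \<le> sieve_const"
    using large_sieve[of "{z0}" r n 1] r z0 by simp
  then have "(\<Sum>l\<le>n. Zdim d l) \<le> sieve_const / r ^ d"
    using r by (simp add: pos_le_divide_eq mult.commute)
  also have "\<dots> = sieve_const * 2 ^ d * real n ^ d"
    by (simp add: r_def power_divide power_mult_distrib)
  finally show ?thesis .
qed

end

text \<open>
  On each dyadic block the weight \<open>l powr (- 2 s)\<close> is at most its value at the left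
  end. The resulting bounds form a geometric series with ratio \<open>2 powr (d - 2 s) <
  1\<close>, which is where \<open>s > d / 2\<close> enters.
\<close>

lemma dyadic_tail_bound:
  fixes b :: "nat \<Rightarrow> real" and s :: real
  assumes s: "s > real d / 2" and b: "\<And>l. b l \<ge> 0" and K: "K \<ge> 0" and t: "t \<ge> 1"
    and le: "\<And>L. L \<ge> t \<Longrightarrow> (\<Sum>l\<le>L. b l) \<le> K * real L ^ d"
  shows "(\<Sum>l\<in>{t<..M}. real l powr (- 2 * s) * b l)
    \<le> 2 ^ d / (1 - 2 powr (real d - 2 * s)) * K * real t powr (real d - 2 * s)"
proof -
  define \<rho> where "\<rho> = (2::real) powr (real d - 2 * s)"
  define C where "C = 2 ^ d * K * real t powr (real d - 2 * s)"
  let ?f = "\<lambda>l. real l powr (- 2 * s) * b l"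
  have s0: "s > 0" using s by (meson less_le_trans of_nat_0_le_iff zero_le_divide_iff less_eq_real_def order_le_less_trans zero_le_numeral)
  have C0: "C \<ge> 0" using K by (simp add: C_def)
  have \<rho>: "0 < \<rho>" "\<rho> < 1" using s by (auto simp: \<rho>_def powr_less_one)
  have f0: "?f l \<ge> 0" for l using b by simp
  have block: "sum ?f {2 ^ m * t<..2 ^ Suc m * t} \<le> C * \<rho> ^ m" for m
  proof -
    have pos: "real (2 ^ m * t) > 0" using t by simp
    have "sum ?f {2 ^ m * t<..2 ^ Suc m * t} \<le> (\<Sum>l\<in>{2 ^ m * t<..2 ^ Suc m * t}. real (2 ^ m * t) powr (- 2 * s) * b l)"
    proof (intro sum_mono mult_right_mono b)
      fix l assume "l \<in> {2 ^ m * t<..2 ^ Suc m * t}"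
      then have "real (2 ^ m * t) \<le> real l" by (simp only: of_nat_le_iff) simp
      then show "real l powr (- 2 * s) \<le> real (2 ^ m * t) powr (- 2 * s)"
        using pos s0 by (intro powr_mono2') auto
    qed
    also have "\<dots> = real (2 ^ m * t) powr (- 2 * s) * sum b {2 ^ m * t<..2 ^ Suc m * t}"
      by (simp add: sum_distrib_left)
    also have "\<dots> \<le> real (2 ^ m * t) powr (- 2 * s) * (K * real (2 ^ Suc m * t) ^ d)"
    proof (rule mult_left_mono)
      have "sum b {2 ^ m * t<..2 ^ Suc m * t} \<le> (\<Sum>l\<le>2 ^ Suc m * t. b l)"
        using b by (intro sum_mono2) auto
      also have "\<dots> \<le> K * real (2 ^ Suc m * t) ^ d" by (rule le) (simp add: Suc_leI)
      finally show "sum b {2 ^ m * t<..2 ^ Suc m * t} \<le> K * real (2 ^ Suc m * t) ^ d" .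
    qed simp
    also have "\<dots> = 2 ^ d * K * (real (2 ^ m * t) powr (- 2 * s) * real (2 ^ m * t) ^ d)"
      by (simp add: power_mult_distrib)
    also have "real (2 ^ m * t) powr (- 2 * s) * real (2 ^ m * t) ^ d = real (2 ^ m * t) powr (real d - 2 * s)"
      using pos by (simp add: powr_realpow[symmetric] powr_add[symmetric])
    also have "\<dots> = (2 ^ m) powr (real d - 2 * s) * real t powr (real d - 2 * s)"
      using t by (simp add: powr_mult)
    also have "(2 ^ m) powr (real d - 2 * s) = \<rho> ^ m"
      by (simp add: \<rho>_def powr_realpow[symmetric] powr_powr mult.commute)
    finally show ?thesis by (simp add: C_def mult_ac)
  qed
  have dy: "sum ?f {t<..2 ^ m * t} \<le> (\<Sum>i<m. C * \<rho> ^ i)" for m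
  proof (induction m)
    case (Suc m)
    have "{t<..2 ^ Suc m * t} = {t<..2 ^ m * t} \<union> {2 ^ m * t<..2 ^ Suc m * t}"
    proof -
      have un: "{i<..k} = {i<..j} \<union> {j<..k}" if "i \<le> j" "j \<le> k" for i j k :: nat
        using that by auto
      show ?thesis by (rule un) simp_all
    qed
    then have "sum ?f {t<..2 ^ Suc m * t} = sum ?f {t<..2 ^ m * t} + sum ?f {2 ^ m * t<..2 ^ Suc m * t}"
      by (simp add: sum.union_disjoint)
    then show ?case using Suc block[of m] by simp
  qed simp
  have "M \<le> 2 ^ M * t"
  proof -
    have "M \<le> 2 ^ M" by (simp add: less_imp_le)
    then show ?thesis using t by (metis mult.right_neutral mult_le_mono)
  qed
  then have "sum ?f {t<..M} \<le> sum ?f {t<..2 ^ M * t}"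
    using f0 by (intro sum_mono2) auto
  also have "\<dots> \<le> C * (\<Sum>i<M. \<rho> ^ i)" using dy[of M] by (simp add: sum_distrib_left)
  also have "\<dots> \<le> C * (1 / (1 - \<rho>))"
  proof (rule mult_left_mono[OF _ C0])
    have "(\<Sum>i<M. \<rho> ^ i) = (1 - \<rho> ^ M) / (1 - \<rho>)" using \<rho> by (simp add: sum_gp_strict)
    also have "\<dots> \<le> 1 / (1 - \<rho>)" using \<rho> by (intro divide_right_mono) auto
    finally show "(\<Sum>i<M. \<rho> ^ i) \<le> 1 / (1 - \<rho>)" .
  qed
  finally show ?thesis by (simp add: C_def \<rho>_def)
qed

section \<open>Completeness of the harmonics\<close>

text \<open>
  The surface measure has full support: the cone over a neighbourhood of \<open>z\<close> in the
  sphere contains a ball around \<open>z / 2\<close>.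
\<close>

lemma sphere_continuous_AE_zero:
  fixes h :: "'a::euclidean_space \<Rightarrow> real"
  assumes c: "continuous_on (sphere 0 1) h" and ae: "AE x in sphere_measure. h x = 0"
    and z: "z \<in> sphere 0 1"
  shows "h z = 0"
proof (rule ccontr)
  assume nz: "h z \<noteq> 0"
  let ?V = "measure lborel (ball (0::'a) 1)" and ?g = "\<lambda>x::'a. x /\<^sub>R norm x"
  have V: "?V > 0" by (simp add: content_ball_pos)
  obtain T where T: "open T" "h -` (- {0}) \<inter> sphere 0 1 = T \<inter> sphere 0 1"
  proof -
    have "open (- {0::real})" by (intro open_Compl closed_singleton)
    from c[unfolded continuous_on_open_invariant, rule_format, OF this]
    obtain T where "open T" "T \<inter> sphere 0 1 = h -` (- {0}) \<inter> sphere 0 1" by (elim exE conjE)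
    then show ?thesis by (intro that) (assumption, rule sym)
  qed
  have zT: "z \<in> T"
  proof -
    have "z \<in> h -` (- {0}) \<inter> sphere 0 1" using nz z by simp
    then show ?thesis unfolding T(2) by (rule IntD1)
  qed
  have Tb [measurable]: "T \<in> sets borel" using T(1) by simp
  have g [measurable]: "?g \<in> borel_measurable borel" by measurable
  have cg: "continuous (at (z /\<^sub>R 2)) ?g" using z by (intro continuous_intros) auto
  have gz: "?g (z /\<^sub>R 2) = z" using z by simp
  obtain \<epsilon> where \<epsilon>: "\<epsilon> > 0" "ball z \<epsilon> \<subseteq> T" using T(1) zT open_contains_ball by blast
  obtain e where e: "e > 0" "\<And>x. dist x (z /\<^sub>R 2) < e \<Longrightarrow> dist (?g x) z < \<epsilon>"
    using cg \<epsilon>(1) unfolding continuous_at_eps_delta gz by blast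
  have e: "e > 0" "\<And>x. dist x (z /\<^sub>R 2) < e \<Longrightarrow> ?g x \<in> T"
    using e \<epsilon>(2) by (auto simp: dist_commute)
  define r where "r = min e (1 / 2)"
  have r: "r > 0" using e by (simp add: r_def)
  have sub: "ball (z /\<^sub>R 2) r \<subseteq> ball 0 1"
  proof
    fix x assume "x \<in> ball (z /\<^sub>R 2) r"
    then have "dist x (z /\<^sub>R 2) < 1 / 2" by (simp add: r_def dist_commute)
    moreover have "dist (z /\<^sub>R 2) 0 = 1 / 2" using z by simp
    ultimately show "x \<in> ball 0 1" using dist_triangle[of x 0 "z /\<^sub>R 2"] by (simp add: dist_commute)
  qed
  have "(\<integral>x. indicator T x \<partial>sphere_measure) = (\<integral>x. (0::real) \<partial>(sphere_measure :: 'a measure))"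
  proof (rule integral_cong_AE)
    show "AE x in sphere_measure. indicator T x = (0::real)"
      using ae AE_space
    proof eventually_elim
      case (elim x)
      then have "x \<notin> T" using T(2) by (auto simp: space_sphere_measure)
      then show ?case by simp
    qed
    show "(indicator T :: 'a \<Rightarrow> real) \<in> borel_measurable sphere_measure"
    proof (rule borel_measurable_indicator')
      have "T \<inter> sphere 0 1 \<in> sets sphere_measure"
        unfolding sets_sphere_measure sets_restrict_space by (rule image_eqI[OF Int_commute Tb])
      then show "{x \<in> space sphere_measure. x \<in> T} \<in> sets sphere_measure"
        unfolding space_sphere_measure by (simp only: Int_def conj_commute)
    qed
  qed auto
  then have "(LINT x:ball 0 1|lborel. indicator T (?g x)) = (0::real)"
    using integral_sphere_eq_ball[of "indicator T"] V by simp
  moreover have "(\<integral>x. indicator (ball (z /\<^sub>R 2) r) x \<partial>lborel) \<le> (LINT x:ball 0 1|lborel. indicator T (?g x) :: real)"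
    unfolding set_lebesgue_integral_def
  proof (rule integral_mono)
    show "integrable lborel (\<lambda>x. indicator (ball (z /\<^sub>R 2) r) x :: real)"
      using emeasure_lborel_ball_finite[of "z /\<^sub>R 2" r] by simp
    show "integrable lborel (\<lambda>x. indicator (ball 0 1) x *\<^sub>R indicator T (?g x) :: real)"
    proof (rule Bochner_Integration.integrable_bound)
      show "integrable lborel (\<lambda>x. indicator (ball (0::'a) 1) x :: real)"
        using emeasure_lborel_ball_finite[of "0::'a" 1] by simp
      have [measurable]: "ball 0 1 \<in> sets (borel :: 'a measure)" by simp
      show "(\<lambda>x. indicator (ball 0 1) x *\<^sub>R indicator T (?g x) :: real) \<in> borel_measurable lborel"
        by measurable
    qed (auto simp: indicator_def)
    show "indicator (ball (z /\<^sub>R 2) r) x \<le> (indicator (ball 0 1) x *\<^sub>R indicator T (?g x) :: real)" for x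
      using sub e(2)[of x] by (auto simp: indicator_def r_def dist_commute)
  qed
  ultimately have "measure lborel (ball (z /\<^sub>R 2) r) \<le> 0" by simp
  moreover have "measure lborel (ball (z /\<^sub>R 2) r) > 0" by (rule content_ball_pos[OF r])
  ultimately show False by linarith
qed

context orthonormal_harmonics
begin

lemma continuous_q: "k \<in> J l \<Longrightarrow> continuous_on S (q l k)"
  by (intro continuous_real_polynomial polynomial_q)

lemma orthogonal_to_polynomials:
  assumes h: "continuous_on (sphere 0 1) h"
    and orth: "\<And>l k. k \<in> J l \<Longrightarrow> (\<integral>x. h x * q l k x \<partial>sphere_measure) = 0"
    and p: "real_polynomial_function p"
  shows "(\<integral>x. h x * p x \<partial>sphere_measure) = 0"
proof -
  obtain n u where u: "\<And>l. solid_harmonic l (u l)" "\<And>x. x \<in> sphere 0 1 \<Longrightarrow> p x = (\<Sum>l\<le>n. u l x)"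
    using polynomial_on_sphere_harmonic_sum[OF p] by blast
  define c where "c = (\<lambda>l k. \<integral>y. u l y * q l k y \<partial>sphere_measure)"
  have i: "integrable sphere_measure (\<lambda>x. c l k * (h x * q l k x))" if "k \<in> J l" for l k
    using that by (intro integrable_sphere_continuous continuous_intros h continuous_q)
  have "(\<integral>x. h x * p x \<partial>sphere_measure) = (\<integral>x. (\<Sum>l\<le>n. \<Sum>k\<in>J l. c l k * (h x * q l k x)) \<partial>sphere_measure)"
  proof (rule integral_sphere_cong)
    fix x :: 'a assume x: "x \<in> sphere 0 1"
    have "p x = (\<Sum>l\<le>n. \<Sum>k\<in>J l. c l k * q l k x)"
      using u(2)[OF x] solid_harmonic_expansion[OF u(1), of _ x] by (simp add: c_def)
    then show "h x * p x = (\<Sum>l\<le>n. \<Sum>k\<in>J l. c l k * (h x * q l k x))"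
      by (simp add: sum_distrib_left mult_ac)
  qed
  also have "\<dots> = (\<Sum>l\<le>n. \<Sum>k\<in>J l. \<integral>x. c l k * (h x * q l k x) \<partial>sphere_measure)"
    using i by (simp only: Bochner_Integration.integral_sum Bochner_Integration.integrable_sum)
  also have "\<dots> = 0" using orth by simp
  finally show ?thesis .
qed

text \<open>
  Polynomials are uniformly dense by the Stone-Weierstrass theorem, and on the sphere they are
  sums of harmonics.
\<close>

theorem harmonics_complete:
  assumes h: "continuous_on (sphere 0 1) h"
    and orth: "\<And>l k. k \<in> J l \<Longrightarrow> (\<integral>x. h x * q l k x \<partial>sphere_measure) = 0"
    and z: "z \<in> sphere 0 1"
  shows "h z = 0"
proof -
  have ih: "integrable sphere_measure (\<lambda>x. h x * h x)" "integrable sphere_measure (\<lambda>x. \<bar>h x\<bar>)"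
    using h by (auto intro!: integrable_sphere_continuous continuous_intros)
  let ?M = "\<integral>x. \<bar>h x\<bar> \<partial>sphere_measure"
  have M0: "?M \<ge> 0" by (simp add: Bochner_Integration.integral_nonneg)
  have le: "(\<integral>x. h x * h x \<partial>sphere_measure) \<le> e * ?M" if e: "e > 0" for e
  proof -
    obtain p where p: "real_polynomial_function p" "\<And>x. x \<in> sphere 0 1 \<Longrightarrow> \<bar>h x - p x\<bar> < e"
      using Stone_Weierstrass_real_polynomial_function[OF compact_sphere h e] by blast
    have ip: "integrable sphere_measure (\<lambda>x. h x * p x)"
      by (intro integrable_sphere_continuous continuous_on_mult h continuous_real_polynomial[OF p(1)])
    have "(\<integral>x. h x * h x \<partial>sphere_measure) = (\<integral>x. h x * h x - h x * p x \<partial>sphere_measure)"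
      using ih ip orthogonal_to_polynomials[OF h orth p(1)] by simp
    also have "\<dots> \<le> (\<integral>x. e * \<bar>h x\<bar> \<partial>sphere_measure)"
    proof (rule integral_mono)
      fix x :: 'a assume "x \<in> space sphere_measure"
      then have "\<bar>h x - p x\<bar> \<le> e" using p(2)[of x] by (simp add: space_sphere_measure)
      then have "\<bar>h x\<bar> * \<bar>h x - p x\<bar> \<le> \<bar>h x\<bar> * e" by (intro mult_left_mono) auto
      then show "h x * h x - h x * p x \<le> e * \<bar>h x\<bar>"
        by (simp add: abs_mult[symmetric] right_diff_distrib mult.commute)
    qed (use ih ip in auto)
    finally show ?thesis by simp
  qed
  have "(\<integral>x. h x * h x \<partial>sphere_measure) \<le> 0"
  proof (rule field_le_epsilon)
    fix e :: real assume e: "e > 0"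
    have "(\<integral>x. h x * h x \<partial>sphere_measure) \<le> e / (?M + 1) * ?M" using M0 e by (intro le divide_pos_pos) linarith+
    also have "\<dots> \<le> e"
    proof -
      have "?M + 1 > 0" using M0 by linarith
      then show ?thesis using e by (simp add: field_simps)
    qed
    finally show "(\<integral>x. h x * h x \<partial>sphere_measure) \<le> 0 + e" by simp
  qed
  then have "(\<integral>x. h x * h x \<partial>sphere_measure) = 0"
    by (intro antisym Bochner_Integration.integral_nonneg) auto
  then have "AE x in sphere_measure. h x * h x = 0"
    using ih by (subst (asm) integral_nonneg_eq_0_iff_AE) auto
  then have "AE x in sphere_measure. h x = 0" by (rule AE_mp) auto
  then show ?thesis using sphere_continuous_AE_zero[OF h] z by blast
qed

lemma constant_level: "k \<in> J 0 \<Longrightarrow> q 0 k x = q 0 k 0"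
  by (rule homogeneous_0_eq[OF solid_harmonic_homogeneous[OF harmonic]])

lemma level_zero_mean:
  assumes f: "continuous_on (sphere 0 1) f"
  shows "(\<Sum>k\<in>J 0. (\<integral>y. f y * q 0 k y \<partial>sphere_measure) * q 0 k x) = integral\<^sup>L sphere_measure f"
proof -
  have "(\<Sum>k\<in>J 0. (q 0 k 0) * q 0 k x) = 1"
  proof -
    have "(\<integral>y. 1 * q 0 k y \<partial>sphere_measure) = q 0 k 0" if "k \<in> J 0" for k
    proof -
      define c where "c = q 0 k 0"
      have "(\<lambda>y. 1 * q 0 k y) = (\<lambda>y. c)" unfolding c_def by (intro ext) (unfold mult_1, rule constant_level[OF that])
      then show ?thesis using integral_sphere_const[of c, where 'a='a] by (simp only: c_def)
    qed
    then have "(\<Sum>k\<in>J 0. (q 0 k 0) * q 0 k x) = (\<Sum>k\<in>J 0. (\<integral>y. 1 * q 0 k y \<partial>sphere_measure) * q 0 k x)"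
      by (intro sum.cong refl) (simp only:)
    also have "\<dots> = 1" using solid_harmonic_expansion[OF solid_harmonic_const[of 1], of x] by (simp only:)
    finally show ?thesis .
  qed
  moreover have "(\<integral>y. f y * q 0 k y \<partial>sphere_measure) = integral\<^sup>L sphere_measure f * q 0 k 0" if "k \<in> J 0" for k
  proof -
    have "(\<lambda>y. f y * q 0 k y) = (\<lambda>y. f y * q 0 k 0)" by (intro ext arg_cong2[where f="(*)"] refl constant_level that)
    then show ?thesis by simp
  qed
  then have "(\<Sum>k\<in>J 0. (\<integral>y. f y * q 0 k y \<partial>sphere_measure) * q 0 k x)
      = integral\<^sup>L sphere_measure f * (\<Sum>k\<in>J 0. (q 0 k 0) * q 0 k x)"
    by (simp add: sum_distrib_left mult.assoc cong: sum.cong)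
  ultimately show ?thesis by simp
qed

end

section \<open>Sobolev functions and the worst-case error\<close>

locale sobolev_harmonics = orthonormal_harmonics d q
  for d :: nat and q :: "nat \<Rightarrow> nat \<Rightarrow> 'a::euclidean_space \<Rightarrow> real" +
  fixes s :: real and a :: "nat \<Rightarrow> real"
  assumes s: "s > real d / 2" and a_pos: "\<And>l. a l > 0"
    and a_comparable: "comparable_on UNIV a (\<lambda>l. (1 + eigval d l) powr (- s))"
begin

lemma s_pos: "s > 0" using s d2 by (meson less_le_trans less_imp_le order_le_less_trans of_nat_0_le_iff divide_nonneg_pos zero_less_numeral)

lemma weight_upper: "\<exists>C>0. \<forall>l\<ge>1. a l \<le> C * real l powr (- 2 * s)"
proof -
  obtain c1 where c1: "c1 > 0" "\<And>l. c1 * a l \<le> (1 + eigval d l) powr (- s)"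
    using a_comparable unfolding comparable_on_def by auto
  have "a l \<le> (1 / c1) * real l powr (- 2 * s)" if l: "l \<ge> 1" for l
  proof -
    have "real l * real l \<le> real l * (real l + real d - 1)" using d2 by (intro mult_left_mono) auto
    then have "(real l)\<^sup>2 \<le> 1 + eigval d l" by (simp add: eigval_def power2_eq_square)
    then have "(1 + eigval d l) powr (- s) \<le> ((real l)\<^sup>2) powr (- s)"
      using s_pos l by (intro powr_mono2') auto
    also have "\<dots> = real l powr (- 2 * s)"
      using l powr_powr[of "real l" 2 "- s"] by (simp add: powr_numeral)
    finally show ?thesis using c1(1) c1(2)[of l] by (simp add: field_simps)
  qed
  then show ?thesis using c1(1) by (intro exI[of _ "1 / c1"]) auto
qed

lemma eigval_nonneg: "eigval d l \<ge> 0"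
  using d2 by (simp add: eigval_def)

lemma weight_lower: "\<exists>C>0. \<forall>l. 1 / a l \<le> C * (1 + eigval d l) powr s"
proof -
  obtain c2 where c2: "c2 > 0" "\<And>l. (1 + eigval d l) powr (- s) \<le> c2 * a l"
    using a_comparable unfolding comparable_on_def by auto
  have "1 / a l \<le> c2 * (1 + eigval d l) powr s" for l
  proof -
    have "(1 + eigval d l) powr s > 0" using eigval_nonneg[of l] by (simp add: add_pos_nonneg)
    moreover have "1 / (1 + eigval d l) powr s \<le> c2 * a l" using c2(2)[of l] by (simp add: powr_minus_divide)
    ultimately show ?thesis using a_pos[of l] by (simp add: field_simps)
  qed
  then show ?thesis using c2(1) by blast
qed

lemma summable_weight_Zdim: "summable (\<lambda>l. a l * Zdim d l)"
proof -
  obtain C where C: "C > 0" "\<And>l. l \<ge> 1 \<Longrightarrow> a l \<le> C * real l powr (- 2 * s)" using weight_upper by blast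
  let ?K = "sieve_const * 2 ^ d"
  let ?B = "2 ^ d / (1 - 2 powr (real d - 2 * s)) * ?K"
  have Z0: "Zdim d l \<ge> 0" for l using Zdim_pos[of l] by simp
  have tail: "(\<Sum>l\<in>{1<..M}. real l powr (- 2 * s) * Zdim d l) \<le> ?B" for M
    using dyadic_tail_bound[OF s Z0, where K="?K" and t=1 and M=M] sum_Zdim_le by (simp add: sieve_const_def)
  show ?thesis
  proof (rule summableI_nonneg_bounded)
    show "0 \<le> a l * Zdim d l" for l using a_pos[of l] Z0 by simp
    fix n
    have "(\<Sum>l<n. a l * Zdim d l) \<le> (\<Sum>l\<in>{0, 1} \<union> {1<..n}. a l * Zdim d l)"
      using mult_nonneg_nonneg[OF less_imp_le[OF a_pos] Z0] by (intro sum_mono2) auto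
    also have "\<dots> = (a 0 * Zdim d 0 + a 1 * Zdim d 1) + (\<Sum>l\<in>{1<..n}. a l * Zdim d l)"
      by (subst sum.union_disjoint) auto
    also have "(\<Sum>l\<in>{1<..n}. a l * Zdim d l) \<le> (\<Sum>l\<in>{1<..n}. C * real l powr (- 2 * s) * Zdim d l)"
      using C Z0 by (intro sum_mono mult_right_mono) auto
    also have "\<dots> = C * (\<Sum>l\<in>{1<..n}. real l powr (- 2 * s) * Zdim d l)"
      by (simp add: sum_distrib_left mult.assoc)
    also have "\<dots> \<le> C * ?B" using tail C(1) by (intro mult_left_mono) auto
    finally show "(\<Sum>l<n. a l * Zdim d l) \<le> (a 0 * Zdim d 0 + a 1 * Zdim d 1) + C * ?B" by simp
  qed
qed

abbreviation fc :: "('a \<Rightarrow> real) \<Rightarrow> nat \<Rightarrow> nat \<Rightarrow> real" where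
  "fc \<equiv> fourier_coeff q"

definition sobolev_energy :: "('a \<Rightarrow> real) \<Rightarrow> nat \<Rightarrow> real" where
  "sobolev_energy f l = (\<Sum>k\<in>J l. 1 / a l * \<bar>fc f l k\<bar>\<^sup>2)"

lemma sobolev_energy_nonneg: "sobolev_energy f l \<ge> 0"
  using a_pos[of l] by (simp add: sobolev_energy_def sum_nonneg less_imp_le)

lemma summable_sobolev_energy:
  assumes "f \<in> sobolev_space d q s"
  shows "summable (sobolev_energy f)"
proof -
  obtain C where C: "C > 0" "\<And>l. 1 / a l \<le> C * (1 + eigval d l) powr s" using weight_lower by blast
  have "summable (\<lambda>l. C * (\<Sum>k\<in>J l. (1 + eigval d l) powr s * \<bar>fc f l k\<bar>\<^sup>2))"
    using assms by (intro summable_mult) (simp add: sobolev_space_def)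
  then show ?thesis
  proof (rule summable_comparison_test')
    fix l :: nat
    have "sobolev_energy f l \<le> (\<Sum>k\<in>J l. (C * (1 + eigval d l) powr s) * \<bar>fc f l k\<bar>\<^sup>2)"
      unfolding sobolev_energy_def using C(2)[of l] by (intro sum_mono mult_right_mono) auto
    also have "\<dots> = C * (\<Sum>k\<in>J l. (1 + eigval d l) powr s * \<bar>fc f l k\<bar>\<^sup>2)"
      by (simp add: sum_distrib_left mult.assoc)
    finally show "norm (sobolev_energy f l) \<le> C * (\<Sum>k\<in>J l. (1 + eigval d l) powr s * \<bar>fc f l k\<bar>\<^sup>2)"
      using sobolev_energy_nonneg[of f l] by simp
  qed
qed

definition level_part :: "('a \<Rightarrow> real) \<Rightarrow> nat \<Rightarrow> 'a \<Rightarrow> real" where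
  "level_part f l x = (\<Sum>k\<in>J l. fc f l k * q l k x)"

text \<open>
  The inequality of arithmetic and geometric means, weighted by \<open>a l\<close>. The
  right-hand side is independent of \<open>x\<close> by the addition theorem and summable in
  \<open>l\<close>; it serves as majorant in the Weierstrass test.
\<close>

lemma level_part_bound:
  assumes x: "x \<in> sphere 0 1"
  shows "\<bar>level_part f l x\<bar> \<le> sobolev_energy f l + a l * Zdim d l"
proof -
  have "\<bar>level_part f l x\<bar> \<le> (\<Sum>k\<in>J l. \<bar>fc f l k * q l k x\<bar>)"
    unfolding level_part_def by (rule sum_abs)
  also have "\<dots> \<le> (\<Sum>k\<in>J l. 1 / a l * \<bar>fc f l k\<bar>\<^sup>2 + a l * (q l k x)\<^sup>2)"
  proof (rule sum_mono)
    fix k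
    let ?u = "\<bar>fc f l k\<bar>" and ?v = "\<bar>q l k x\<bar>" and ?r = "sqrt (a l)"
    have r: "?r > 0" "?r\<^sup>2 = a l" using a_pos[of l] by auto
    have "0 \<le> (?u / ?r - ?r * ?v)\<^sup>2" by simp
    also have "\<dots> = ?u\<^sup>2 / a l - 2 * (?u * ?v) + a l * ?v\<^sup>2"
      using r(1) unfolding power2_diff power_divide power_mult_distrib r(2) by simp
    finally have "2 * (?u * ?v) \<le> 1 / a l * ?u\<^sup>2 + a l * (q l k x)\<^sup>2" by simp
    moreover have "0 \<le> ?u * ?v" by simp
    ultimately show "\<bar>fc f l k * q l k x\<bar> \<le> 1 / a l * \<bar>fc f l k\<bar>\<^sup>2 + a l * (q l k x)\<^sup>2"
      by (simp only: abs_mult)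
  qed
  also have "\<dots> = sobolev_energy f l + a l * (\<Sum>k\<in>J l. (q l k x)\<^sup>2)"
    by (simp add: sobolev_energy_def sum.distrib sum_distrib_left)
  also have "\<dots> = sobolev_energy f l + a l * Zdim d l" by (simp add: level_sum_square[OF x])
  finally show ?thesis .
qed

lemma continuous_level_part: "continuous_on S (level_part f l)"
  unfolding level_part_def by (intro continuous_intros continuous_q)

text \<open>
  The series converges uniformly, so its sum is continuous with the same Fourier coefficients as
  \<open>f\<close>; by completeness it is \<open>f\<close>. Here the choice of the continuous
  representative in the Sobolev space is used.
\<close>

theorem sobolev_fourier_series:
  assumes f: "f \<in> sobolev_space d q s" and x: "x \<in> sphere 0 1"
  shows "(\<lambda>l. level_part f l x) sums f x"
proof -
  define M where "M = (\<lambda>l. sobolev_energy f l + a l * Zdim d l)"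
  define g where "g = (\<lambda>x. \<Sum>l. level_part f l x)"
  have cf: "continuous_on (sphere 0 1) f" using f by (simp add: sobolev_space_def)
  have M: "summable M" unfolding M_def
    by (intro summable_add summable_sobolev_energy summable_weight_Zdim f)
  have bd: "norm (level_part f l x) \<le> M l" if "x \<in> sphere 0 1" for l x
    using level_part_bound[OF that, of f l] by (simp add: M_def)
  have ul: "uniform_limit (sphere 0 1) (\<lambda>n x. \<Sum>l<n. level_part f l x) g sequentially"
    unfolding g_def by (rule Weierstrass_m_test[OF bd M])
  have cg: "continuous_on (sphere 0 1) g"
    by (rule uniform_limit_theorem[OF _ ul]) (auto intro!: always_eventually continuous_intros continuous_level_part)
  have summ: "summable (\<lambda>l. level_part f l y)" if "y \<in> sphere 0 1" for y
    by (rule summable_comparison_test'[OF M bd[OF that]])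
  have coef: "(\<integral>y. g y * q l k y \<partial>sphere_measure) = fc f l k" if k: "k \<in> J l" for l k
  proof -
    have lim: "(\<lambda>n. \<integral>y. (\<Sum>j<n. level_part f j y) * q l k y \<partial>sphere_measure) \<longlonglongrightarrow> (\<integral>y. g y * q l k y \<partial>sphere_measure)"
    proof (rule integral_dominated_convergence[where w = "\<lambda>y. suminf M * \<bar>q l k y\<bar>"])
      show "integrable sphere_measure (\<lambda>y. suminf M * \<bar>q l k y\<bar>)"
        using k by (intro integrable_sphere_continuous continuous_intros continuous_q)
      show "(\<lambda>y. g y * q l k y) \<in> borel_measurable sphere_measure"
        using k by (intro measurable_sphere_continuous continuous_intros continuous_q cg)
      show "(\<lambda>y. (\<Sum>j<n. level_part f j y) * q l k y) \<in> borel_measurable sphere_measure" for n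
        using k by (intro measurable_sphere_continuous continuous_intros continuous_q continuous_level_part)
      show "AE y in sphere_measure. (\<lambda>n. (\<Sum>j<n. level_part f j y) * q l k y) \<longlonglongrightarrow> g y * q l k y"
        unfolding g_def
        by (intro AE_I2 tendsto_mult_right summable_LIMSEQ summ) (simp add: space_sphere_measure)
      show "AE y in sphere_measure. norm ((\<Sum>j<n. level_part f j y) * q l k y) \<le> suminf M * \<bar>q l k y\<bar>" for n
      proof (rule AE_I2)
        fix y :: 'a assume "y \<in> space sphere_measure"
        then have y: "y \<in> sphere 0 1" by (simp add: space_sphere_measure)
        have "\<bar>\<Sum>j<n. level_part f j y\<bar> \<le> (\<Sum>j<n. M j)"
          using bd[OF y] by (intro order_trans[OF sum_abs] sum_mono) simp
        also have "\<dots> \<le> suminf M"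
          using order_trans[OF norm_ge_zero bd[OF y]] by (intro sum_le_suminf M) auto
        finally show "norm ((\<Sum>j<n. level_part f j y) * q l k y) \<le> suminf M * \<bar>q l k y\<bar>"
          by (simp add: abs_mult mult_right_mono)
      qed
    qed
    have "(\<integral>y. (\<Sum>j<n. level_part f j y) * q l k y \<partial>sphere_measure) = fc f l k" if n: "n > l" for n
    proof -
      have i: "integrable sphere_measure (\<lambda>y. level_part f j y * q l k y)" for j
        using k by (intro integrable_sphere_continuous continuous_intros continuous_q continuous_level_part)
      have one: "(\<integral>y. level_part f j y * q l k y \<partial>sphere_measure) = (if j = l then fc f l k else 0)" for j
      proof (cases "j = l")
        case True
        then show ?thesis unfolding level_part_def using integral_sum_q[OF k order_refl, of "fc f l"] k by simp
      next
        case False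
        have "solid_harmonic j (level_part f j)"
          unfolding level_part_def by (intro solid_harmonic_sum solid_harmonic_cmult harmonic)
        then show ?thesis using solid_harmonic_orthogonal[OF dim_ge_2 _ harmonic[OF k] False] False by simp
      qed
      have "(\<integral>y. (\<Sum>j<n. level_part f j y) * q l k y \<partial>sphere_measure)
          = (\<Sum>j<n. \<integral>y. level_part f j y * q l k y \<partial>sphere_measure)"
        using i by (simp add: sum_distrib_right Bochner_Integration.integral_sum)
      also have "\<dots> = fc f l k" unfolding one using n by simp
      finally show ?thesis .
    qed
    then have "(\<lambda>n. \<integral>y. (\<Sum>j<n. level_part f j y) * q l k y \<partial>sphere_measure) \<longlonglongrightarrow> fc f l k"
      by (intro tendsto_eventually eventually_sequentiallyI[of "Suc l"]) auto
    then show ?thesis using lim LIMSEQ_unique by blast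
  qed
  have "f x - g x = 0"
  proof (rule harmonics_complete[OF _ _ x])
    show "continuous_on (sphere 0 1) (\<lambda>x. f x - g x)" by (intro continuous_intros cf cg)
    fix l k assume k: "k \<in> J l"
    have i: "integrable sphere_measure (\<lambda>y. f y * q l k y)" "integrable sphere_measure (\<lambda>y. g y * q l k y)"
      using k by (auto intro!: integrable_sphere_continuous continuous_intros continuous_q cf cg)
    show "(\<integral>y. (f y - g y) * q l k y \<partial>sphere_measure) = 0"
      using Bochner_Integration.integral_diff[OF i] coef[OF k]
      by (simp add: left_diff_distrib fourier_coeff_def)
  qed
  then have "f x = g x" by simp
  then show ?thesis using summable_sums[OF summ[OF x]] by (simp add: g_def)
qed

definition quadrature_error :: "('a \<Rightarrow> real) \<Rightarrow> 'a set \<Rightarrow> real" where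
  "quadrature_error f A = 1 / real (card A) * (\<Sum>x\<in>A. f x) - integral\<^sup>L sphere_measure f"

text \<open>
  The error functional applied to the Fourier series pairs the coefficients of \<open>f\<close>
  with the sums \<open>T l k\<close>; the level \<open>0\<close> cancels against the integral.
  Cauchy-Schwarz with the weights \<open>a l\<close> bounds the error by the norm of
  \<open>f\<close> times the square root of the weighted energy of the points.
\<close>

theorem quadrature_error_le:
  assumes f: "f \<in> sobolev_space d q s" and nf: "sobolev_norm d q a f \<le> 1"
    and A: "finite A" "A \<subseteq> sphere 0 1" "A \<noteq> {}"
    and W: "\<And>n. (\<Sum>l=1..n. a l * level_energy A l) \<le> (real (card A))\<^sup>2 * W"
  shows "\<bar>quadrature_error f A\<bar> \<le> sqrt W"
proof -
  define N where "N = real (card A)"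
  have N: "N > 0" using A by (simp add: N_def card_gt_0_iff)
  define T where "T = (\<lambda>l k. \<Sum>x\<in>A. q l k x)"
  define e where "e = (\<lambda>l. \<Sum>k\<in>J l. fc f l k * T l k / N)"
  have cf: "continuous_on (sphere 0 1) f" using f by (simp add: sobolev_space_def)
  have e_eq: "e l = (\<Sum>x\<in>A. level_part f l x) / N" for l
  proof -
    have "(\<Sum>x\<in>A. level_part f l x) = (\<Sum>k\<in>J l. \<Sum>x\<in>A. fc f l k * q l k x)"
      unfolding level_part_def by (rule sum.swap)
    then show ?thesis by (simp add: e_def T_def sum_distrib_left sum_divide_distrib)
  qed
  have "(\<lambda>l. (\<Sum>x\<in>A. level_part f l x) / N) sums ((\<Sum>x\<in>A. f x) / N)"
    using sobolev_fourier_series[OF f] A by (intro sums_divide sums_sum) auto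
  then have "e sums ((\<Sum>x\<in>A. f x) / N)" using e_eq by presburger
  then have "(\<lambda>l. e (Suc l)) sums ((\<Sum>x\<in>A. f x) / N - e 0)" by (subst sums_Suc_iff) simp
  moreover have "e 0 = integral\<^sup>L sphere_measure f"
    using level_zero_mean[OF cf] N unfolding e_eq by (simp add: level_part_def fourier_coeff_def N_def)
  ultimately have sm: "(\<lambda>l. e (Suc l)) sums quadrature_error f A"
    by (simp add: quadrature_error_def N_def)
  have en: "(\<Sum>l. sobolev_energy f l) \<le> 1"
    using nf suminf_nonneg[OF summable_sobolev_energy[OF f] sobolev_energy_nonneg]
    by (simp add: sobolev_norm_def sobolev_energy_def[abs_def])
  have W0: "W \<ge> 0" using W[of 0] N by (simp add: N_def zero_le_mult_iff)
  have part: "\<bar>\<Sum>l<n. e (Suc l)\<bar> \<le> sqrt W" for n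
  proof -
    let ?I = "SIGMA l:{1..n}. J l"
    have fin: "finite ?I" using finite_J by auto
    have reidx: "(\<Sum>l<n. h (Suc l)) = (\<Sum>l=1..n. h l)" for h :: "nat \<Rightarrow> real"
      by (rule sum.reindex_bij_witness[of _ "\<lambda>l. l - 1" Suc]) auto
    have sig: "(\<Sum>l=1..n. \<Sum>k\<in>J l. h l k) = (\<Sum>(l, k)\<in>?I. h l k)" for h :: "nat \<Rightarrow> nat \<Rightarrow> real"
      using finite_J by (intro sum.Sigma) auto
    \<comment> \<open>Cauchy-Schwarz over all pairs (l, k), with the weight split evenly\<close>
    let ?u = "\<lambda>(l, k). fc f l k / sqrt (a l)" and ?v = "\<lambda>(l, k). sqrt (a l) * T l k / N"
    have 1: "(\<Sum>l<n. e (Suc l)) = (\<Sum>i\<in>?I. ?u i * ?v i)"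
    proof -
      have "fc f l k * T l k / N = ?u (l, k) * ?v (l, k)" for l k
        using a_pos[of l] by simp
      then show ?thesis unfolding reidx unfolding e_def sig by (intro sum.cong) auto
    qed
    have 2: "(\<Sum>i\<in>?I. ?u i * ?v i)\<^sup>2 \<le> (\<Sum>i\<in>?I. (?u i)\<^sup>2) * (\<Sum>i\<in>?I. (?v i)\<^sup>2)"
      by (rule Cauchy_Schwarz_ineq_sum)
    have 3: "(\<Sum>i\<in>?I. (?u i)\<^sup>2) = (\<Sum>l=1..n. sobolev_energy f l)"
      unfolding sobolev_energy_def sig using a_pos
      by (intro sum.cong) (auto simp: power_divide less_imp_le)
    have 4: "(\<Sum>i\<in>?I. (?v i)\<^sup>2) = (\<Sum>l=1..n. a l * level_energy A l) / N\<^sup>2"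
      unfolding level_energy_def sum_distrib_left sig sum_divide_distrib using a_pos
      by (intro sum.cong) (auto simp: power_divide power_mult_distrib less_imp_le T_def)
    have 5: "(\<Sum>l=1..n. sobolev_energy f l) * ((\<Sum>l=1..n. a l * level_energy A l) / N\<^sup>2) \<le> 1 * W"
    proof (rule mult_mono)
      have "(\<Sum>l=1..n. sobolev_energy f l) \<le> (\<Sum>l. sobolev_energy f l)"
        by (intro sum_le_suminf summable_sobolev_energy f sobolev_energy_nonneg) auto
      then show "(\<Sum>l=1..n. sobolev_energy f l) \<le> 1" using en by simp
      show "(\<Sum>l=1..n. a l * level_energy A l) / N\<^sup>2 \<le> W"
        using W[of n] N by (simp add: N_def divide_le_eq mult.commute)
      show "0 \<le> (\<Sum>l=1..n. a l * level_energy A l) / N\<^sup>2"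
        using a_pos level_energy_nonneg by (intro divide_nonneg_nonneg sum_nonneg mult_nonneg_nonneg) (auto intro: less_imp_le)
    qed simp
    have "(\<Sum>l<n. e (Suc l))\<^sup>2 \<le> W" using 2 5 unfolding 1 3 4 by linarith
    then show ?thesis by (metis real_sqrt_abs real_sqrt_le_mono)
  qed
  have "(\<lambda>n. \<bar>\<Sum>l<n. e (Suc l)\<bar>) \<longlonglongrightarrow> \<bar>quadrature_error f A\<bar>"
    using sm unfolding sums_def by (rule tendsto_rabs)
  then show ?thesis by (rule LIMSEQ_le_const2) (use part in auto)
qed

text \<open>
  Equality in Cauchy-Schwarz, restricted to the levels \<open>1, \<dots>, t\<close>: the Fourier
  coefficients of \<open>f\<close> are proportional to \<open>a l\<close> times the sums of
  \<open>q l k\<close> over the points, that is, \<open>f\<close> is a multiple of the sum of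
  the truncated kernels centred at the points.
\<close>

theorem extremal_polynomial:
  assumes A: "finite A" "A \<subseteq> sphere 0 1" "A \<noteq> {}"
    and Q: "Q = (\<Sum>l=1..t. a l * level_energy A l) / (real (card A))\<^sup>2" "Q > 0"
  obtains f where "f \<in> sobolev_space d q s" "sobolev_norm d q a f \<le> 1" "quadrature_error f A = sqrt Q"
proof -
  define N where "N = real (card A)"
  have N: "N > 0" using A by (simp add: N_def card_gt_0_iff)
  \<comment> \<open>the factor normalizes the norm of f to 1\<close>
  define c where "c = (\<lambda>l k. if l \<in> {1..t} then a l * (\<Sum>x\<in>A. q l k x) / (N * sqrt Q) else 0)"
  define u where "u = (\<lambda>l x. \<Sum>k\<in>J l. c l k * q l k x)"
  define f where "f = (\<lambda>x. \<Sum>l=1..t. u l x)"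
  have sq: "sqrt Q > 0" "(sqrt Q)\<^sup>2 = Q" using Q(2) by auto
  have u: "solid_harmonic l (u l)" for l
    unfolding u_def by (intro solid_harmonic_sum solid_harmonic_cmult harmonic)
  have pf: "real_polynomial_function f"
    unfolding f_def using u by (intro real_polynomial_sum solid_harmonic_polynomial)
  have cf: "continuous_on (sphere 0 1) f" by (rule continuous_real_polynomial[OF pf])
  have coef: "fc f l k = c l k" if k: "k \<in> J l" for l k
  proof -
    have i: "integrable sphere_measure (\<lambda>y. u j y * q l k y)" for j
      using k u by (intro integrable_sphere_polynomial real_polynomial_mult polynomial_q solid_harmonic_polynomial)
    have one: "(\<integral>y. u j y * q l k y \<partial>sphere_measure) = (if j = l then c l k else 0)" for j
      using solid_harmonic_orthogonal[OF dim_ge_2 u harmonic[OF k], of j]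
        integral_sum_q[OF k order_refl, of "c l"] k by (auto simp: u_def)
    have "fc f l k = (\<Sum>j=1..t. \<integral>y. u j y * q l k y \<partial>sphere_measure)"
      unfolding fourier_coeff_def f_def sum_distrib_right using i by (intro Bochner_Integration.integral_sum) auto
    also have "\<dots> = c l k" unfolding one by (simp add: c_def)
    finally show ?thesis .
  qed
  have zero: "sobolev_energy f l = 0" "(\<Sum>k\<in>J l. (1 + eigval d l) powr s * \<bar>fc f l k\<bar>\<^sup>2) = 0" if "l \<notin> {1..t}" for l
    using coef that by (auto simp: sobolev_energy_def c_def)
  have sobolev_energy: "sobolev_energy f l = a l * level_energy A l / (N\<^sup>2 * Q)" if l: "l \<in> {1..t}" for l
  proof -
    have "1 / a l * \<bar>fc f l k\<bar>\<^sup>2 = a l * (\<Sum>x\<in>A. q l k x)\<^sup>2 / (N\<^sup>2 * Q)" if "k \<in> J l" for k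
      using l coef[OF that] a_pos[of l] sq(2)
      by (simp add: c_def power_divide power_mult_distrib) (simp add: power2_eq_square)
    then show ?thesis by (simp add: sobolev_energy_def level_energy_def sum_distrib_left sum_divide_distrib)
  qed
  have "f \<in> sobolev_space d q s"
    unfolding sobolev_space_def L2_sphere_def
  proof (intro CollectI conjI)
    show "f \<in> borel_measurable sphere_measure" by (rule measurable_sphere_continuous[OF cf])
    show "integrable sphere_measure (\<lambda>x. (f x)\<^sup>2)" by (intro integrable_sphere_continuous continuous_intros cf)
    show "continuous_on (sphere 0 1) f" by fact
    show "summable (\<lambda>l. \<Sum>k\<in>J l. (1 + eigval d l) powr s * \<bar>fc f l k\<bar>\<^sup>2)"
      by (rule summable_finite[of "{1..t}"]) (use zero in auto)
  qed
  moreover have "sobolev_norm d q a f \<le> 1"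
  proof -
    have "(\<Sum>l. sobolev_energy f l) = (\<Sum>l=1..t. sobolev_energy f l)"
      by (rule suminf_finite) (use zero in auto)
    also have "\<dots> = (\<Sum>l=1..t. a l * level_energy A l) / (N\<^sup>2 * Q)"
      using sobolev_energy by (simp add: sum_divide_distrib)
    also have "\<dots> = 1" using Q N by (simp add: N_def field_simps)
    finally show ?thesis by (simp add: sobolev_norm_def sobolev_energy_def[abs_def])
  qed
  moreover have "quadrature_error f A = sqrt Q"
  proof -
    have "integral\<^sup>L sphere_measure f = (\<Sum>l=1..t. integral\<^sup>L sphere_measure (u l))"
      unfolding f_def using u by (intro Bochner_Integration.integral_sum integrable_sphere_polynomial solid_harmonic_polynomial)
    also have "\<dots> = 0" using integral_sphere_harmonic[OF dim_ge_2 u] by simp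
    finally have int0: "integral\<^sup>L sphere_measure f = 0" .
    have "(\<Sum>x\<in>A. f x) = (\<Sum>l=1..t. \<Sum>x\<in>A. u l x)" unfolding f_def by (rule sum.swap)
    also have "\<dots> = (\<Sum>l=1..t. a l * level_energy A l / (N * sqrt Q))"
    proof (intro sum.cong refl)
      fix l assume l: "l \<in> {1..t}"
      have "(\<Sum>x\<in>A. u l x) = (\<Sum>k\<in>J l. c l k * (\<Sum>x\<in>A. q l k x))"
        unfolding u_def sum_distrib_left by (rule sum.swap)
      also have "\<dots> = a l * level_energy A l / (N * sqrt Q)"
        using l by (simp add: c_def level_energy_def sum_distrib_left sum_divide_distrib power2_eq_square mult_ac)
      finally show "(\<Sum>x\<in>A. u l x) = a l * level_energy A l / (N * sqrt Q)" .
    qed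
    also have "\<dots> = (Q * N\<^sup>2) / (N * sqrt Q)"
      using Q(1) N by (simp add: N_def flip: sum_divide_distrib)
    finally have "quadrature_error f A = Q / sqrt Q"
      using N int0 by (simp add: quadrature_error_def N_def power2_eq_square)
    then show ?thesis using Q(2) by (simp add: real_div_sqrt)
  qed
  ultimately show ?thesis using that by blast
qed

end

section \<open>Property R and the truncated kernel\<close>

lemma cos_le_quadratic:
  fixes x :: real
  assumes "0 \<le> x" "x \<le> 1"
  shows "cos x \<le> 1 - x\<^sup>2 / 4"
proof -
  have c: "cos y \<ge> 1 / 2" if "0 \<le> y" "y \<le> 1" for y :: real
  proof -
    have "cos (pi / 3) \<le> cos y" using that pi_gt3 by (intro cos_monotone_0_pi_le) auto
    then show ?thesis by (simp add: cos_60)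
  qed
  have s: "sin y \<ge> y / 2" if y: "0 \<le> y" "y \<le> 1" for y :: real
  proof -
    have "sin 0 - 0 / 2 \<le> sin y - y / 2"
    proof (rule DERIV_nonneg_imp_nondecreasing[OF y(1)])
      fix z assume z: "0 \<le> z" "z \<le> y"
      have "((\<lambda>y. sin y - y / 2) has_real_derivative (cos z - 1 / 2)) (at z)"
        by (auto intro!: derivative_eq_intros)
      then show "\<exists>D. ((\<lambda>y. sin y - y / 2) has_real_derivative D) (at z) \<and> 0 \<le> D"
        using c[of z] z y by auto
    qed
    then show ?thesis by simp
  qed
  have "1 - 0\<^sup>2 / 4 - cos 0 \<le> 1 - x\<^sup>2 / 4 - cos x"
  proof (rule DERIV_nonneg_imp_nondecreasing[OF assms(1)])
    fix z assume z: "0 \<le> z" "z \<le> x"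
    have "((\<lambda>x. 1 - x\<^sup>2 / 4 - cos x) has_real_derivative (sin z - z / 2)) (at z)"
      by (auto intro!: derivative_eq_intros)
    then show "\<exists>D. ((\<lambda>x. 1 - x\<^sup>2 / 4 - cos x) has_real_derivative D) (at z) \<and> 0 \<le> D"
      using s[of z] z assms by auto
  qed
  then show ?thesis by simp
qed

lemma near_in_spherical_cap:
  fixes x z :: "'a::euclidean_space"
  assumes "x \<in> sphere 0 1" "z \<in> sphere 0 1" "0 \<le> \<theta>" "\<theta> \<le> 1" "dist x z \<le> \<theta> / 2"
  shows "x \<in> spherical_cap z \<theta>"
proof -
  have "x \<bullet> x = 1" "z \<bullet> z = 1" using assms by (auto simp: norm_eq_1)
  then have "(dist x z)\<^sup>2 = 2 - 2 * (x \<bullet> z)"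
    by (simp add: dist_norm power2_norm_eq_inner inner_simps inner_commute)
  moreover have "(dist x z)\<^sup>2 \<le> (\<theta> / 2)\<^sup>2" using assms by (intro power_mono) auto
  ultimately have "1 - \<theta>\<^sup>2 / 8 \<le> x \<bullet> z" by (simp add: power_divide)
  moreover have "cos \<theta> \<le> 1 - \<theta>\<^sup>2 / 4" using assms by (intro cos_le_quadratic)
  moreover have "\<theta>\<^sup>2 / 8 \<le> \<theta>\<^sup>2 / 4" by simp
  ultimately have "cos \<theta> \<le> x \<bullet> z" by linarith
  then show ?thesis using assms by (simp add: spherical_cap_def)
qed

text \<open>
  Property R in terms of distances. The cap of angle \<open>\<theta>\<close> contains the points
  within distance \<open>\<theta> / 2\<close> of its centre only for moderate
  \<open>\<theta>\<close>; since the cosine is periodic, a cap of angle near \<open>2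
  \<pi>\<close> can even be a single point. An angle above \<open>1\<close> occurs only when
  \<open>N < c1 powr d\<close>, and then the trivial bound \<open>N\<close> is good enough.
\<close>

lemma property_R_chordal:
  fixes X :: "nat \<Rightarrow> 'a::euclidean_space set"
  assumes conf: "configurations I X" and R: "property_R d I X" and d: "d \<ge> 1"
  obtains c0 c1 where "c0 > 0" "c1 > 0"
    "\<And>N z. N \<in> I \<Longrightarrow> z \<in> sphere 0 1 \<Longrightarrow> real (card {x \<in> X N. dist x z \<le> c1 * real N powr (- 1 / real d)}) \<le> c0"
proof -
  obtain c0 c1 where c: "c0 > 0" "c1 > 0" "\<And>N z. N \<in> I \<Longrightarrow> z \<in> sphere 0 1 \<Longrightarrow>
      real (card (X N \<inter> spherical_cap z (c1 * real N powr (- 1 / real d)))) \<le> c0"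
    using R unfolding property_R_def by blast
  have "real (card {x \<in> X N. dist x z \<le> (c1 / 2) * real N powr (- 1 / real d)}) \<le> c0 + c1 powr real d"
    if N: "N \<in> I" and z: "z \<in> sphere 0 1" for N z
  proof -
    have X: "X N \<subseteq> sphere 0 1" "finite (X N)" "card (X N) = N" "N > 0"
      using conf N by (auto simp: configurations_def intro: gr0I)
    define \<theta> where "\<theta> = c1 * real N powr (- 1 / real d)"
    have \<theta>0: "\<theta> \<ge> 0" using c by (simp add: \<theta>_def)
    let ?A = "{x \<in> X N. dist x z \<le> (c1 / 2) * real N powr (- 1 / real d)}"
    show ?thesis
    proof (cases "\<theta> \<le> 1")
      case True
      have "?A \<subseteq> X N \<inter> spherical_cap z \<theta>"
        using near_in_spherical_cap[OF _ z \<theta>0 True] X(1) by (auto simp: \<theta>_def)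
      then have "card ?A \<le> card (X N \<inter> spherical_cap z \<theta>)" using X(2) by (intro card_mono) auto
      then have "real (card ?A) \<le> c0" using c(3)[OF N z] by (simp add: \<theta>_def)
      then show ?thesis using powr_ge_zero[of c1 "real d"] by linarith
    next
      case False
      have "real N powr (1 / real d) \<le> c1"
      proof -
        have p: "real N powr (1 / real d) > 0" using X(4) by simp
        have "1 \<le> c1 * inverse (real N powr (1 / real d))"
          using False by (simp add: \<theta>_def powr_minus)
        then show ?thesis using p by (simp add: field_simps)
      qed
      then have "(real N powr (1 / real d)) powr real d \<le> c1 powr real d" by (intro powr_mono2) auto
      then have "real N \<le> c1 powr real d" using d X(4) by (simp add: powr_powr)
      moreover have "card ?A \<le> N" using card_mono[of "X N" ?A] X by simp
      ultimately show ?thesis using c(1) by linarith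
    qed
  qed
  then show ?thesis using that[of "c0 + c1 powr real d" "c1 / 2"] c by (simp add: add_pos_nonneg)
qed

context orthonormal_harmonics
begin

text \<open>
  By the addition theorem the double sum of the kernel is a weighted sum of energies.
\<close>

lemma truncated_kernel_sum:
  assumes A: "A \<subseteq> sphere 0 1"
  shows "(\<Sum>y\<in>A. \<Sum>z\<in>A. truncated_kernel d a t (y \<bullet> z)) = (\<Sum>l=1..t. a l * level_energy A l)"
proof -
  have "truncated_kernel d a t (y \<bullet> z) = (\<Sum>l=1..t. a l * (\<Sum>k\<in>J l. q l k y * q l k z))"
    if "y \<in> A" "z \<in> A" for y z
  proof -
    have "y \<in> sphere 0 1" "z \<in> sphere 0 1" using that A by auto
    then show ?thesis unfolding truncated_kernel_def by (simp only: addition_theorem mult.assoc)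
  qed
  then have "(\<Sum>y\<in>A. \<Sum>z\<in>A. truncated_kernel d a t (y \<bullet> z))
      = (\<Sum>y\<in>A. \<Sum>z\<in>A. \<Sum>l=1..t. a l * (\<Sum>k\<in>J l. q l k y * q l k z))"
    by simp
  also have "\<dots> = (\<Sum>y\<in>A. \<Sum>l=1..t. \<Sum>z\<in>A. a l * (\<Sum>k\<in>J l. q l k y * q l k z))"
    by (intro sum.cong refl sum.swap)
  also have "\<dots> = (\<Sum>l=1..t. \<Sum>y\<in>A. \<Sum>z\<in>A. a l * (\<Sum>k\<in>J l. q l k y * q l k z))"
    by (rule sum.swap)
  also have "\<dots> = (\<Sum>l=1..t. a l * level_energy A l)"
  proof (intro sum.cong refl)
    fix l
    have "(\<Sum>y\<in>A. \<Sum>z\<in>A. \<Sum>k\<in>J l. q l k y * q l k z) = (\<Sum>y\<in>A. \<Sum>k\<in>J l. \<Sum>z\<in>A. q l k y * q l k z)"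
      by (intro sum.cong refl sum.swap)
    also have "\<dots> = (\<Sum>k\<in>J l. \<Sum>y\<in>A. \<Sum>z\<in>A. q l k y * q l k z)" by (rule sum.swap)
    also have "\<dots> = level_energy A l" by (simp add: level_energy_def power2_eq_square sum_product)
    finally show "(\<Sum>y\<in>A. \<Sum>z\<in>A. a l * (\<Sum>k\<in>J l. q l k y * q l k z)) = a l * level_energy A l"
      by (simp flip: sum_distrib_left)
  qed
  finally show ?thesis .
qed

end

section \<open>The characterization of QMC designs\<close>

context sobolev_harmonics
begin

lemma worst_case_error_leI:
  assumes "\<And>f. f \<in> sobolev_space d q s \<Longrightarrow> sobolev_norm d q a f \<le> 1 \<Longrightarrow> \<bar>quadrature_error f A\<bar> \<le> c"
  shows "worst_case_error d q s a A \<le> ereal c"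
  unfolding worst_case_error_def using assms by (intro SUP_least) (simp add: quadrature_error_def)

lemma quadrature_error_le_worst_case:
  assumes "f \<in> sobolev_space d q s" "sobolev_norm d q a f \<le> 1"
  shows "ereal \<bar>quadrature_error f A\<bar> \<le> worst_case_error d q s a A"
  unfolding worst_case_error_def quadrature_error_def using assms by (intro SUP_upper) simp

lemma truncated_energy_le_worst_case:
  assumes A: "finite A" "A \<subseteq> sphere 0 1" "A \<noteq> {}" and w: "worst_case_error d q s a A \<le> ereal c" and c: "c \<ge> 0"
  shows "(\<Sum>l=1..t. a l * level_energy A l) / (real (card A))\<^sup>2 \<le> c\<^sup>2"
proof -
  define Q where "Q = (\<Sum>l=1..t. a l * level_energy A l) / (real (card A))\<^sup>2"
  show ?thesis
  proof (cases "Q > 0")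
    case True
    obtain f where f: "f \<in> sobolev_space d q s" "sobolev_norm d q a f \<le> 1" "quadrature_error f A = sqrt Q"
      using extremal_polynomial[OF A Q_def True] by blast
    have "ereal \<bar>sqrt Q\<bar> \<le> ereal c"
      using order_trans[OF quadrature_error_le_worst_case[OF f(1,2)] w] f(3) by simp
    then have "sqrt Q \<le> c" using True by simp
    then have "(sqrt Q)\<^sup>2 \<le> c\<^sup>2" using True by (intro power_mono) auto
    then show ?thesis unfolding Q_def[symmetric] using True by simp
  next
    case False
    then show ?thesis unfolding Q_def[symmetric] using zero_le_power2[of c] by linarith
  qed
qed

text \<open>
  The levels above \<open>t N\<close> contribute the optimal order for every sequence with
  Property R. The sieve is applied with a radius proportional to \<open>1 / L\<close>, at most
  the separation scale \<open>N powr (- 1 / d)\<close>, and gives energy \<open>O(N L ^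
  d)\<close> up to level \<open>L\<close>; the dyadic summation turns this into \<open>N * t
  powr (d - 2 s)\<close>, which is of the order \<open>N\<^sup>2 * N powr (- 2 s / d)\<close>
  for \<open>t\<close> of the order \<open>N powr (1 / d)\<close>.
\<close>

lemma tail_energy_bound:
  fixes X :: "nat \<Rightarrow> 'a set" and t :: "nat \<Rightarrow> nat"
  assumes conf: "configurations I X" and R: "property_R d I X"
    and t1: "\<And>N. N \<in> I \<Longrightarrow> t N \<ge> 1" and tc: "comparable_on I (\<lambda>N. real (t N)) (\<lambda>N. real N powr (1 / real d))"
  obtains C where "C \<ge> 0" "\<And>N n. N \<in> I \<Longrightarrow>
    (\<Sum>l\<in>{t N<..n}. a l * level_energy (X N) l) \<le> (real N)\<^sup>2 * (C * real N powr (- 2 * s / real d))"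
proof -
  have d1: "d \<ge> 1" using d2 by simp
  obtain c0 c1 where c: "c0 > 0" "c1 > 0" "\<And>N z. N \<in> I \<Longrightarrow> z \<in> sphere 0 1 \<Longrightarrow>
      real (card {x \<in> X N. dist x z \<le> c1 * real N powr (- 1 / real d)}) \<le> c0"
    using property_R_chordal[OF conf R d1] by blast
  obtain k2 where k2: "k2 > 0" "\<And>N. N \<in> I \<Longrightarrow> real N powr (1 / real d) \<le> k2 * real (t N)"
    using tc unfolding comparable_on_def by blast
  obtain Ca where Ca: "Ca > 0" "\<And>l. l \<ge> 1 \<Longrightarrow> a l \<le> Ca * real l powr (- 2 * s)" using weight_upper by blast
  \<comment> \<open>with the radius \<kappa> / L, the bound 1/2 keeps the radius below 1, the other one keeps
    twice the radius below the separation scale for every L >= t N\<close>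
  define \<kappa> where "\<kappa> = min (1 / 2) (c1 / (2 * k2))"
  have \<kappa>: "\<kappa> > 0" "\<kappa> \<le> 1 / 2" "\<kappa> \<le> c1 / (2 * k2)" using c k2 by (auto simp: \<kappa>_def)
  define K where "K = sieve_const * c0 / \<kappa> ^ d"
  have K0: "K \<ge> 0" using c \<kappa> by (simp add: K_def sieve_const_def)
  define B where "B = 2 ^ d / (1 - 2 powr (real d - 2 * s))"
  define k3 where "k3 = (1 / k2) powr (real d - 2 * s)"
  define C where "C = Ca * B * K * k3"
  have "2 powr (real d - 2 * s) < 1" using s by (intro powr_less_one) auto
  then have B0: "B \<ge> 0" by (simp add: B_def)
  have C0: "C \<ge> 0" using Ca B0 K0 by (simp add: C_def k3_def)
  have "(\<Sum>l\<in>{t N<..n}. a l * level_energy (X N) l) \<le> (real N)\<^sup>2 * (C * real N powr (- 2 * s / real d))"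
    if N: "N \<in> I" for N n
  proof -
    have X: "X N \<subseteq> sphere 0 1" "finite (X N)" "card (X N) = N" "N > 0"
      using conf N by (auto simp: configurations_def intro: gr0I)
    have Np: "real N powr (1 / real d) > 0" using X(4) by simp
    have le: "(\<Sum>l\<le>L. level_energy (X N) l) \<le> (K * real N) * real L ^ d" if L: "L \<ge> t N" for L
    proof -
      have L1: "real L \<ge> 1" using L t1[OF N] by simp
      define r where "r = \<kappa> / real L"
      have r: "0 < r" "r < 1" "real L * r \<le> 1"
        using \<kappa> L1 by (auto simp: r_def divide_less_eq)
      have "real N powr (1 / real d) \<le> k2 * real L"
        using k2(2)[OF N] k2(1) L by (meson mult_left_mono of_nat_le_iff order_trans less_imp_le)
      then have "1 / (k2 * real L) \<le> real N powr (- 1 / real d)"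
        using Np k2 L1 by (simp add: powr_minus field_simps)
      then have "c1 * (1 / (k2 * real L)) \<le> c1 * real N powr (- 1 / real d)"
        using c by (intro mult_left_mono) auto
      moreover have "2 * r \<le> c1 * (1 / (k2 * real L))"
      proof -
        have "2 * \<kappa> \<le> c1 / k2" using \<kappa>(3) by simp
        then have "2 * \<kappa> / real L \<le> c1 / k2 / real L" using L1 by (intro divide_right_mono) auto
        then show ?thesis by (simp add: r_def)
      qed
      ultimately have r2: "2 * r \<le> c1 * real N powr (- 1 / real d)" by linarith
      have sep: "real (card {x \<in> X N. dist x z \<le> 2 * r}) \<le> c0" if z: "z \<in> sphere 0 1" for z
      proof -
        have "card {x \<in> X N. dist x z \<le> 2 * r} \<le> card {x \<in> X N. dist x z \<le> c1 * real N powr (- 1 / real d)}"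
          using r2 X(2) by (intro card_mono) auto
        then show ?thesis using c(3)[OF N z] by linarith
      qed
      have "r ^ d * (\<Sum>l\<le>L. level_energy (X N) l) \<le> sieve_const * c0 * real N"
        using large_sieve[OF X(2,1) r sep] X(3) by simp
      then have "(\<Sum>l\<le>L. level_energy (X N) l) \<le> sieve_const * c0 * real N / r ^ d"
        using r by (simp add: pos_le_divide_eq mult.commute)
      also have "\<dots> = (K * real N) * real L ^ d"
        by (simp add: K_def r_def power_divide)
      finally show ?thesis .
    qed
    have KN: "0 \<le> K * real N" using K0 by simp
    have tN: "real (t N) > 0" using t1[OF N] by simp
    have "(\<Sum>l\<in>{t N<..n}. a l * level_energy (X N) l)
        \<le> (\<Sum>l\<in>{t N<..n}. (Ca * real l powr (- 2 * s)) * level_energy (X N) l)"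
      using Ca(2) t1[OF N] by (intro sum_mono mult_right_mono level_energy_nonneg) auto
    also have "\<dots> = Ca * (\<Sum>l\<in>{t N<..n}. real l powr (- 2 * s) * level_energy (X N) l)"
      by (simp add: sum_distrib_left mult.assoc)
    also have "\<dots> \<le> Ca * (B * (K * real N) * real (t N) powr (real d - 2 * s))"
      unfolding B_def using Ca(1)
      by (intro mult_left_mono dyadic_tail_bound s level_energy_nonneg KN t1 N le) auto
    also have "\<dots> \<le> Ca * (B * (K * real N) * (k3 * real N powr ((real d - 2 * s) / real d)))"
    proof (intro mult_left_mono)
      have "real N powr (1 / real d) * (1 / k2) \<le> real (t N)"
        using k2(2)[OF N] k2(1) by (simp add: divide_le_eq mult.commute)
      then have "real (t N) powr (real d - 2 * s) \<le> (real N powr (1 / real d) * (1 / k2)) powr (real d - 2 * s)"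
        using s Np k2(1) by (intro powr_mono2') auto
      also have "\<dots> = k3 * real N powr ((real d - 2 * s) / real d)"
        using k2(1) Np powr_mult[of "real N powr (1 / real d)" "1 / k2" "real d - 2 * s"]
        unfolding k3_def by (simp add: powr_powr mult.commute)
      finally show "real (t N) powr (real d - 2 * s) \<le> k3 * real N powr ((real d - 2 * s) / real d)" .
    qed (use Ca B0 KN in auto)
    also have "\<dots> = C * (real N * real N powr ((real d - 2 * s) / real d))"
      by (simp add: C_def mult_ac)
    also have "real N * real N powr ((real d - 2 * s) / real d) = (real N)\<^sup>2 * real N powr (- 2 * s / real d)"
    proof -
      have "real N * real N powr ((real d - 2 * s) / real d) = real N powr (1 + (real d - 2 * s) / real d)"
        using X(4) by (simp add: powr_add)
      also have "1 + (real d - 2 * s) / real d = 2 + (- 2 * s / real d)" using d1 by (simp add: field_simps)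
      also have "real N powr (2 + (- 2 * s / real d)) = (real N)\<^sup>2 * real N powr (- 2 * s / real d)"
        unfolding powr_add using X(4) by (simp add: powr_numeral)
      finally show ?thesis .
    qed
    finally show ?thesis by (simp add: mult_ac)
  qed
  then show ?thesis using that C0 by blast
qed

theorem QMC_designs_iff:
  fixes X :: "nat \<Rightarrow> 'a set" and x :: "nat \<Rightarrow> nat \<Rightarrow> 'a" and t :: "nat \<Rightarrow> nat"
  assumes conf: "configurations I X" and bij: "\<And>N. N \<in> I \<Longrightarrow> bij_betw (\<lambda>j. x j N) {1..N} (X N)"
    and R: "property_R d I X" and t1: "\<And>N. N \<in> I \<Longrightarrow> t N \<ge> 1"
    and tc: "comparable_on I (\<lambda>N. real (t N)) (\<lambda>N. real N powr (1 / real d))"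
  shows "QMC_designs d q s a I X \<longleftrightarrow>
    (\<lambda>N. 1 / (real N)\<^sup>2 * (\<Sum>j=1..N. \<Sum>i=1..N. truncated_kernel d a (t N) (x j N \<bullet> x i N)))
      \<in> O[inf at_top (principal I)](\<lambda>N. real N powr (- 2 * s / real d))" (is "_ \<longleftrightarrow> ?Q \<in> O[_](?p)")
proof -
  have X: "X N \<subseteq> sphere 0 1" "finite (X N)" "card (X N) = N" "N > 0" "X N \<noteq> {}" if "N \<in> I" for N
    using conf that by (auto simp: configurations_def intro: gr0I)
  have Q: "?Q N = (\<Sum>l=1..t N. a l * level_energy (X N) l) / (real N)\<^sup>2" if N: "N \<in> I" for N
  proof -
    have "(\<Sum>j=1..N. \<Sum>i=1..N. truncated_kernel d a (t N) (x j N \<bullet> x i N))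
        = (\<Sum>y\<in>X N. \<Sum>z\<in>X N. truncated_kernel d a (t N) (y \<bullet> z))"
      using sum.reindex_bij_betw[OF bij[OF N], of "\<lambda>z. truncated_kernel d a (t N) (y \<bullet> z)" for y]
        sum.reindex_bij_betw[OF bij[OF N], of "\<lambda>y. \<Sum>z\<in>X N. truncated_kernel d a (t N) (y \<bullet> z)"] by simp
    then show ?thesis using truncated_kernel_sum[OF X(1)[OF N], of a "t N"] by simp
  qed
  have Q0: "?Q N \<ge> 0" if "N \<in> I" for N
    unfolding Q[OF that] using a_pos level_energy_nonneg
    by (intro divide_nonneg_nonneg sum_nonneg mult_nonneg_nonneg) (auto intro: less_imp_le)
  have p0: "?p N > 0" if "N \<in> I" for N using X(4)[OF that] by simp
  have psq: "(c / real N powr (s / real d))\<^sup>2 = c\<^sup>2 * ?p N" if "N \<in> I" for c N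
  proof -
    have "(real N powr (s / real d))\<^sup>2 = real N powr (2 * s / real d)"
      by (simp add: power2_eq_square flip: powr_add)
    then show ?thesis by (simp add: power_divide powr_minus_divide)
  qed
  show ?thesis
  proof
    assume "QMC_designs d q s a I X"
    then obtain c where c: "c > 0" "\<And>N. N \<in> I \<Longrightarrow> worst_case_error d q s a (X N) \<le> ereal (c / real N powr (s / real d))"
      unfolding QMC_designs_def by blast
    have "?Q N \<le> c\<^sup>2 * ?p N" if N: "N \<in> I" for N
      using truncated_energy_le_worst_case[OF X(2)[OF N] X(1)[OF N] X(5)[OF N] c(2)[OF N], of "t N"] c(1)
      unfolding Q[OF N] psq[OF N] X(3)[OF N] by simp
    then have "norm (?Q N) \<le> c\<^sup>2 * norm (?p N)" if N: "N \<in> I" for N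
      using N unfolding real_norm_def abs_of_nonneg[OF Q0[OF N]] abs_of_pos[OF p0[OF N]] .
    then show "?Q \<in> O[inf at_top (principal I)](?p)"
      by (intro bigoI[of _ "c\<^sup>2"]) (unfold eventually_inf_principal, intro always_eventually allI impI)
  next
    assume "?Q \<in> O[inf at_top (principal I)](?p)"
    then obtain C where "\<forall>\<^sub>F N in inf at_top (principal I). norm (?Q N) \<le> C * norm (?p N)"
      by (rule landau_o.bigE)
    then obtain N0 where N0: "\<And>N. N \<ge> N0 \<Longrightarrow> N \<in> I \<Longrightarrow> \<bar>?Q N\<bar> \<le> C * \<bar>?p N\<bar>"
      by (auto simp: eventually_inf_principal eventually_at_top_linorder)
    \<comment> \<open>the O-bound need not hold for small N, which are finitely many and go into the constant\<close>
    define C1 where "C1 = \<bar>C\<bar> + (\<Sum>N<N0. \<bar>?Q N / ?p N\<bar>)"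
    have S0: "(\<Sum>N<N0. \<bar>?Q N / ?p N\<bar>) \<ge> 0" by (intro sum_nonneg) simp
    have C10: "C1 \<ge> 0" unfolding C1_def using S0 by linarith
    have QC: "?Q N \<le> C1 * ?p N" if N: "N \<in> I" for N
    proof (cases "N < N0")
      case True
      then have "\<bar>?Q N / ?p N\<bar> \<le> (\<Sum>N<N0. \<bar>?Q N / ?p N\<bar>)"
        by (intro member_le_sum[of N "{..<N0}" "\<lambda>N. \<bar>?Q N / ?p N\<bar>"]) auto
      then have "?Q N / ?p N \<le> C1" unfolding C1_def by linarith
      then show ?thesis using p0[OF N] by (simp only: pos_divide_le_eq)
    next
      case False
      then have "N0 \<le> N" by (simp only: not_less)
      from order_trans[OF abs_ge_self N0[OF this N]] have "?Q N \<le> C * ?p N"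
        unfolding abs_of_pos[OF p0[OF N]] .
      also have "\<dots> \<le> C1 * ?p N"
        using p0[OF N] S0 unfolding C1_def by (intro mult_right_mono) linarith+
      finally show ?thesis .
    qed
    obtain C2 where C2: "C2 \<ge> 0" "\<And>N n. N \<in> I \<Longrightarrow>
        (\<Sum>l\<in>{t N<..n}. a l * level_energy (X N) l) \<le> (real N)\<^sup>2 * (C2 * ?p N)"
      using tail_energy_bound[OF conf R t1 tc] by blast
    define c where "c = sqrt (C1 + C2) + 1"
    have "worst_case_error d q s a (X N) \<le> ereal (c / real N powr (s / real d))" if N: "N \<in> I" for N
    proof (rule worst_case_error_leI)
      fix f assume f: "f \<in> sobolev_space d q s" "sobolev_norm d q a f \<le> 1"
      have W: "(\<Sum>l=1..n. a l * level_energy (X N) l) \<le> (real (card (X N)))\<^sup>2 * ((C1 + C2) * ?p N)" for n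
      proof -
        have "(\<Sum>l=1..n. a l * level_energy (X N) l) \<le> (\<Sum>l\<in>{1..t N} \<union> {t N<..n}. a l * level_energy (X N) l)"
          using mult_nonneg_nonneg[OF less_imp_le[OF a_pos] level_energy_nonneg] by (intro sum_mono2) auto
        also have "\<dots> = (\<Sum>l=1..t N. a l * level_energy (X N) l) + (\<Sum>l\<in>{t N<..n}. a l * level_energy (X N) l)"
          by (intro sum.union_disjoint) auto
        also have "\<dots> \<le> (real N)\<^sup>2 * (C1 * ?p N) + (real N)\<^sup>2 * (C2 * ?p N)"
        proof (rule add_mono[OF _ C2(2)[OF N]])
          have "(real N)\<^sup>2 > 0" using X(4)[OF N] by simp
          then show "(\<Sum>l=1..t N. a l * level_energy (X N) l) \<le> (real N)\<^sup>2 * (C1 * ?p N)"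
            using QC[OF N] unfolding Q[OF N] by (simp add: pos_divide_le_eq mult.commute)
        qed
        finally show ?thesis using X(3)[OF N] by (simp add: algebra_simps)
      qed
      have "\<bar>quadrature_error f (X N)\<bar> \<le> sqrt ((C1 + C2) * ?p N)"
        by (rule quadrature_error_le[OF f X(2)[OF N] X(1)[OF N] X(5)[OF N] W])
      also have "(C1 + C2) * ?p N = (sqrt (C1 + C2) / real N powr (s / real d))\<^sup>2"
        using C10 C2(1) by (simp only: psq[OF N]) simp
      also have "sqrt \<dots> = sqrt (C1 + C2) / real N powr (s / real d)"
        using C10 C2(1) by simp
      also have "\<dots> \<le> c / real N powr (s / real d)"
        by (intro divide_right_mono) (auto simp: c_def)
      finally show "\<bar>quadrature_error f (X N)\<bar> \<le> c / real N powr (s / real d)" .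
    qed
    moreover have "c > 0" using C10 C2(1) by (simp add: c_def add_nonneg_pos)
    ultimately show "QMC_designs d q s a I X" unfolding QMC_designs_def by blast
  qed
qed

end

text \<open>
  All the notions involved see the family only through integrals over the sphere.
\<close>

lemma QMC_designs_cong:
  fixes Y q :: "nat \<Rightarrow> nat \<Rightarrow> 'a::euclidean_space \<Rightarrow> real"
  assumes "\<And>l k x. k \<in> harmonic_indices d l \<Longrightarrow> x \<in> sphere 0 1 \<Longrightarrow> Y l k x = q l k x"
  shows "QMC_designs d Y s a I X = QMC_designs d q s a I X"
proof -
  have fc: "fourier_coeff Y f l k = fourier_coeff q f l k" if "k \<in> harmonic_indices d l" for f l k
    unfolding fourier_coeff_def using assms that by (intro integral_sphere_cong) simp
  have "sobolev_space d Y s = sobolev_space d q s"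
    unfolding sobolev_space_def by (simp add: fc cong: sum.cong)
  moreover have "sobolev_norm d Y a f = sobolev_norm d q a f" for f
    unfolding sobolev_norm_def by (simp add: fc cong: sum.cong)
  ultimately show ?thesis by (simp add: QMC_designs_def worst_case_error_def)
qed

theorem theorem15:
  fixes d :: nat and s :: real and a :: "nat \<Rightarrow> real"
    and Y :: "nat \<Rightarrow> nat \<Rightarrow> 'a::euclidean_space \<Rightarrow> real"
    and I :: "nat set" and X :: "nat \<Rightarrow> 'a set" and x :: "nat \<Rightarrow> nat \<Rightarrow> 'a" and t :: "nat \<Rightarrow> nat"
  assumes "DIM('a) = d + 1" and "d \<ge> 2" and "s > real d / 2"
    and "orthonormal_spherical_harmonics d Y"
    and "\<And>l. a l > 0" and "comparable_on UNIV a (\<lambda>l. (1 + eigval d l) powr (- s))"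
    and "configurations I X" and "\<And>N. N \<in> I \<Longrightarrow> bij_betw (\<lambda>j. x j N) {1..N} (X N)"
    and "property_R d I X"
    and "\<And>N. N \<in> I \<Longrightarrow> t N \<ge> 1"
    and "comparable_on I (\<lambda>N. real (t N)) (\<lambda>N. real N powr (1 / real d))"
  shows "QMC_designs d Y s a I X \<longleftrightarrow>
    (\<lambda>N. 1 / (real N)\<^sup>2 * (\<Sum>j=1..N. \<Sum>i=1..N. truncated_kernel d a (t N) (x j N \<bullet> x i N)))
      \<in> O[inf at_top (principal I)](\<lambda>N. real N powr (- 2 * s / real d))"
proof -
  have "\<forall>l k. \<exists>p. k \<in> harmonic_indices d l \<longrightarrow> solid_harmonic l p \<and> (\<forall>x\<in>sphere 0 1. Y l k x = p x)"
  proof (intro allI)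
    fix l k
    show "\<exists>p. k \<in> harmonic_indices d l \<longrightarrow> solid_harmonic l p \<and> (\<forall>x\<in>sphere 0 1. Y l k x = p x)"
    proof (cases "k \<in> harmonic_indices d l")
      case True
      then have "spherical_harmonic l (Y l k)"
        using assms(4) unfolding orthonormal_spherical_harmonics_def by blast
      then obtain p where "real_polynomial_function p" "\<forall>c x. p (c *\<^sub>R x) = c ^ l * p x"
        "\<forall>x. laplacian p x = 0" "\<forall>x\<in>sphere 0 1. Y l k x = p x"
        unfolding spherical_harmonic_def by blast
      then show ?thesis by (intro exI[of _ p]) (auto simp: solid_harmonic_def homogeneous_def)
    qed simp
  qed
  then obtain q where q: "\<And>l k. k \<in> harmonic_indices d l \<Longrightarrow> solid_harmonic l (q l k)"
    "\<And>l k x. k \<in> harmonic_indices d l \<Longrightarrow> x \<in> sphere 0 1 \<Longrightarrow> Y l k x = q l k x" by metis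
  interpret sobolev_harmonics d q s a
  proof
    fix l k k' assume k: "k \<in> harmonic_indices d l" "k' \<in> harmonic_indices d l"
    have "(\<integral>x. q l k x * q l k' x \<partial>sphere_measure) = (\<integral>x. Y l k x * Y l k' x \<partial>sphere_measure)"
      using q(2) k by (intro integral_sphere_cong) simp
    then show "(\<integral>x. q l k x * q l k' x \<partial>sphere_measure) = (if k = k' then 1 else 0)"
      using assms(4) k unfolding orthonormal_spherical_harmonics_def by simp
  qed (use assms q in auto)
  have "QMC_designs d Y s a I X = QMC_designs d q s a I X"
    by (rule QMC_designs_cong) (rule q(2))
  then show ?thesis
    using QMC_designs_iff[OF assms(7-11)] by (simp only:)
qed

end
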